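(* Let $P,F,A_I,A_O,B_I,B_O,E_A,E_B$ be finite-dimensional Hilbert spaces with $d_{A_I}=d_{A_O}=:d_A$, $d_{B_I}=d_{B_O}=:d_B$, and $d_P=d_F=d_Ad_{E_A}=d_Bd_{E_B}$. Let $(\Pi_A,\Phi_A)$ be a frame function for Alice and $(\Pi_B,\Phi_B)$ a frame function for Bob which are consistent, i.e. for all unitaries $U_A:A_I\to A_O$, $U_B:B_I\to B_O$, $$\Phi_A(U_B)(U_A\otimes\mathbb{1}^{E_A})\Pi_A(U_B)=\Phi_B(U_A)(U_B\otimes\mathbb{1}^{E_B})\Pi_B(U_A)=:\mathcal{G}(U_A,U_B).$$ Let $\{U_i:A_I\to A_O\}_{i=1}^{d_A^2}$ and $\{V_j:B_I\to B_O\}_{j=1}^{d_B^2}$ be orthonormal bases of unitaries, and define $$|w\rangle=\frac{1}{d_Ad_B}\sum_{i,j}|\mathcal{G}(U_i,V_j)\rangle\!\rangle^{PF}|U_i^*\rangle\!\rangle^{A_IA_O}|V_j^*\rangle\!\rangle^{B_IB_O}.$$ Then $W=|w\rangle\langle w|$ is a valid process matrix and is pure.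
   Context: A frame function for Alice is a pair of functions $(\Pi_A,\Phi_A)$, each sending linear maps $T_B:B_I\to B_O$ to linear maps $\Pi_A(T_B):P\to A_I\otimes E_A$ and $\Phi_A(T_B):A_O\otimes E_A\to F$, such that $\Pi_A(U_B),\Phi_A(U_B)$ are unitary whenever $U_B$ is unitary (no linearity in $T_B$ is required). A frame function for Bob is defined symmetrically: $\Pi_B(T_A):P\to B_I\otimes E_B$, $\Phi_B(T_A):B_O\otimes E_B\to F$ for linear $T_A:A_I\to A_O$, unitary whenever $T_A$ is unitary. All Hilbert spaces are finite-dimensional with fixed computational bases; juxtaposition of spaces denotes tensor product. For a linear map $K:X\to Y$, $|K\rangle\!\rangle^{XY}=\sum_i|i\rangle^X\otimes(K|i\rangle)^Y$; $K^*$ is entrywise complex conjugation. A set $\{U_i\}_{i=1}^{d^2}$ of unitaries $X\to Y$ ($d=\dim X=\dim Y$) is an orthonormal basis of unitaries if $\{|U_i\rangle\!\rangle\}$ is a basis of $X\otimes Y$ and $\langle\!\langle U_i|U_j\rangle\!\rangle=d\,\delta_{ij}$. For an operator $W$ on $X\otimes Y$, $W^{T_X}$ is its partial transpose on $X$. The Choi operator of $\mathcal{M}:\mathcal{L}(X)\to\mathcal{L}(Y)$ is $\sum_{ij}|i\rangle\langle j|\otimes\mathcal{M}(|i\rangle\langle j|)$. A process matrix is an operator $W$ on $PFA_IA_OB_IB_O$ such that for all finite-dimensional ancilla spaces $A_I',A_O',B_I',B_O'$ and all CPTP maps $\mathcal{M}_x:\mathcal{L}(A_IA_I')\to\mathcal{L}(A_OA_O')$,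 $\mathcal{M}_y:\mathcal{L}(B_IB_I')\to\mathcal{L}(B_OB_O')$ with Choi operators $M_x,M_y$, the operator $\mathrm{tr}_{A_IA_OB_IB_O}\big(W^{T_{A_IA_OB_IB_O}}(M_x\otimes M_y)\big)$ is the Choi operator of a CPTP map from $PA_I'B_I'$ to $FA_O'B_O'$. It is pure if for all ancilla spaces with $d_{A_I}d_{A_I'}=d_{A_O}d_{A_O'}$, $d_{B_I}d_{B_I'}=d_{B_O}d_{B_O'}$, $d_Pd_{A_I'}d_{B_I'}=d_Fd_{A_O'}d_{B_O'}$, and all unitaries $U:A_IA_I'\to A_OA_O'$, $V:B_IB_I'\to B_OB_O'$, the operator $\mathrm{tr}_{A_IA_OB_IB_O}\big(W^{T_{A_IA_OB_IB_O}}(|U\rangle\!\rangle\langle\!\langle U|\otimes|V\rangle\!\rangle\langle\!\langle V|)\big)$ is the Choi operator of a unitary channel from $PA_I'B_I'$ to $FA_O'B_O'$. *)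

theory Defs
  imports Complex_Main "Jordan_Normal_Form.Matrix"
begin

text \<open>Conventions. A finite-dimensional Hilbert space with a fixed computational basis
is identified with its dimension; a linear map X -> Y is a complex matrix in
carrier_mat (dim Y) (dim X). Tensor products of spaces are encoded row-major
(the first factor is the most significant digit), which is the convention of kron.\<close>

definition adj :: "complex mat \<Rightarrow> complex mat" where
  "adj A = mat (dim_col A) (dim_row A) (\<lambda>(i,j). cnj (A $$ (j,i)))"

definition cconj :: "complex mat \<Rightarrow> complex mat" where
  "cconj A = mat (dim_row A) (dim_col A) (\<lambda>(i,j). cnj (A $$ (i,j)))"

definition unitary_map :: "nat \<Rightarrow> nat \<Rightarrow> complex mat \<Rightarrow> bool" where
  "unitary_map m n U \<longleftrightarrow> U \<in> carrier_mat n m \<and> adj U * U = 1\<^sub>m m \<and> U * adj U = 1\<^sub>m n"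

definition kron :: "complex mat \<Rightarrow> complex mat \<Rightarrow> complex mat" where
  "kron A B = mat (dim_row A * dim_row B) (dim_col A * dim_col B)
     (\<lambda>(i,j). A $$ (i div dim_row B, j div dim_col B) * B $$ (i mod dim_row B, j mod dim_col B))"

definition vkron :: "complex vec \<Rightarrow> complex vec \<Rightarrow> complex vec" where
  "vkron v w = vec (dim_vec v * dim_vec w) (\<lambda>i. v $ (i div dim_vec w) * w $ (i mod dim_vec w))"

text \<open>|K>>^{XY} = sum_i |i>^X (K|i>)^Y, for K : X -> Y\<close>
definition dket :: "complex mat \<Rightarrow> complex vec" where
  "dket K = vec (dim_col K * dim_row K) (\<lambda>k. K $$ (k mod dim_row K, k div dim_row K))"

definition cinner :: "complex vec \<Rightarrow> complex vec \<Rightarrow> complex" where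
  "cinner v w = (\<Sum>k<dim_vec v. cnj (v $ k) * w $ k)"

definition proj :: "complex vec \<Rightarrow> complex mat" where
  "proj v = mat (dim_vec v) (dim_vec v) (\<lambda>(i,j). v $ i * cnj (v $ j))"

definition psd :: "nat \<Rightarrow> complex mat \<Rightarrow> bool" where
  "psd n A \<longleftrightarrow> A \<in> carrier_mat n n \<and>
     (\<forall>v\<in>carrier_vec n. Im (cinner v (A *\<^sub>v v)) = 0 \<and> 0 \<le> Re (cinner v (A *\<^sub>v v)))"

definition superop :: "nat \<Rightarrow> nat \<Rightarrow> (complex mat \<Rightarrow> complex mat) \<Rightarrow> bool" where
  "superop m n M \<longleftrightarrow> (\<forall>X\<in>carrier_mat m m. M X \<in> carrier_mat n n) \<and>
     (\<forall>X\<in>carrier_mat m m. \<forall>Y\<in>carrier_mat m m. \<forall>a b.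
        M (a \<cdot>\<^sub>m X + b \<cdot>\<^sub>m Y) = a \<cdot>\<^sub>m M X + b \<cdot>\<^sub>m M Y)"

text \<open>block (a,b) of an operator on X (dim m) tensor K (dim k), w.r.t. the second factor\<close>
definition blk :: "nat \<Rightarrow> nat \<Rightarrow> complex mat \<Rightarrow> nat \<Rightarrow> nat \<Rightarrow> complex mat" where
  "blk m k \<rho> a b = mat m m (\<lambda>(i,j). \<rho> $$ (i * k + a, j * k + b))"

text \<open>(M tensor id_K) applied to rho, where K has dimension k\<close>
definition ext_id :: "nat \<Rightarrow> nat \<Rightarrow> (complex mat \<Rightarrow> complex mat) \<Rightarrow> nat \<Rightarrow> complex mat \<Rightarrow> complex mat" where
  "ext_id m n M k \<rho> = mat (n * k) (n * k)
     (\<lambda>(r,c). M (blk m k \<rho> (r mod k) (c mod k)) $$ (r div k, c div k))"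

definition mtrace :: "complex mat \<Rightarrow> complex" where
  "mtrace A = (\<Sum>i<dim_row A. A $$ (i,i))"

definition CPTP :: "nat \<Rightarrow> nat \<Rightarrow> (complex mat \<Rightarrow> complex mat) \<Rightarrow> bool" where
  "CPTP m n M \<longleftrightarrow> superop m n M \<and>
     (\<forall>k>0. \<forall>\<rho>. psd (m * k) \<rho> \<longrightarrow> psd (n * k) (ext_id m n M k \<rho>)) \<and>
     (\<forall>X\<in>carrier_mat m m. mtrace (M X) = mtrace X)"

definition unit_op :: "nat \<Rightarrow> nat \<Rightarrow> nat \<Rightarrow> complex mat" where
  "unit_op m i j = mat m m (\<lambda>(a,b). if a = i \<and> b = j then 1 else 0)"

text \<open>Choi operator sum_ij |i><j| tensor M(|i><j|) on X tensor Y\<close>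
definition choi :: "nat \<Rightarrow> nat \<Rightarrow> (complex mat \<Rightarrow> complex mat) \<Rightarrow> complex mat" where
  "choi m n M = mat (m * n) (m * n)
     (\<lambda>(r,c). M (unit_op m (r div n) (c div n)) $$ (r mod n, c mod n))"

definition is_CPTP_choi :: "nat \<Rightarrow> nat \<Rightarrow> complex mat \<Rightarrow> bool" where
  "is_CPTP_choi m n C \<longleftrightarrow> (\<exists>M. CPTP m n M \<and> choi m n M = C)"

definition is_unitary_choi :: "nat \<Rightarrow> nat \<Rightarrow> complex mat \<Rightarrow> bool" where
  "is_unitary_choi m n C \<longleftrightarrow> (\<exists>U. unitary_map m n U \<and> choi m n (\<lambda>\<rho>. U * \<rho> * adj U) = C)"

definition enc :: "nat list \<Rightarrow> nat list \<Rightarrow> nat" where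
  "enc ds is = foldl (\<lambda>acc (d, i). acc * d + i) 0 (zip ds is)"

fun dec :: "nat list \<Rightarrow> nat \<Rightarrow> nat list" where
  "dec [] k = []"
| "dec (d # ds) k = (k div prod_list ds) # dec ds (k mod prod_list ds)"

definition ptrans2 :: "nat \<Rightarrow> nat \<Rightarrow> complex mat \<Rightarrow> complex mat" where
  "ptrans2 dX dY W = mat (dX * dY) (dX * dY)
     (\<lambda>(r,c). W $$ ((r div dY) * dY + c mod dY, (c div dY) * dY + r mod dY))"

text \<open>tr_{A_I A_O B_I B_O}( W^{T_{A_I A_O B_I B_O}} (Mx tensor My) ), where W acts on
  P F A_I A_O B_I B_O, Mx on A_I A_I' A_O A_O', My on B_I B_I' B_O B_O'; the resulting
  operator on P F A_I' A_O' B_I' B_O' is written with its factors ordered as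
  (P A_I' B_I') (F A_O' B_O'), i.e. input system first, as a Choi operator.\<close>
definition link ::
  "nat \<Rightarrow> nat \<Rightarrow> nat \<Rightarrow> nat \<Rightarrow> nat \<Rightarrow> nat \<Rightarrow> nat \<Rightarrow> nat \<Rightarrow> nat \<Rightarrow> nat \<Rightarrow>
   complex mat \<Rightarrow> complex mat \<Rightarrow> complex mat \<Rightarrow> complex mat" where
  "link dP dF dAI dAO dBI dBO dAI' dAO' dBI' dBO' W Mx My =
    (let DR = [dP, dAI', dBI', dF, dAO', dBO'];
         DW = [dP, dF, dAI, dAO, dBI, dBO];
         DX = [dAI, dAI', dAO, dAO'];
         DY = [dBI, dBI', dBO, dBO'];
         WT = ptrans2 (dP * dF) (dAI * dAO * dBI * dBO) W;
         N = dP * dAI' * dBI' * dF * dAO' * dBO'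
     in mat N N (\<lambda>(r,c).
       let u = dec DR r; v = dec DR c in
       (\<Sum>ai<dAI. \<Sum>ao<dAO. \<Sum>bi<dBI. \<Sum>bo<dBO.
        \<Sum>ai2<dAI. \<Sum>ao2<dAO. \<Sum>bi2<dBI. \<Sum>bo2<dBO.
          WT $$ (enc DW [u!0, u!3, ai, ao, bi, bo], enc DW [v!0, v!3, ai2, ao2, bi2, bo2])
          * Mx $$ (enc DX [ai2, u!1, ao2, u!4], enc DX [ai, v!1, ao, v!4])
          * My $$ (enc DY [bi2, u!2, bo2, u!5], enc DY [bi, v!2, bo, v!5]))))"

definition process_matrix ::
  "nat \<Rightarrow> nat \<Rightarrow> nat \<Rightarrow> nat \<Rightarrow> nat \<Rightarrow> nat \<Rightarrow> complex mat \<Rightarrow> bool" where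
  "process_matrix dP dF dAI dAO dBI dBO W \<longleftrightarrow>
    W \<in> carrier_mat (dP * dF * dAI * dAO * dBI * dBO) (dP * dF * dAI * dAO * dBI * dBO) \<and>
    (\<forall>dAI' dAO' dBI' dBO' Mx My.
       0 < dAI' \<and> 0 < dAO' \<and> 0 < dBI' \<and> 0 < dBO' \<and>
       CPTP (dAI * dAI') (dAO * dAO') Mx \<and> CPTP (dBI * dBI') (dBO * dBO') My \<longrightarrow>
       is_CPTP_choi (dP * dAI' * dBI') (dF * dAO' * dBO')
         (link dP dF dAI dAO dBI dBO dAI' dAO' dBI' dBO' W
            (choi (dAI * dAI') (dAO * dAO') Mx) (choi (dBI * dBI') (dBO * dBO') My)))"

definition pure_process ::
  "nat \<Rightarrow> nat \<Rightarrow> nat \<Rightarrow> nat \<Rightarrow> nat \<Rightarrow> nat \<Rightarrow> complex mat \<Rightarrow> bool" where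
  "pure_process dP dF dAI dAO dBI dBO W \<longleftrightarrow>
    (\<forall>dAI' dAO' dBI' dBO' U V.
       0 < dAI' \<and> 0 < dAO' \<and> 0 < dBI' \<and> 0 < dBO' \<and>
       dAI * dAI' = dAO * dAO' \<and> dBI * dBI' = dBO * dBO' \<and>
       dP * dAI' * dBI' = dF * dAO' * dBO' \<and>
       unitary_map (dAI * dAI') (dAO * dAO') U \<and> unitary_map (dBI * dBI') (dBO * dBO') V \<longrightarrow>
       is_unitary_choi (dP * dAI' * dBI') (dF * dAO' * dBO')
         (link dP dF dAI dAO dBI dBO dAI' dAO' dBI' dBO' W (proj (dket U)) (proj (dket V))))"

definition frame_function_A ::
  "nat \<Rightarrow> nat \<Rightarrow> nat \<Rightarrow> nat \<Rightarrow> nat \<Rightarrow> nat \<Rightarrow> nat \<Rightarrow>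
   (complex mat \<Rightarrow> complex mat) \<Rightarrow> (complex mat \<Rightarrow> complex mat) \<Rightarrow> bool" where
  "frame_function_A dP dF dAI dAO dBI dBO dEA PiA PhiA \<longleftrightarrow>
    (\<forall>T\<in>carrier_mat dBO dBI. PiA T \<in> carrier_mat (dAI * dEA) dP \<and> PhiA T \<in> carrier_mat dF (dAO * dEA)) \<and>
    (\<forall>U. unitary_map dBI dBO U \<longrightarrow>
       unitary_map dP (dAI * dEA) (PiA U) \<and> unitary_map (dAO * dEA) dF (PhiA U))"

definition frame_function_B ::
  "nat \<Rightarrow> nat \<Rightarrow> nat \<Rightarrow> nat \<Rightarrow> nat \<Rightarrow> nat \<Rightarrow> nat \<Rightarrow>
   (complex mat \<Rightarrow> complex mat) \<Rightarrow> (complex mat \<Rightarrow> complex mat) \<Rightarrow> bool" where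
  "frame_function_B dP dF dAI dAO dBI dBO dEB PiB PhiB \<longleftrightarrow>
    (\<forall>T\<in>carrier_mat dAO dAI. PiB T \<in> carrier_mat (dBI * dEB) dP \<and> PhiB T \<in> carrier_mat dF (dBO * dEB)) \<and>
    (\<forall>U. unitary_map dAI dAO U \<longrightarrow>
       unitary_map dP (dBI * dEB) (PiB U) \<and> unitary_map (dBO * dEB) dF (PhiB U))"

definition onb_unitaries :: "nat \<Rightarrow> (nat \<Rightarrow> complex mat) \<Rightarrow> bool" where
  "onb_unitaries d U \<longleftrightarrow>
    (\<forall>i<d^2. unitary_map d d (U i)) \<and>
    (\<forall>v\<in>carrier_vec (d * d). \<exists>c. \<forall>k<d * d. v $ k = (\<Sum>i<d^2. c i * dket (U i) $ k)) \<and>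
    (\<forall>c. (\<forall>k<d * d. (\<Sum>i<d^2. c i * dket (U i) $ k) = 0) \<longrightarrow> (\<forall>i<d^2. c i = 0)) \<and>
    (\<forall>i<d^2. \<forall>j<d^2. cinner (dket (U i)) (dket (U j)) = (if i = j then of_nat d else 0))"

end

theory Submission
  imports Defs "Jordan_Normal_Form.Determinant"
begin

text \<open>
  Write \<open>L(X, Y)\<close> for the bilinear extension of \<open>G\<close> from the two unitary bases; its coefficients are the
  entries of \<open>w\<close>. Consistency gives \<open>L(X, V) = \<Phi>\<^sub>A(V) (X \<otimes> 1) \<Pi>\<^sub>A(V)\<close> for unitary \<open>V\<close> and arbitrary \<open>X\<close>,
  and symmetrically for unitary \<open>X\<close>. Everything reduces to one identity: the sesquilinear form
  \<open>L(X, Y)\<^sup>* L(X', Y')\<close>, extended linearly to pairs of tensors, maps trace-preserving pairs to the identity.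
  Subtracting the identity tensors, this says that the form vanishes on pairs of tensors with zero
  contraction, i.e. on the combinations of \<open>X \<otimes> X'\<close> whose value \<open>X\<^sup>* X'\<close> is zero.

  For a reflection \<open>H\<close> on \<open>B\<close> and an ancilla, \<open>X \<mapsto> L(X, H)\<close> maps unitaries to unitaries, so on each
  two-by-two block of \<open>X\<close> it is a Jordan homomorphism, up to a unitary factor. Its antimultiplicative part is
  measured by a defect \<open>Z\<close> with \<open>Z\<^sup>3 = 4 Z\<close>. The defect of the unitary \<open>(3 + 4 i H) / 5\<close> is \<open>16/25\<close> times the
  defect of \<open>H\<close>, because the cross terms cancel. Both satisfy the cubic equation, hence \<open>Z = 0\<close>. Suitable
  reflections \<open>H\<close> then generate all tensors with zero contraction.

  Complete positivity of the link product follows from Gram decompositions of the Choi operators; the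
  process is pure because an isometry between spaces of equal dimension is unitary.
\<close>

section \<open>Kernels and block Pauli frames\<close>

text \<open>The hypotheses control the form only when one party applies a plain unitary, while a
  process matrix must accept ancillas on both sides at once. For a fixed unitary \<open>V\<close> on
  \<open>B\<close> and an ancilla, what is known of \<open>X \<mapsto> L(X, V)\<close> is that it
  sends unitaries to unitaries. Transposition does this too, and it fails as soon as
  \<open>A\<close> also has an ancilla. The difficulty is therefore to exclude an antimultiplicative
  part. This is done by comparing two operators \<open>V\<close> whose Gram tensors differ by a
  factor \<open>t\<close> outside -1, 0, 1, up to tensors on which the form is already known to
  vanish: then \<open>Z\<close> and \<open>t Z\<close> both satisfy the cubic equation only if
  \<open>Z = 0\<close>. A reflection and its rotation are such a pair. The numbers 3/5 and 4/5 are
  rational coordinates of a unit vector, and \<open>t\<close> is the square of 4/5.\<close>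

lemma kernel_left_right_inverse:
  fixes A B :: "'i \<Rightarrow> 'i \<Rightarrow> complex"
  assumes fin: "finite I"
    and AB: "\<And>i j. i \<in> I \<Longrightarrow> j \<in> I \<Longrightarrow> (\<Sum>k\<in>I. A i k * B k j) = (if i = j then 1 else 0)"
    and ij: "i \<in> I" "j \<in> I"
  shows "(\<Sum>k\<in>I. B i k * A k j) = (if i = j then 1 else 0)"
proof -
  define n where "n = card I"
  obtain h where h: "bij_betw h {..<n} I"
    using ex_bij_betw_nat_finite[OF fin] unfolding n_def atLeast0LessThan by blast
  have hI: "h s \<in> I" if "s < n" for s
    using h that by (auto simp: bij_betw_def)
  have hinj: "h s = h t \<longleftrightarrow> s = t" if "s < n" "t < n" for s t
    using h that by (auto simp: bij_betw_def inj_on_def)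
  define MA MB where "MA = mat n n (\<lambda>(s,t). A (h s) (h t))" and "MB = mat n n (\<lambda>(s,t). B (h s) (h t))"
  have sumI: "(\<Sum>k\<in>I. f k) = (\<Sum>k<n. f (h k))" for f :: "'i \<Rightarrow> complex"
    using sum.reindex_bij_betw[OF h, of f] by simp
  have "MA * MB = 1\<^sub>m n"
  proof (rule eq_matI)
    fix s t assume st: "s < dim_row (1\<^sub>m n :: complex mat)" "t < dim_col (1\<^sub>m n :: complex mat)"
    show "(MA * MB) $$ (s,t) = 1\<^sub>m n $$ (s,t)"
      using st AB[of "h s" "h t"] hI hinj
      by (simp add: MA_def MB_def scalar_prod_def sumI atLeast0LessThan)
  qed (auto simp: MA_def MB_def)
  then have BA: "MB * MA = 1\<^sub>m n"
    using mat_mult_left_right_inverse[of MA n MB] by (simp add: MA_def MB_def)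
  obtain s t where st: "s < n" "i = h s" "t < n" "j = h t"
    using ij h by (auto simp: bij_betw_def)
  have "(\<Sum>k\<in>I. B i k * A k j) = (MB * MA) $$ (s,t)"
    using st by (simp add: MA_def MB_def scalar_prod_def sumI atLeast0LessThan)
  then show ?thesis
    using st BA hinj by simp
qed

text \<open>Matrix product over index sets that are not intervals: the index is later a pair of a
  matrix index and an ancilla index.\<close>

definition kmul :: "'i set \<Rightarrow> ('i \<Rightarrow> 'i \<Rightarrow> complex) \<Rightarrow> ('i \<Rightarrow> 'i \<Rightarrow> complex) \<Rightarrow> 'i \<Rightarrow> 'i \<Rightarrow> complex" where
  "kmul I A B = (\<lambda>i j. \<Sum>k\<in>I. A i k * B k j)"

lemma kmul_assoc: "kmul I (kmul I A B) C = kmul I A (kmul I B C)"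
proof (intro ext)
  fix i j
  have "kmul I (kmul I A B) C i j = (\<Sum>k\<in>I. \<Sum>m\<in>I. A i m * B m k * C k j)"
    by (simp add: kmul_def sum_distrib_right)
  also have "\<dots> = (\<Sum>m\<in>I. \<Sum>k\<in>I. A i m * B m k * C k j)"
    by (rule sum.swap)
  also have "\<dots> = kmul I A (kmul I B C) i j"
    by (simp add: kmul_def sum_distrib_left mult.assoc)
  finally show "kmul I (kmul I A B) C i j = kmul I A (kmul I B C) i j" .
qed

lemma kmul_scale_left: "kmul I (\<lambda>i j. c * A i j) B = (\<lambda>i j. c * kmul I A B i j)"
  by (simp add: kmul_def sum_distrib_left mult.assoc)

lemma kmul_scale_right: "kmul I A (\<lambda>i j. c * B i j) = (\<lambda>i j. c * kmul I A B i j)"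
  by (simp add: kmul_def sum_distrib_left mult.left_commute)

lemma kmul_add_left: "kmul I (\<lambda>i j. A i j + A' i j) B = (\<lambda>i j. kmul I A B i j + kmul I A' B i j)"
  by (simp add: kmul_def sum.distrib distrib_right)

lemma kmul_add_right: "kmul I A (\<lambda>i j. B i j + B' i j) = (\<lambda>i j. kmul I A B i j + kmul I A B' i j)"
  by (simp add: kmul_def sum.distrib distrib_left)

text \<open>The coefficients \<^term>\<open>c\<close> describe the direct sum of the two-by-two matrix
  \<open>c 0 + c 1 \<sigma>\<^sub>x + c 2 \<sigma>\<^sub>y + c 3 \<sigma>\<^sub>z\<close> and the phase \<^term>\<open>c 4\<close>; the predicate says that
  this direct sum is unitary.\<close>
definition pauli_unitary :: "(nat \<Rightarrow> complex) \<Rightarrow> bool" where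
  "pauli_unitary c \<longleftrightarrow>
     cnj (c 0 + c 3) * (c 0 + c 3) + cnj (c 1 + \<i> * c 2) * (c 1 + \<i> * c 2) = 1 \<and>
     cnj (c 1 - \<i> * c 2) * (c 1 - \<i> * c 2) + cnj (c 0 - c 3) * (c 0 - c 3) = 1 \<and>
     cnj (c 0 + c 3) * (c 1 - \<i> * c 2) + cnj (c 1 + \<i> * c 2) * (c 0 - c 3) = 0 \<and>
     cnj (c 4) * c 4 = 1"

text \<open>\<open>L \<mu>\<close> stands for the image of the \<open>\<mu>\<close>-th block matrix
  under a linear map, of which \<open>unit\<close> says only that unitary combinations go to
  isometries.\<close>

locale pauli_frame =
  fixes I :: "'i set" and L :: "nat \<Rightarrow> 'i \<Rightarrow> 'i \<Rightarrow> complex"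
  assumes fin: "finite I"
    and unit: "\<And>c i j. pauli_unitary c \<Longrightarrow> i \<in> I \<Longrightarrow> j \<in> I \<Longrightarrow>
      (\<Sum>\<mu><5. \<Sum>\<nu><5. cnj (c \<mu>) * c \<nu> * (\<Sum>s\<in>I. cnj (L \<mu> s i) * L \<nu> s j)) = (if i = j then 1 else 0)"
begin

definition J :: "nat \<Rightarrow> nat \<Rightarrow> 'i \<Rightarrow> 'i \<Rightarrow> complex" where
  "J \<mu> \<nu> = (\<lambda>i j. \<Sum>s\<in>I. cnj (L \<mu> s i) * L \<nu> s j)"

lemma sum_lessThan_5: "(\<Sum>\<mu><5. f \<mu>) = f 0 + f 1 + f 2 + f 3 + f (4::nat)"
  for f :: "nat \<Rightarrow> complex"
  by (simp add: eval_nat_numeral)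

lemma unit_J:
  assumes "pauli_unitary ((!) [a0,a1,a2,a3,a4])" "i \<in> I" "j \<in> I"
  shows
   "cnj a0 * a0 * J 0 0 i j + cnj a0 * a1 * J 0 1 i j + cnj a0 * a2 * J 0 2 i j + cnj a0 * a3 * J 0 3 i j + cnj a0 * a4 * J 0 4 i j +
   (cnj a1 * a0 * J 1 0 i j + cnj a1 * a1 * J 1 1 i j + cnj a1 * a2 * J 1 2 i j + cnj a1 * a3 * J 1 3 i j + cnj a1 * a4 * J 1 4 i j) +
   (cnj a2 * a0 * J 2 0 i j + cnj a2 * a1 * J 2 1 i j + cnj a2 * a2 * J 2 2 i j + cnj a2 * a3 * J 2 3 i j + cnj a2 * a4 * J 2 4 i j) +
   (cnj a3 * a0 * J 3 0 i j + cnj a3 * a1 * J 3 1 i j + cnj a3 * a2 * J 3 2 i j + cnj a3 * a3 * J 3 3 i j + cnj a3 * a4 * J 3 4 i j) +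
   (cnj a4 * a0 * J 4 0 i j + cnj a4 * a1 * J 4 1 i j + cnj a4 * a2 * J 4 2 i j + cnj a4 * a3 * J 4 3 i j + cnj a4 * a4 * J 4 4 i j)
    = (if i = j then 1 else 0)"
  using unit[OF assms] unfolding sum_lessThan_5 J_def by simp

text \<open>Polarization of \<open>unit\<close> at a few unitaries. The phases 1, -1,
  \<open>\<i>\<close> in the fifth slot isolate the mixed terms with it; then one pair of Pauli
  matrices at a time is mixed with weights 3/5 and 4/5. The sign of \<open>J 1 2\<close> relative to
  \<open>J 0 3\<close> stays open, as it differs between a representation and its transpose.\<close>

lemma J_linear_relations:
  assumes ij: "i \<in> I" "j \<in> I"
  shows "\<mu> < 4 \<Longrightarrow> J \<mu> 4 i j = 0" and "\<mu> < 4 \<Longrightarrow> J 4 \<mu> i j = 0"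
    and "\<mu> < 4 \<Longrightarrow> J \<mu> \<mu> i j = J 0 0 i j"
    and "\<mu> < 4 \<Longrightarrow> J \<mu> 0 i j = J 0 \<mu> i j"
    and "J 2 1 i j = - J 1 2 i j" "J 3 1 i j = - J 1 3 i j" "J 3 2 i j = - J 2 3 i j"
    and "J 0 0 i j + J 4 4 i j = (if i = j then 1 else 0)"
proof -
  define d :: complex where "d = (if i = j then 1 else 0)"
  note U = unit_J[OF _ ij, folded d_def]
  have diag: "J \<mu> \<mu> i j + J 4 4 i j = d \<and> J \<mu> 4 i j = 0 \<and> J 4 \<mu> i j = 0" if m: "\<mu> < 4" for \<mu>
  proof -
    have E: "J \<mu> \<mu> i j + t * J \<mu> 4 i j + cnj t * J 4 \<mu> i j + J 4 4 i j = d"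
      if t: "cnj t * t = 1" for t
    proof -
      consider "\<mu> = 0" | "\<mu> = 1" | "\<mu> = 2" | "\<mu> = 3" using m by linarith
      then show ?thesis
      proof cases
        case 1 have "pauli_unitary ((!) [1,0,0,0,t])" using t by (simp add: pauli_unitary_def)
        from U[OF this] show ?thesis using t 1 by (simp add: mult.commute[of t] add.assoc)
      next
        case 2 have "pauli_unitary ((!) [0,1,0,0,t])" using t by (simp add: pauli_unitary_def)
        from U[OF this] show ?thesis using t 2 by (simp add: mult.commute[of t] add.assoc)
      next
        case 3 have "pauli_unitary ((!) [0,0,1,0,t])" using t by (simp add: pauli_unitary_def)
        from U[OF this] show ?thesis using t 3 by (simp add: mult.commute[of t] add.assoc)
      next
        case 4 have "pauli_unitary ((!) [0,0,0,1,t])" using t by (simp add: pauli_unitary_def)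
        from U[OF this] show ?thesis using t 4 by (simp add: mult.commute[of t] add.assoc)
      qed
    qed
    have e: "J \<mu> \<mu> i j + J \<mu> 4 i j + J 4 \<mu> i j + J 4 4 i j = d"
      "J \<mu> \<mu> i j - J \<mu> 4 i j - J 4 \<mu> i j + J 4 4 i j = d"
      "J \<mu> \<mu> i j + \<i> * J \<mu> 4 i j - \<i> * J 4 \<mu> i j + J 4 4 i j = d"
      using E[of 1] E[of "-1"] E[of \<i>] by simp_all
    then show ?thesis by (simp add: complex_eq_iff)
  qed
  show "\<mu> < 4 \<Longrightarrow> J \<mu> 4 i j = 0" "\<mu> < 4 \<Longrightarrow> J 4 \<mu> i j = 0" for \<mu> using diag by blast+
  show "J 0 0 i j + J 4 4 i j = (if i = j then 1 else 0)" using diag[of 0] by (simp add: d_def)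
  show eq: "J \<mu> \<mu> i j = J 0 0 i j" if "\<mu> < 4" for \<mu>
    using diag[of \<mu>] diag[of 0] that by (metis add_right_cancel zero_less_numeral)
  have z: "J 0 4 i j = 0" "J 1 4 i j = 0" "J 2 4 i j = 0" "J 3 4 i j = 0"
     "J 4 0 i j = 0" "J 4 1 i j = 0" "J 4 2 i j = 0" "J 4 3 i j = 0"
    using diag by simp_all
  have q: "J 1 1 i j = J 0 0 i j" "J 2 2 i j = J 0 0 i j" "J 3 3 i j = J 0 0 i j"
     "J 4 4 i j = d - J 0 0 i j"
    using eq[of 1] eq[of 2] eq[of 3] diag[of 0] by (simp_all add: algebra_simps)
  have fin: "x = y" if "12 * \<i> * (x - y) = 0" for x y :: complex
    using that by simp
  have neg: "x = - y" if "12 * (y + x) = 0" for x y :: complex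
    using that by (simp add: complex_eq_iff)
  show "J \<mu> 0 i j = J 0 \<mu> i j" if m: "\<mu> < 4" for \<mu>
  proof -
    consider "\<mu> = 0" | "\<mu> = 1" | "\<mu> = 2" | "\<mu> = 3" using m by linarith
    then show ?thesis
    proof cases
      case 2
      \<comment> \<open>The instance of \<open>unit\<close> multiplied by 25; the diagonal terms
        cancel. The identity commutes with a Pauli matrix, so unitarity requires the factor
        \<open>\<i>\<close>; two anticommuting Pauli matrices are mixed with real weights further
        down.\<close>
      have "9 * J 0 0 i j + 12 * \<i> * J 0 1 i j - 12 * \<i> * J 1 0 i j + 16 * J 0 0 i j + 25 * (d - J 0 0 i j) = 25 * d"
        proof -
      have "pauli_unitary ((!) [3/5,4/5*\<i>,0,0,1])" by (simp add: pauli_unitary_def algebra_simps)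
      from U[OF this] show ?thesis unfolding z q by (simp add: complex_eq_iff)
    qed
      then show ?thesis using 2 fin[of "J 1 0 i j" "J 0 1 i j"] by (simp add: algebra_simps)
    next
      case 3
      have "9 * J 0 0 i j + 12 * \<i> * J 0 2 i j - 12 * \<i> * J 2 0 i j + 16 * J 0 0 i j + 25 * (d - J 0 0 i j) = 25 * d"
        proof -
      have "pauli_unitary ((!) [3/5,0,4/5*\<i>,0,1])" by (simp add: pauli_unitary_def algebra_simps)
      from U[OF this] show ?thesis unfolding z q by (simp add: complex_eq_iff)
    qed
      then show ?thesis using 3 fin[of "J 2 0 i j" "J 0 2 i j"] by (simp add: algebra_simps)
    next
      case 4
      have "9 * J 0 0 i j + 12 * \<i> * J 0 3 i j - 12 * \<i> * J 3 0 i j + 16 * J 0 0 i j + 25 * (d - J 0 0 i j) = 25 * d"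
        proof -
      have "pauli_unitary ((!) [3/5,0,0,4/5*\<i>,1])" by (simp add: pauli_unitary_def algebra_simps)
      from U[OF this] show ?thesis unfolding z q by (simp add: complex_eq_iff)
    qed
      then show ?thesis using 4 fin[of "J 3 0 i j" "J 0 3 i j"] by (simp add: algebra_simps)
    qed simp
  qed
  have "9 * J 0 0 i j + 12 * J 1 2 i j + 12 * J 2 1 i j + 16 * J 0 0 i j + 25 * (d - J 0 0 i j) = 25 * d"
    proof -
      have "pauli_unitary ((!) [0,3/5,4/5,0,1])" by (simp add: pauli_unitary_def algebra_simps)
      from U[OF this] show ?thesis unfolding z q by (simp add: complex_eq_iff)
    qed
  then show "J 2 1 i j = - J 1 2 i j" using neg[of "J 1 2 i j" "J 2 1 i j"] by (simp add: algebra_simps)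
  have "9 * J 0 0 i j + 12 * J 1 3 i j + 12 * J 3 1 i j + 16 * J 0 0 i j + 25 * (d - J 0 0 i j) = 25 * d"
    proof -
      have "pauli_unitary ((!) [0,3/5,0,4/5,1])" by (simp add: pauli_unitary_def algebra_simps)
      from U[OF this] show ?thesis unfolding z q by (simp add: complex_eq_iff)
    qed
  then show "J 3 1 i j = - J 1 3 i j" using neg[of "J 1 3 i j" "J 3 1 i j"] by (simp add: algebra_simps)
  have "9 * J 0 0 i j + 12 * J 2 3 i j + 12 * J 3 2 i j + 16 * J 0 0 i j + 25 * (d - J 0 0 i j) = 25 * d"
    proof -
      have "pauli_unitary ((!) [0,0,3/5,4/5,1])" by (simp add: pauli_unitary_def algebra_simps)
      from U[OF this] show ?thesis unfolding z q by (simp add: complex_eq_iff)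
    qed
  then show "J 3 2 i j = - J 2 3 i j" using neg[of "J 2 3 i j" "J 3 2 i j"] by (simp add: algebra_simps)
qed

end

context pauli_frame
begin

abbreviation km :: "('i \<Rightarrow> 'i \<Rightarrow> complex) \<Rightarrow> ('i \<Rightarrow> 'i \<Rightarrow> complex) \<Rightarrow> 'i \<Rightarrow> 'i \<Rightarrow> complex"  (infixl "\<bullet>" 70) where
  "A \<bullet> B \<equiv> kmul I A B"

text \<open>\<^term>\<open>L 0\<close> and \<^term>\<open>L 4\<close> sum to a unitary, whose inverse can be inserted in the middle.\<close>
lemma J_factor:
  assumes "\<mu> < 4" "\<nu> < 4" and ij: "i \<in> I" "j \<in> I"
  shows "(J \<mu> 0 \<bullet> J 0 \<nu>) i j = J \<mu> \<nu> i j"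
proof -
  define E where "E = (\<lambda>s i. L 0 s i + L 4 s i)"
  have J_E: "(\<Sum>s\<in>I. cnj (L \<mu> s i) * E s k) = J \<mu> 0 i k" if "\<mu> < 4" "i \<in> I" "k \<in> I" for \<mu> i k
    using J_linear_relations(1)[of i k \<mu>] that by (simp add: E_def J_def distrib_left sum.distrib)
  have E_J: "(\<Sum>s\<in>I. cnj (E s k) * L \<mu> s i) = J 0 \<mu> k i" if "\<mu> < 4" "i \<in> I" "k \<in> I" for \<mu> i k
    using J_linear_relations(2)[of k i \<mu>] that by (simp add: E_def J_def distrib_right sum.distrib)
  have EE: "(\<Sum>s\<in>I. cnj (E s i) * E s j) = (if i = j then 1 else 0)" if "i \<in> I" "j \<in> I" for i j
  proof -
    have "(\<Sum>s\<in>I. cnj (E s i) * E s j) = J 0 0 i j + J 0 4 i j + (J 4 0 i j + J 4 4 i j)"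
      by (simp add: E_def J_def distrib_left distrib_right sum.distrib algebra_simps)
    then show ?thesis using J_linear_relations(1,2,8)[OF that] by simp
  qed
  have EE': "(\<Sum>k\<in>I. E s k * cnj (E t k)) = (if s = t then 1 else 0)" if "s \<in> I" "t \<in> I" for s t
    using kernel_left_right_inverse[OF fin, of "\<lambda>i s. cnj (E s i)" E s t] EE that by simp
  have "(J \<mu> 0 \<bullet> J 0 \<nu>) i j
      = (\<Sum>k\<in>I. (\<Sum>s\<in>I. cnj (L \<mu> s i) * E s k) * (\<Sum>t\<in>I. cnj (E t k) * L \<nu> t j))"
    using assms by (simp add: kmul_def J_E E_J)
  also have "\<dots> = (\<Sum>k\<in>I. \<Sum>s\<in>I. \<Sum>t\<in>I. cnj (L \<mu> s i) * L \<nu> t j * (E s k * cnj (E t k)))"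
    by (simp add: sum_product algebra_simps)
  also have "\<dots> = (\<Sum>s\<in>I. \<Sum>t\<in>I. \<Sum>k\<in>I. cnj (L \<mu> s i) * L \<nu> t j * (E s k * cnj (E t k)))"
    by (subst sum.swap, rule sum.cong[OF refl], rule sum.swap)
  also have "\<dots> = (\<Sum>s\<in>I. \<Sum>t\<in>I. cnj (L \<mu> s i) * L \<nu> t j * (if s = t then 1 else 0))"
    by (simp add: EE' flip: sum_distrib_left)
  also have "\<dots> = J \<mu> \<nu> i j"
    using fin by (simp add: J_def if_distrib cong: if_cong)
  finally show ?thesis .
qed

text \<open>The extension by 0 turns relations on \<open>I\<close> into equations between functions,
  which can be rewritten. \<open>N 0\<close> is the unit for these products, but only a projection:
  \<open>J 4 4\<close> takes the rest of the space.\<close>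

definition N :: "nat \<Rightarrow> 'i \<Rightarrow> 'i \<Rightarrow> complex" where
  "N \<mu> = (\<lambda>i j. if i \<in> I \<and> j \<in> I then J 0 \<mu> i j else 0)"

text \<open>Hermiticity of \<open>N \<mu>\<close>, in the form \<open>J \<mu> 0 = J 0 \<mu>\<close>,
  turns \<open>J_factor\<close> into a product rule, from which the Clifford relations of the Pauli
  matrices follow.\<close>

lemma N_mult:
  assumes "\<mu> < 4" "\<nu> < 4"
  shows "N \<mu> \<bullet> N \<nu> = (\<lambda>i j. if i \<in> I \<and> j \<in> I then J \<mu> \<nu> i j else 0)"
proof (intro ext)
  fix i j
  show "(N \<mu> \<bullet> N \<nu>) i j = (if i \<in> I \<and> j \<in> I then J \<mu> \<nu> i j else 0)"
  proof (cases "i \<in> I \<and> j \<in> I")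
    case True
    then have "(N \<mu> \<bullet> N \<nu>) i j = (J \<mu> 0 \<bullet> J 0 \<nu>) i j"
      unfolding kmul_def using assms by (intro sum.cong) (auto simp: N_def J_linear_relations(4))
    then show ?thesis using True assms by (simp add: J_factor)
  qed (auto simp: N_def kmul_def)
qed

lemma N_unit_left: "\<mu> < 4 \<Longrightarrow> N 0 \<bullet> N \<mu> = N \<mu>"
  by (simp add: N_mult) (simp add: N_def)

lemma N_unit_right: "\<mu> < 4 \<Longrightarrow> N \<mu> \<bullet> N 0 = N \<mu>"
  by (simp add: N_mult) (auto simp: N_def fun_eq_iff intro: J_linear_relations(4))

lemma N_square: "\<mu> < 4 \<Longrightarrow> N \<mu> \<bullet> N \<mu> = N 0"
  by (simp add: N_mult) (auto simp: N_def fun_eq_iff intro: J_linear_relations(3))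

lemma N_anticomm:
  "N 2 \<bullet> N 1 = (\<lambda>i j. - 1 * (N 1 \<bullet> N 2) i j)"
  "N 3 \<bullet> N 1 = (\<lambda>i j. - 1 * (N 1 \<bullet> N 3) i j)"
  "N 3 \<bullet> N 2 = (\<lambda>i j. - 1 * (N 2 \<bullet> N 3) i j)"
  by (simp_all add: N_mult del: One_nat_def) (auto simp: J_linear_relations(5,6,7) fun_eq_iff simp del: One_nat_def)

text \<open>A second candidate for the third Pauli matrix: \<open>T\<close> equals
  \<open>- N 3\<close> on a multiplicative part and \<open>N 3\<close> on an antimultiplicative
  one.\<close>

definition T :: "'i \<Rightarrow> 'i \<Rightarrow> complex" where
  "T = (\<lambda>i j. \<i> * (N 1 \<bullet> N 2) i j)"

lemma T_unit: "T \<bullet> N 0 = T"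
  by (simp add: T_def kmul_scale_left kmul_assoc N_unit_right)

lemma T_square: "T \<bullet> T = N 0"
proof -
  have "N 1 \<bullet> N 2 \<bullet> (N 1 \<bullet> N 2) = N 1 \<bullet> (N 2 \<bullet> N 1) \<bullet> N 2"
    by (simp add: kmul_assoc)
  also have "\<dots> = (\<lambda>i j. - 1 * ((N 1 \<bullet> N 1) \<bullet> (N 2 \<bullet> N 2)) i j)"
    unfolding N_anticomm kmul_scale_left kmul_scale_right by (simp add: kmul_assoc)
  also have "\<dots> = (\<lambda>i j. - 1 * N 0 i j)"
    by (simp add: N_square N_unit_left)
  finally show ?thesis
    by (simp add: T_def kmul_scale_left kmul_scale_right fun_eq_iff)
qed

lemma T_comm: "N 3 \<bullet> T = T \<bullet> N 3"
proof -
  have "N 3 \<bullet> (N 1 \<bullet> N 2) = (N 3 \<bullet> N 1) \<bullet> N 2"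
    by (simp add: kmul_assoc)
  also have "\<dots> = (\<lambda>i j. - 1 * (N 1 \<bullet> (N 3 \<bullet> N 2)) i j)"
    unfolding N_anticomm(2) kmul_scale_left by (simp add: kmul_assoc)
  also have "\<dots> = N 1 \<bullet> N 2 \<bullet> N 3"
    unfolding N_anticomm(3) kmul_scale_right by (simp add: kmul_assoc)
  finally show ?thesis
    by (simp add: T_def kmul_scale_left kmul_scale_right)
qed

text \<open>The defect: zero on a multiplicative part and twice \<open>N 3\<close> on an
  antimultiplicative one.\<close>

definition Z :: "'i \<Rightarrow> 'i \<Rightarrow> complex" where
  "Z = (\<lambda>i j. T i j + N 3 i j)"

lemma Z_apply: "i \<in> I \<Longrightarrow> j \<in> I \<Longrightarrow> Z i j = \<i> * J 1 2 i j + J 0 3 i j"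
  by (simp add: Z_def T_def N_mult) (simp add: N_def)

text \<open>\<^term>\<open>T\<close> and \<^term>\<open>N 3\<close> are commuting square roots of the projection \<^term>\<open>N 0\<close>,
  so \<^term>\<open>Z\<close> has spectrum in \<open>{-2, 0, 2}\<close>.\<close>
lemma Z_cubed: "Z \<bullet> Z \<bullet> Z = (\<lambda>i j. 4 * Z i j)"
proof -
  have TN: "N 3 \<bullet> (T \<bullet> X) = T \<bullet> (N 3 \<bullet> X)" and TT: "T \<bullet> (T \<bullet> X) = N 0 \<bullet> X"
    and NN: "N 3 \<bullet> (N 3 \<bullet> X) = N 0 \<bullet> X" for X
    using T_comm T_square N_square[of 3] by (simp_all flip: kmul_assoc)
  have T0: "N 0 \<bullet> T = T"
    by (simp add: T_def kmul_scale_right N_unit_left flip: kmul_assoc)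
  show ?thesis
    by (simp add: Z_def kmul_add_left kmul_add_right kmul_scale_left kmul_assoc TN TT NN T_comm T_square N_square
        T_unit T0 N_unit_left N_unit_right fun_eq_iff)
qed

text \<open>The hypothesis is \<open>Z = 0\<close>, that is
  \<open>N 1 \<bullet> N 2 = \<i> N 3\<close>. Multiplying by \<open>N 1\<close> from the left and
  by \<open>N 2\<close> from the right gives the other two products.\<close>

lemma J_multiplicative:
  assumes Z0: "\<And>i j. i \<in> I \<Longrightarrow> j \<in> I \<Longrightarrow> \<i> * J 1 2 i j + J 0 3 i j = 0"
    and ij: "i \<in> I" "j \<in> I"
  shows "J 1 2 i j = \<i> * J 0 3 i j" "J 1 3 i j = - \<i> * J 0 2 i j" "J 2 3 i j = \<i> * J 0 1 i j"
proof -
  have "J 1 2 i j = \<i> * J 0 3 i j" if "i \<in> I" "j \<in> I" for i j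
    using Z0[OF that] by (auto simp: complex_eq_iff)
  then have N12: "N 1 \<bullet> N 2 = (\<lambda>i j. \<i> * N 3 i j)"
    by (simp add: N_mult del: One_nat_def) (auto simp: N_def fun_eq_iff simp del: One_nat_def)
  have "N 1 \<bullet> (N 1 \<bullet> N 2) = N 2"
    by (simp add: N_square N_unit_left flip: kmul_assoc)
  then have N13: "(\<lambda>i j. \<i> * (N 1 \<bullet> N 3) i j) = N 2"
    by (simp add: N12 kmul_scale_right del: One_nat_def)
  have "N 1 \<bullet> N 2 \<bullet> N 2 = N 1"
    by (simp add: N_square N_unit_right kmul_assoc)
  then have N32: "(\<lambda>i j. \<i> * (N 3 \<bullet> N 2) i j) = N 1"
    by (simp add: N12 kmul_scale_left del: One_nat_def)
  show "J 1 2 i j = \<i> * J 0 3 i j"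
    using fun_cong[OF fun_cong[OF N12, of i], of j] ij by (simp add: N_mult del: One_nat_def) (simp add: N_def)
  show "J 1 3 i j = - \<i> * J 0 2 i j"
    using fun_cong[OF fun_cong[OF N13, of i], of j] ij by (simp add: N_mult del: One_nat_def) (auto simp: N_def complex_eq_iff simp del: One_nat_def)
  show "J 2 3 i j = \<i> * J 0 1 i j"
    using fun_cong[OF fun_cong[OF N32, of i], of j] ij
    by (simp add: N_mult J_linear_relations(7) del: One_nat_def) (auto simp: N_def complex_eq_iff simp del: One_nat_def)
qed

end

section \<open>Forms that vanish on unitaries\<close>

definition sq :: "nat \<Rightarrow> (nat \<times> nat) set" where
  "sq d = {..<d} \<times> {..<d}"

definition ob :: "('x \<Rightarrow> complex) \<Rightarrow> ('x \<Rightarrow> complex) \<Rightarrow> 'x \<Rightarrow> 'x \<Rightarrow> complex" where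
  "ob X Y = (\<lambda>x y. cnj (X x) * Y y)"

text \<open>A pair \<open>(r, c)\<close> indexes the matrix entry in row \<open>r\<close> and column \<open>c\<close>; the contraction of
  \<open>ob X Y\<close> is the matrix \<open>X\<^sup>* Y\<close>.\<close>
definition ctr :: "nat \<Rightarrow> (nat \<times> nat \<Rightarrow> nat \<times> nat \<Rightarrow> complex) \<Rightarrow> nat \<Rightarrow> nat \<Rightarrow> complex" where
  "ctr d v i j = (\<Sum>r<d. v (r, i) (r, j))"

definition isom :: "nat \<Rightarrow> (nat \<times> nat \<Rightarrow> complex) \<Rightarrow> bool" where
  "isom d X \<longleftrightarrow> (\<forall>i<d. \<forall>j<d. ctr d (ob X X) i j = (if i = j then 1 else 0))"

definition idk :: "nat \<times> nat \<Rightarrow> complex" where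
  "idk y = (if fst y = snd y then 1 else 0)"

definition pairing :: "nat \<Rightarrow> (nat \<times> nat \<Rightarrow> nat \<times> nat \<Rightarrow> complex) \<Rightarrow>
    (nat \<times> nat \<Rightarrow> nat \<times> nat \<Rightarrow> complex) \<Rightarrow> complex" where
  "pairing d g v = (\<Sum>y\<in>sq d. \<Sum>y'\<in>sq d. g y y' * v y y')"

lemma finite_sq [simp]: "finite (sq d)"
  by (simp add: sq_def)

lemma sum_sq: "(\<Sum>y\<in>sq d. f y) = (\<Sum>r<d. \<Sum>c<d. f (r, c))"
  for f :: "nat \<times> nat \<Rightarrow> 'a::comm_monoid_add"
  by (simp add: sq_def sum.cartesian_product)

lemma pairing_cong:
  "(\<And>y y'. y \<in> sq d \<Longrightarrow> y' \<in> sq d \<Longrightarrow> v y y' = w y y') \<Longrightarrow> pairing d g v = pairing d g w"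
  by (simp add: pairing_def)

lemma pairing_add: "pairing d g (\<lambda>y y'. v y y' + w y y') = pairing d g v + pairing d g w"
  by (simp add: pairing_def sum.distrib distrib_left)

lemma pairing_diff: "pairing d g (\<lambda>y y'. v y y' - w y y') = pairing d g v - pairing d g w"
  by (simp add: pairing_def sum_subtractf right_diff_distrib)

lemma pairing_scale: "pairing d g (\<lambda>y y'. s * v y y') = s * pairing d g v"
  by (simp add: pairing_def sum_distrib_left mult.left_commute)

text \<open>Coefficients that vanish for distinct rows and do not depend on a common row make the
  functional factor through the contraction.\<close>

lemma pairing_eq_0:
  assumes off: "\<And>r r' c c'. r < d \<Longrightarrow> r' < d \<Longrightarrow> c < d \<Longrightarrow> c' < d \<Longrightarrow> r \<noteq> r' \<Longrightarrow> g (r, c) (r', c') = 0"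
    and diag: "\<And>r r' c c'. r < d \<Longrightarrow> r' < d \<Longrightarrow> c < d \<Longrightarrow> c' < d \<Longrightarrow> r \<noteq> r' \<Longrightarrow> g (r, c) (r, c') = g (r', c) (r', c')"
    and ctr0: "\<And>i j. i < d \<Longrightarrow> j < d \<Longrightarrow> ctr d v i j = 0"
  shows "pairing d g v = 0"
proof -
  have diag': "g (r, c) (r, c') = g (0, c) (0, c')" if "r < d" "c < d" "c' < d" for r c c'
    using diag[of r 0 c c'] that by (cases "r = 0") auto
  have "pairing d g v = (\<Sum>r<d. \<Sum>c<d. \<Sum>r'<d. \<Sum>c'<d. g (r, c) (r', c') * v (r, c) (r', c'))"
    by (simp add: pairing_def sum_sq)
  also have "\<dots> = (\<Sum>r<d. \<Sum>c<d. \<Sum>r'<d. if r' = r then \<Sum>c'<d. g (r, c) (r, c') * v (r, c) (r, c') else 0)"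
    by (intro sum.cong refl) (auto simp: off)
  also have "\<dots> = (\<Sum>r<d. \<Sum>c<d. \<Sum>c'<d. g (r, c) (r, c') * v (r, c) (r, c'))"
    by simp
  also have "\<dots> = (\<Sum>r<d. \<Sum>c<d. \<Sum>c'<d. g (0, c) (0, c') * v (r, c) (r, c'))"
    by (intro sum.cong refl arg_cong2[of _ _ _ _ times]) (auto intro: diag')
  also have "\<dots> = (\<Sum>c<d. \<Sum>c'<d. \<Sum>r<d. g (0, c) (0, c') * v (r, c) (r, c'))"
    by (subst sum.swap, rule sum.cong[OF refl], rule sum.swap)
  also have "\<dots> = (\<Sum>c<d. \<Sum>c'<d. g (0, c) (0, c') * ctr d v c c')"
    by (simp add: ctr_def sum_distrib_left)
  finally show ?thesis by (simp add: ctr0)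
qed

lemma pairing_id_left:
  "pairing d g (ob idk X) = (\<Sum>z\<in>sq d. X z * (\<Sum>c<d. g (c, c) z))"
proof -
  have "pairing d g (ob idk X) = (\<Sum>z\<in>sq d. \<Sum>y\<in>sq d. g y z * (cnj (idk y) * X z))"
    unfolding pairing_def ob_def by (rule sum.swap)
  also have "\<dots> = (\<Sum>z\<in>sq d. \<Sum>r<d. \<Sum>c<d. if c = r then g (r, r) z * X z else 0)"
    unfolding sum_sq[of _ d] by (intro sum.cong refl) (auto simp: idk_def)
  finally show ?thesis by (simp add: sum_distrib_left mult.commute)
qed

lemma pairing_id_right:
  "pairing d g (ob X idk) = (\<Sum>z\<in>sq d. cnj (X z) * (\<Sum>c<d. g z (c, c)))"
proof -
  have "pairing d g (ob X idk) = (\<Sum>z\<in>sq d. \<Sum>y\<in>sq d. g z y * (cnj (X z) * idk y))"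
    unfolding pairing_def ob_def by (rule refl)
  also have "\<dots> = (\<Sum>z\<in>sq d. \<Sum>r<d. \<Sum>c<d. if c = r then g z (r, r) * cnj (X z) else 0)"
    unfolding sum_sq[of _ d] by (intro sum.cong refl) (auto simp: idk_def)
  finally show ?thesis by (simp add: sum_distrib_left mult.commute)
qed

lemma pairing_ob_combination:
  "pairing d g (ob (\<lambda>y. s * X y + t * Y y) (\<lambda>y. s * X y + t * Y y)) =
     cnj s * s * pairing d g (ob X X) + cnj s * t * pairing d g (ob X Y) +
     cnj t * s * pairing d g (ob Y X) + cnj t * t * pairing d g (ob Y Y)"
proof -
  have "pairing d g (ob (\<lambda>y. s * X y + t * Y y) (\<lambda>y. s * X y + t * Y y)) =
    pairing d g (\<lambda>y y'. cnj s * s * ob X X y y' + cnj s * t * ob X Y y y' +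
     cnj t * s * ob Y X y y' + cnj t * t * ob Y Y y y')"
    by (rule pairing_cong) (simp add: ob_def algebra_simps)
  then show ?thesis by (simp only: pairing_add pairing_scale)
qed

lemma ctr_ob_id_left: "i < d \<Longrightarrow> ctr d (ob idk X) i j = X (i, j)"
proof -
  have "cnj (idk (r, i)) * X (r, j) = (if r = i then X (r, j) else 0)" for r
    by (simp add: idk_def)
  then show "i < d \<Longrightarrow> ctr d (ob idk X) i j = X (i, j)"
    by (simp add: ctr_def ob_def)
qed

lemma ctr_ob_id_right: "j < d \<Longrightarrow> ctr d (ob X idk) i j = cnj (X (j, i))"
proof -
  have "cnj (X (r, i)) * idk (r, j) = (if r = j then cnj (X (r, i)) else 0)" for r
    by (simp add: idk_def)
  then show "j < d \<Longrightarrow> ctr d (ob X idk) i j = cnj (X (j, i))"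
    by (simp add: ctr_def ob_def)
qed

lemma isom_idk: "isom d idk"
  unfolding isom_def by (auto simp: ctr_ob_id_left) (simp_all add: idk_def)

lemma isom_rotation:
  assumes S: "isom d S" and herm: "\<And>i j. i < d \<Longrightarrow> j < d \<Longrightarrow> S (i, j) = cnj (S (j, i))"
  shows "isom d (\<lambda>y. 3/5 * idk y + 4/5 * \<i> * S y)"
  unfolding isom_def
proof (intro allI impI)
  fix i j assume ij: "i < d" "j < d"
  let ?Y = "\<lambda>y. 3/5 * idk y + 4/5 * \<i> * S y"
  have "ctr d (ob ?Y ?Y) i j = 9/25 * ctr d (ob idk idk) i j + 12/25 * \<i> * ctr d (ob idk S) i j
      - 12/25 * \<i> * ctr d (ob S idk) i j + 16/25 * ctr d (ob S S) i j"
    by (simp add: ctr_def ob_def sum_distrib_left sum.distrib[symmetric] sum_subtractf[symmetric])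
       (rule sum.cong, auto simp: algebra_simps)
  also have "\<dots> = 9/25 * (if i = j then 1 else 0) + 16/25 * (if i = j then 1 else 0)"
    using ij S isom_idk[of d] herm[OF ij, symmetric] by (simp add: isom_def ctr_ob_id_left ctr_ob_id_right)
  finally show "ctr d (ob ?Y ?Y) i j = (if i = j then 1 else 0)" by simp
qed

text \<open>Applied later to the functional on one party that arises by fixing a tensor of zero
  contraction on the other. Vanishing on unitaries does not in general make it vanish on all tensors
  of zero contraction, but it identifies its values at \<open>ob idk X\<close> and at
  \<open>ob X' idk\<close> for the adjoint \<open>X'\<close> of \<open>X\<close>.\<close>

locale unitary_null =
  fixes d :: nat and g :: "nat \<times> nat \<Rightarrow> nat \<times> nat \<Rightarrow> complex"
  assumes null: "isom d Y \<Longrightarrow> pairing d g (ob Y Y) = 0"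
begin

text \<open>For \<open>Y = (3 + 4 \<i> S) / 5\<close> the squares in \<open>ob Y Y\<close> vanish by
  \<open>null\<close>, which leaves the cross terms with coefficients \<open>12/25 \<i>\<close> and
  \<open>- 12/25 \<i>\<close>.\<close>

lemma involution_commutes:
  assumes S: "isom d S" and herm: "\<And>i j. i < d \<Longrightarrow> j < d \<Longrightarrow> S (i, j) = cnj (S (j, i))"
  shows "pairing d g (ob idk S) = pairing d g (ob S idk)"
  using null[OF isom_rotation[OF assms], unfolded pairing_ob_combination] null[OF S] null[OF isom_idk]
  by simp

definition gl :: "nat \<times> nat \<Rightarrow> complex" where "gl z = (\<Sum>c<d. g (c, c) z)"
definition gr :: "nat \<times> nat \<Rightarrow> complex" where "gr z = (\<Sum>c<d. g z (c, c))"

lemma involution_sums: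
  assumes "isom d S" "\<And>i j. i < d \<Longrightarrow> j < d \<Longrightarrow> S (i, j) = cnj (S (j, i))"
  shows "(\<Sum>z\<in>sq d. S z * gl z) = (\<Sum>z\<in>sq d. cnj (S z) * gr z)"
  using involution_commutes[OF assms] by (simp add: pairing_id_left pairing_id_right gl_def gr_def)

lemma id_sums: "(\<Sum>z\<in>sq d. idk z * gl z) = (\<Sum>z\<in>sq d. cnj (idk z) * gr z)"
  by (rule involution_sums[OF isom_idk]) (auto simp: idk_def)

lemma gl_gr_diag:
  assumes r: "r < d"
  shows "gl (r, r) = gr (r, r)"
proof -
  \<comment> \<open>The sign change of coordinate \<open>r\<close>.\<close>
  define S where "S z = idk z - 2 * (if z = (r, r) then 1 else 0 :: complex)" for z :: "nat \<times> nat"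
  have S_alt: "S (i, j) = (if i = j then if i = r then - 1 else 1 else 0)" for i j
    by (auto simp: S_def idk_def)
  have "cnj (S (k, i)) * S (k, j) = (if k = i then if i = j then 1 else 0 else 0)" for i j k
    by (auto simp: S_alt)
  then have iso: "isom d S"
    unfolding isom_def ctr_def ob_def by simp
  have herm: "S (i, j) = cnj (S (j, i))" for i j by (simp add: S_alt)
  have rin: "(r, r) \<in> sq d" using r by (simp add: sq_def)
  have e: "(if P then 1 else 0) * x = (if P then x else 0)" for P and x :: complex by simp
  have "(\<Sum>z\<in>sq d. S z * gl z) = (\<Sum>z\<in>sq d. idk z * gl z) - 2 * gl (r, r)"
    using rin by (simp add: S_def left_diff_distrib sum_subtractf mult.assoc e flip: sum_distrib_left)
  moreover have "(\<Sum>z\<in>sq d. cnj (S z) * gr z) = (\<Sum>z\<in>sq d. cnj (idk z) * gr z) - 2 * gr (r, r)"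
    using rin by (simp add: S_def left_diff_distrib sum_subtractf mult.assoc e if_distrib[of cnj] flip: sum_distrib_left cong: if_cong)
  ultimately show ?thesis using involution_sums[OF iso herm] id_sums by simp
qed

lemma gl_gr_off:
  assumes r: "r < d" and s: "s < d" and ne: "r \<noteq> s"
  shows "gl (r, s) = gr (s, r)"
proof -
  have key: "w * gl (r, s) + cnj w * gl (s, r) = cnj w * gr (r, s) + w * gr (s, r)"
    if w: "cnj w * w = 1" for w
  proof -
    define u :: "nat \<times> nat \<Rightarrow> nat \<times> nat \<Rightarrow> complex" where "u = (\<lambda>z y. if y = z then 1 else 0)"
    \<comment> \<open>The exchange of coordinates \<open>r\<close> and \<open>s\<close> with a phase
      \<open>w\<close>.\<close>
    define S where "S z = idk z - u (r, r) z - u (s, s) z + w * u (r, s) z + cnj w * u (s, r) z" for z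
    have S_alt: "S (i, j) = (if i = r then if j = s then w else 0
       else if i = s then if j = r then cnj w else 0 else if i = j then 1 else 0)" for i j
      using ne by (auto simp: S_def idk_def u_def)
    define t where "t i = (if i = r then s else if i = s then r else i)" for i
    have t: "t (t i) = i" "i < d \<Longrightarrow> t i < d" for i using r s ne by (auto simp: t_def)
    have "cnj (S (k, i)) * S (k, j) = (if k = t i then if i = j then 1 else 0 else 0)" for i j k
      using ne w by (auto simp: S_alt t_def mult.commute)
    then have iso: "isom d S"
      unfolding isom_def ctr_def ob_def using t by simp
    have herm: "S (i, j) = cnj (S (j, i))" for i j using ne by (simp add: S_alt)
    have inn: "(r, r) \<in> sq d" "(s, s) \<in> sq d" "(r, s) \<in> sq d" "(s, r) \<in> sq d"
      using r s by (auto simp: sq_def)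
    have u: "(\<Sum>z\<in>sq d. u y z * h z) = h y" "(\<Sum>z\<in>sq d. cnj (u y z) * h z) = h y"
      if "y \<in> sq d" for y and h :: "nat \<times> nat \<Rightarrow> complex"
    proof -
      have e: "u y z * h z = (if z = y then h z else 0)" "cnj (u y z) * h z = (if z = y then h z else 0)" for z
        by (auto simp: u_def)
      show "(\<Sum>z\<in>sq d. u y z * h z) = h y" "(\<Sum>z\<in>sq d. cnj (u y z) * h z) = h y"
        using that unfolding e by auto
    qed
    have "(\<Sum>z\<in>sq d. S z * gl z) = (\<Sum>z\<in>sq d. idk z * gl z) - gl (r, r) - gl (s, s) + w * gl (r, s) + cnj w * gl (s, r)"
      by (simp add: S_def left_diff_distrib distrib_right sum_subtractf sum.distrib mult.assoc u inn flip: sum_distrib_left)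
    moreover have "(\<Sum>z\<in>sq d. cnj (S z) * gr z) =
        (\<Sum>z\<in>sq d. cnj (idk z) * gr z) - gr (r, r) - gr (s, s) + cnj w * gr (r, s) + w * gr (s, r)"
      by (simp add: S_def left_diff_distrib distrib_right sum_subtractf sum.distrib mult.assoc u inn flip: sum_distrib_left)
    ultimately show ?thesis
      using involution_sums[OF iso herm] id_sums gl_gr_diag[OF r] gl_gr_diag[OF s] by simp
  qed
  \<comment> \<open>The two phases separate the terms with \<open>w\<close> from those with
    \<open>cnj w\<close>.\<close>
  from key[of 1] key[of \<i>] show ?thesis by (simp add: complex_eq_iff)
qed

lemma gl_gr: "r < d \<Longrightarrow> s < d \<Longrightarrow> gl (r, s) = gr (s, r)"
  using gl_gr_diag gl_gr_off by (cases "r = s") auto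

text \<open>Both sides are complex linear in \<open>X\<close>, and sign changes together with phased
  exchanges, all of them Hermitian unitaries, span the matrices.\<close>

lemma adjoint_commutes:
  assumes "\<And>i j. i < d \<Longrightarrow> j < d \<Longrightarrow> X' (j, i) = cnj (X (i, j))"
  shows "pairing d g (ob idk X) = pairing d g (ob X' idk)"
proof -
  have "(\<Sum>r<d. \<Sum>c<d. X (r, c) * gl (r, c)) = (\<Sum>r<d. \<Sum>c<d. cnj (X' (c, r)) * gr (c, r))"
    by (intro sum.cong refl) (simp add: assms gl_gr)
  also have "\<dots> = (\<Sum>c<d. \<Sum>r<d. cnj (X' (c, r)) * gr (c, r))"
    by (rule sum.swap)
  finally show ?thesis
    by (simp add: pairing_id_left pairing_id_right sum_sq flip: gl_def gr_def)
qed

end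

text \<open>\<open>V \<gamma> \<alpha>\<close> is the block in row \<open>\<gamma>\<close> and
  column \<open>\<alpha>\<close> of an operator on a party with a \<open>k\<close>-dimensional
  ancilla. \<open>gram\<close> is a block of \<open>V\<^sup>* V\<close> in which only the ancilla
  product is carried out; \<open>ctr\<close> completes the product on the party.\<close>

definition gram :: "nat \<Rightarrow> (nat \<Rightarrow> nat \<Rightarrow> 'x \<Rightarrow> complex) \<Rightarrow> nat \<Rightarrow> nat \<Rightarrow> 'x \<Rightarrow> 'x \<Rightarrow> complex" where
  "gram k V \<alpha> \<beta> = (\<lambda>y y'. \<Sum>\<gamma><k. ob (V \<gamma> \<alpha>) (V \<gamma> \<beta>) y y')"

definition block_isom :: "nat \<Rightarrow> nat \<Rightarrow> (nat \<Rightarrow> nat \<Rightarrow> nat \<times> nat \<Rightarrow> complex) \<Rightarrow> bool" where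
  "block_isom k d V \<longleftrightarrow> (\<forall>\<alpha><k. \<forall>\<beta><k. \<forall>i<d. \<forall>j<d.
     ctr d (gram k V \<alpha> \<beta>) i j = (if \<alpha> = \<beta> \<and> i = j then 1 else 0))"

definition block_herm :: "nat \<Rightarrow> nat \<Rightarrow> (nat \<Rightarrow> nat \<Rightarrow> nat \<times> nat \<Rightarrow> complex) \<Rightarrow> bool" where
  "block_herm k d H \<longleftrightarrow> (\<forall>\<gamma><k. \<forall>\<alpha><k. \<forall>i<d. \<forall>j<d. H \<gamma> \<alpha> (i, j) = cnj (H \<alpha> \<gamma> (j, i)))"

definition rotation :: "(nat \<Rightarrow> nat \<Rightarrow> nat \<times> nat \<Rightarrow> complex) \<Rightarrow> nat \<Rightarrow> nat \<Rightarrow> nat \<times> nat \<Rightarrow> complex" where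
  "rotation H \<gamma> \<alpha> = (\<lambda>y. 3/5 * (if \<gamma> = \<alpha> then idk y else 0) + 4/5 * \<i> * H \<gamma> \<alpha> y)"

lemma gram_rotation:
  assumes "\<alpha> < k" "\<beta> < k"
  shows "gram k (rotation H) \<alpha> \<beta> y y' = 9/25 * (if \<alpha> = \<beta> then ob idk idk y y' else 0) +
    12/25 * \<i> * (ob idk (H \<alpha> \<beta>) y y' - ob (H \<beta> \<alpha>) idk y y') + 16/25 * gram k H \<alpha> \<beta> y y'"
proof -
  have "gram k (rotation H) \<alpha> \<beta> y y' = (\<Sum>\<gamma><k.
      (if \<gamma> = \<alpha> then 9/25 * (if \<alpha> = \<beta> then ob idk idk y y' else 0) + 12/25 * \<i> * ob idk (H \<alpha> \<beta>) y y' else 0)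
     - (if \<gamma> = \<beta> then 12/25 * \<i> * ob (H \<beta> \<alpha>) idk y y' else 0) + 16/25 * ob (H \<gamma> \<alpha>) (H \<gamma> \<beta>) y y')"
    unfolding gram_def by (rule sum.cong) (auto simp: rotation_def ob_def algebra_simps)
  also have "\<dots> = 9/25 * (if \<alpha> = \<beta> then ob idk idk y y' else 0) + 12/25 * \<i> * ob idk (H \<alpha> \<beta>) y y'
     - 12/25 * \<i> * ob (H \<beta> \<alpha>) idk y y' + 16/25 * gram k H \<alpha> \<beta> y y'"
    using assms by (simp only: sum.distrib sum_subtractf sum.delta finite_lessThan gram_def sum_distrib_left) simp
  finally show ?thesis by (simp add: algebra_simps)
qed

lemma ctr_add: "ctr d (\<lambda>y y'. v y y' + w y y') i j = ctr d v i j + ctr d w i j"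
  by (simp add: ctr_def sum.distrib)

lemma ctr_diff: "ctr d (\<lambda>y y'. v y y' - w y y') i j = ctr d v i j - ctr d w i j"
  by (simp add: ctr_def sum_subtractf)

lemma ctr_scale: "ctr d (\<lambda>y y'. s * v y y') i j = s * ctr d v i j"
  by (simp add: ctr_def sum_distrib_left)

lemma ctr_idk: "i < d \<Longrightarrow> j < d \<Longrightarrow> ctr d (ob idk idk) i j = (if i = j then 1 else 0)"
  using isom_idk by (simp add: isom_def)

lemma block_isom_rotation:
  assumes iso: "block_isom k d H" and herm: "block_herm k d H"
  shows "block_isom k d (rotation H)"
  unfolding block_isom_def
proof (intro allI impI)
  fix \<alpha> \<beta> i j assume b: "\<alpha> < k" "\<beta> < k" "i < d" "j < d"
  have gram_eq: "gram k (rotation H) \<alpha> \<beta> = (\<lambda>y y'. 9/25 * (if \<alpha> = \<beta> then ob idk idk y y' else 0) +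
    12/25 * \<i> * (ob idk (H \<alpha> \<beta>) y y' - ob (H \<beta> \<alpha>) idk y y') + 16/25 * gram k H \<alpha> \<beta> y y')"
    by (intro ext gram_rotation b)
  have h: "cnj (H \<beta> \<alpha> (j, i)) = H \<alpha> \<beta> (i, j)"
    using herm b unfolding block_herm_def by metis
  have h': "ctr d (ob idk (H \<alpha> \<beta>)) i j - ctr d (ob (H \<beta> \<alpha>) idk) i j = 0"
    using b h by (simp add: ctr_ob_id_left ctr_ob_id_right)
  have z: "ctr d (\<lambda>y y'. if P then v y y' else 0) i j = (if P then ctr d v i j else 0)" for P v
    by (simp add: ctr_def)
  have "ctr d (gram k (rotation H) \<alpha> \<beta>) i j =
      9/25 * (if \<alpha> = \<beta> then ctr d (ob idk idk) i j else 0) +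
      12/25 * \<i> * (ctr d (ob idk (H \<alpha> \<beta>)) i j - ctr d (ob (H \<beta> \<alpha>) idk) i j) + 16/25 * ctr d (gram k H \<alpha> \<beta>) i j"
    unfolding gram_eq by (simp only: ctr_add ctr_diff ctr_scale z)
  then show "ctr d (gram k (rotation H) \<alpha> \<beta>) i j = (if \<alpha> = \<beta> \<and> i = j then 1 else 0)"
    using iso b h' by (auto simp: block_isom_def ctr_idk)
qed

text \<open>The blocks \<open>H \<alpha> \<beta>\<close> and \<open>H \<beta> \<alpha>\<close> are
  adjoint to each other, so the cross terms of \<open>gram_rotation\<close> cancel by
  \<open>adjoint_commutes\<close>; the identity term vanishes by \<open>null\<close>.\<close>

lemma (in unitary_null) pairing_gram_rotation:
  assumes herm: "block_herm k d H" and b: "\<alpha> < k" "\<beta> < k"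
  shows "pairing d g (gram k (rotation H) \<alpha> \<beta>) = 16/25 * pairing d g (gram k H \<alpha> \<beta>)"
proof -
  have gram_eq: "gram k (rotation H) \<alpha> \<beta> = (\<lambda>y y'. 9/25 * (if \<alpha> = \<beta> then ob idk idk y y' else 0) +
    12/25 * \<i> * (ob idk (H \<alpha> \<beta>) y y' - ob (H \<beta> \<alpha>) idk y y') + 16/25 * gram k H \<alpha> \<beta> y y')"
    by (intro ext gram_rotation b)
  have z: "pairing d g (\<lambda>y y'. if P then v y y' else 0) = (if P then pairing d g v else 0)" for P v
    by (simp add: pairing_def)
  have "pairing d g (ob idk (H \<alpha> \<beta>)) = pairing d g (ob (H \<beta> \<alpha>) idk)"
    using herm b unfolding block_herm_def by (intro adjoint_commutes) blast
  moreover have "pairing d g (gram k (rotation H) \<alpha> \<beta>) = 9/25 * (if \<alpha> = \<beta> then pairing d g (ob idk idk) else 0) +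
      12/25 * \<i> * (pairing d g (ob idk (H \<alpha> \<beta>)) - pairing d g (ob (H \<beta> \<alpha>) idk)) + 16/25 * pairing d g (gram k H \<alpha> \<beta>)"
    unfolding gram_eq
    by (simp only: pairing_add pairing_diff pairing_scale z)
  ultimately show ?thesis using null[OF isom_idk] by simp
qed

text \<open>For orthonormal real vectors \<open>p\<close>, \<open>q\<close>, the reflection that exchanges \<open>e\<^sub>j \<otimes> e\<^sub>0\<close> with
  \<open>p \<otimes> e\<^sub>2\<close>, and \<open>e\<^sub>j\<^sub>' \<otimes> e\<^sub>1\<close> with \<open>q \<otimes> e\<^sub>2\<close>; the second factor numbers the blocks.\<close>
definition swap_reflection ::
  "nat \<Rightarrow> nat \<Rightarrow> (nat \<Rightarrow> complex) \<Rightarrow> (nat \<Rightarrow> complex) \<Rightarrow> nat \<Rightarrow> nat \<Rightarrow> nat \<times> nat \<Rightarrow> complex" where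
  "swap_reflection j j' p q \<gamma> \<alpha> = (\<lambda>(r, c).
     if \<gamma> = 0 \<and> \<alpha> = 0 then (if r = c \<and> c \<noteq> j then 1 else 0)
     else if \<gamma> = 1 \<and> \<alpha> = 1 then (if r = c \<and> c \<noteq> j' then 1 else 0)
     else if \<gamma> = 2 \<and> \<alpha> = 2 then (if r = c then 1 else 0) - p r * p c - q r * q c
     else if \<gamma> = 0 \<and> \<alpha> = 2 then (if r = j then p c else 0)
     else if \<gamma> = 2 \<and> \<alpha> = 0 then (if c = j then p r else 0)
     else if \<gamma> = 1 \<and> \<alpha> = 2 then (if r = j' then q c else 0)
     else if \<gamma> = 2 \<and> \<alpha> = 1 then (if c = j' then q r else 0)
     else 0)"

context
  fixes d j j' :: nat and p q :: "nat \<Rightarrow> complex"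
  assumes j: "j < d" "j' < d"
    and real: "\<And>r. cnj (p r) = p r" "\<And>r. cnj (q r) = q r"
    and pp: "(\<Sum>r<d. p r * p r) = 1" and qq: "(\<Sum>r<d. q r * q r) = 1" and pq: "(\<Sum>r<d. p r * q r) = 0"
begin

lemma block_herm_swap_reflection: "block_herm 3 d (swap_reflection j j' p q)"
  unfolding block_herm_def
proof (intro allI impI)
  fix \<gamma> \<alpha> r c assume "\<gamma> < (3::nat)" "\<alpha> < (3::nat)"
  then have "\<alpha> = 0 \<or> \<alpha> = 1 \<or> \<alpha> = 2" "\<gamma> = 0 \<or> \<gamma> = 1 \<or> \<gamma> = 2" by linarith+
  then show "swap_reflection j j' p q \<gamma> \<alpha> (r, c) = cnj (swap_reflection j j' p q \<alpha> \<gamma> (c, r))"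
    by (elim disjE) (simp_all add: swap_reflection_def real)
qed

lemma block_isom_swap_reflection: "block_isom 3 d (swap_reflection j j' p q)"
  unfolding block_isom_def
proof (intro allI impI)
  fix \<alpha> \<beta> i c assume b: "\<alpha> < (3::nat)" "\<beta> < (3::nat)" "i < d" "c < d"
  have three: "(\<Sum>\<gamma><3. f \<gamma>) = f 0 + f 1 + f (2::nat)" for f :: "nat \<Rightarrow> complex"
    by (simp add: eval_nat_numeral)
  have real': "cnj (swap_reflection j j' p q \<gamma> \<alpha> y) = swap_reflection j j' p q \<gamma> \<alpha> y" for \<gamma> \<alpha> y
    by (auto simp: swap_reflection_def real split: prod.split)
  define H where "H = swap_reflection j j' p q"
  let ?R = "\<lambda>r c. H 2 2 (r, c)"
  have qp: "(\<Sum>r<d. q r * p r) = 0" using pq by (simp add: mult.commute)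
  \<comment> \<open>\<open>?R\<close> is the projection onto the orthogonal complement of
    \<open>p\<close> and \<open>q\<close>.\<close>
  have R: "(\<Sum>r<d. ?R r x * h r) = h x - p x * (\<Sum>r<d. p r * h r) - q x * (\<Sum>r<d. q r * h r)"
    if "x < d" for x h
  proof -
    have "?R r x * h r = (if r = x then h r else 0) - p x * (p r * h r) - q x * (q r * h r)" for r
      by (simp add: H_def swap_reflection_def algebra_simps)
    then show ?thesis using that by (simp add: sum_subtractf flip: sum_distrib_left)
  qed
  have Rp: "(\<Sum>r<d. ?R r x * p r) = 0" "(\<Sum>r<d. ?R r x * q r) = 0" if "x < d" for x
    using R[OF that, of p] R[OF that, of q] pp pq qp qq by simp_all
  have Rp': "(\<Sum>r<d. p r * ?R r x) = 0" "(\<Sum>r<d. q r * ?R r x) = 0" if "x < d" for x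
    using Rp[OF that] by (simp_all add: mult.commute)
  have RR: "(\<Sum>r<d. ?R r i * ?R r c) = (if i = c then 1 else 0) - p i * p c - q i * q c"
    using R[OF b(3), of "\<lambda>r. ?R r c"] Rp'[OF b(4)] by (simp add: H_def swap_reflection_def)
  have H_entries: "H 0 0 (r, x) = (if r = x then if x = j then 0 else 1 else 0)"
    "H 1 1 (r, x) = (if r = x then if x = j' then 0 else 1 else 0)"
    "H 0 2 (r, x) = (if r = j then p x else 0)" "H 1 2 (r, x) = (if r = j' then q x else 0)"
    "H 2 0 (r, x) = (if x = j then p r else 0)" "H 2 1 (r, x) = (if x = j' then q r else 0)"
    "H 0 1 (r, x) = 0" "H 1 0 (r, x) = 0" for r x
    by (simp_all add: H_def swap_reflection_def)
  have e: "x * (if P then y else 0) = (if P then x * y else 0)" "(if P then y else 0) * x = (if P then y * x else 0)"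
    for P and x y :: complex by simp_all
  have e': "(\<Sum>r<d. if P then (if Q then x r else 0) * y r else 0) = (if P \<and> Q then \<Sum>r<d. x r * y r else 0)"
    for P Q and x y :: "nat \<Rightarrow> complex" by (cases P; cases Q) simp_all
  have G: "ctr d (gram 3 H \<alpha> \<beta>) i c = (\<Sum>r<d. H 0 \<alpha> (r, i) * H 0 \<beta> (r, c)) +
     (\<Sum>r<d. H 1 \<alpha> (r, i) * H 1 \<beta> (r, c)) + (\<Sum>r<d. H 2 \<alpha> (r, i) * H 2 \<beta> (r, c))"
    unfolding ctr_def gram_def three by (simp add: ob_def real' H_def sum.distrib)
  have "\<alpha> = 0 \<or> \<alpha> = 1 \<or> \<alpha> = 2" "\<beta> = 0 \<or> \<beta> = 1 \<or> \<beta> = 2" using b(1,2) by linarith+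
  then show "ctr d (gram 3 (swap_reflection j j' p q) \<alpha> \<beta>) i c = (if \<alpha> = \<beta> \<and> i = c then 1 else 0)"
    unfolding H_def[symmetric] G using b(3,4) j
    by (elim disjE) (simp_all add: H_entries e e' RR Rp Rp' pp qq pq qp del: One_nat_def)
qed

end

section \<open>Bilinear maps with two unitary slots\<close>

definition entry :: "nat \<Rightarrow> nat \<Rightarrow> nat \<times> nat \<Rightarrow> complex" where
  "entry r c = (\<lambda>y. if y = (r, c) then 1 else 0)"

text \<open>The purpose of the reflection: only block row 2 contributes, and it leaves a rank-one
  tensor whose contraction is proportional to the inner product of \<open>p\<close> and
  \<open>q\<close>, hence zero when they are orthogonal.\<close>

lemma gram_swap_reflection:
  "gram 3 (swap_reflection j j' p q) 0 1 =
    ob (\<lambda>(r, c). if c = j then p r else 0) (\<lambda>(r, c). if c = j' then q r else 0)"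
  by (auto simp: gram_def eval_nat_numeral ob_def swap_reflection_def fun_eq_iff)

lemma pairing_ob: "pairing d g (ob X Y) = (\<Sum>y\<in>sq d. cnj (X y) * (\<Sum>y'\<in>sq d. g y y' * Y y'))"
  by (simp add: pairing_def ob_def sum_distrib_left mult_ac)

lemma pairing_entry:
  assumes "r < d" "c < d" "r' < d" "c' < d"
  shows "pairing d g (ob (entry r c) (entry r' c')) = g (r, c) (r', c')"
proof -
  have e: "cnj (entry r c y) * h = (if y = (r, c) then h else 0)"
    "h * entry r' c' y = (if y = (r', c') then h else 0)" for h y
    by (simp_all add: entry_def)
  show ?thesis using assms by (simp add: pairing_ob e sq_def)
qed

text \<open>Take \<open>p = s e_r + t e_r'\<close> and \<open>q = t e_r - s e_r'\<close>. The choice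
  \<open>s = 1\<close>, \<open>t = 0\<close> gives the first premise of \<open>pairing_eq_0\<close>;
  with this known, \<open>s = 3/5\<close>, \<open>t = 4/5\<close> gives the second.\<close>

lemma pairing_zero_of_reflections:
  assumes refl: "\<And>H. block_herm 3 d H \<Longrightarrow> block_isom 3 d H \<Longrightarrow> pairing d g (gram 3 H 0 1) = 0"
    and ctr0: "\<And>i j. i < d \<Longrightarrow> j < d \<Longrightarrow> ctr d v i j = 0"
  shows "pairing d g v = 0"
proof -
  have key: "s * t * g (r, c) (r, c') - s * s * g (r, c) (r', c') + t * t * g (r', c) (r, c') - s * t * g (r', c) (r', c') = 0"
    if b: "r < d" "r' < d" "c < d" "c' < d" "r \<noteq> r'" and st: "cnj s = s" "cnj t = t" "s * s + t * t = 1"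
    for r r' c c' s t
  proof -
    define p where "p x = (if x = r then s else if x = r' then t else 0)" for x
    define q where "q x = (if x = r then t else if x = r' then - s else 0)" for x
    have two: "(\<Sum>x<d. if x = r then A else if x = r' then B else 0) = A + B" for A B :: complex
    proof -
      have "(if x = r then A else if x = r' then B else 0) = (if x = r then A else 0) + (if x = r' then B else 0)" for x
        using b(5) by auto
      then show ?thesis using b by (simp add: sum.distrib)
    qed
    have sums: "(\<Sum>x<d. p x * p x) = 1" "(\<Sum>x<d. q x * q x) = 1" "(\<Sum>x<d. p x * q x) = 0"
    proof -
      have e: "p x * p x = (if x = r then s * s else if x = r' then t * t else 0)"
        "q x * q x = (if x = r then t * t else if x = r' then s * s else 0)"
        "p x * q x = (if x = r then s * t else if x = r' then - s * t else 0)" for x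
        by (simp_all add: p_def q_def mult.commute)
      show "(\<Sum>x<d. p x * p x) = 1" "(\<Sum>x<d. q x * q x) = 1" "(\<Sum>x<d. p x * q x) = 0"
        unfolding e two using st(3) by (simp_all add: add.commute)
    qed
    have real: "cnj (p x) = p x" "cnj (q x) = q x" for x
      using st by (simp_all add: p_def q_def)
    have P: "(\<lambda>(x, k). if k = c then p x else 0) = (\<lambda>y. s * entry r c y + t * entry r' c y)"
      using b(5) by (auto simp: p_def entry_def fun_eq_iff)
    have Q: "(\<lambda>(x, k). if k = c' then q x else 0) = (\<lambda>y. t * entry r c' y - s * entry r' c' y)"
      using b(5) by (auto simp: q_def entry_def fun_eq_iff)
    have "0 = pairing d g (gram 3 (swap_reflection c c' p q) 0 1)"
      using refl[OF block_herm_swap_reflection block_isom_swap_reflection] b(3,4) real sums by simp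
    also have "\<dots> = pairing d g (ob (\<lambda>y. s * entry r c y + t * entry r' c y) (\<lambda>y. t * entry r c' y - s * entry r' c' y))"
      by (simp only: gram_swap_reflection P Q)
    also have "\<dots> = pairing d g (\<lambda>y y'. s * t * ob (entry r c) (entry r c') y y' - s * s * ob (entry r c) (entry r' c') y y'
        + t * t * ob (entry r' c) (entry r c') y y' - s * t * ob (entry r' c) (entry r' c') y y')"
      by (rule pairing_cong) (simp add: ob_def st algebra_simps)
    finally show ?thesis
      using b by (simp only: pairing_add pairing_diff pairing_scale pairing_entry)
  qed
  have off: "g (r, c) (r', c') = 0" if "r < d" "r' < d" "c < d" "c' < d" "r \<noteq> r'" for r r' c c'
    using key[OF that, of 1 0] by simp
  have diag: "g (r, c) (r, c') = g (r', c) (r', c')" if "r < d" "r' < d" "c < d" "c' < d" "r \<noteq> r'" for r r' c c'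
    using key[OF that, of "3/5" "4/5"] off[OF that] off[of r' r c c'] that by (simp add: algebra_simps)
  show ?thesis using off diag ctr0 by (rule pairing_eq_0)
qed

text \<open>The matrices \<open>1\<close>, \<open>\<sigma>\<^sub>x\<close>, \<open>\<sigma>\<^sub>y\<close>, \<open>\<sigma>\<^sub>z\<close> placed in rows \<open>r\<close>, \<open>r'\<close> and columns \<open>c\<close>, \<open>c'\<close>,
  and (for index 4) the permutation \<open>\<tau>\<close> placed in the remaining rows and columns.\<close>
definition pauli :: "nat \<Rightarrow> nat \<Rightarrow> nat \<Rightarrow> nat \<Rightarrow> nat \<Rightarrow> (nat \<Rightarrow> nat) \<Rightarrow> nat \<Rightarrow> nat \<times> nat \<Rightarrow> complex" where
  "pauli d r r' c c' \<tau> \<mu> = (\<lambda>y.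
     if \<mu> = 0 then entry r c y + entry r' c' y
     else if \<mu> = 1 then entry r c' y + entry r' c y
     else if \<mu> = 2 then \<i> * entry r' c y - \<i> * entry r c' y
     else if \<mu> = 3 then entry r c y - entry r' c' y
     else if snd y < d \<and> snd y \<noteq> c \<and> snd y \<noteq> c' \<and> fst y = \<tau> (snd y) then 1 else 0)"

lemma (in pauli_frame) Z_outside: "i \<notin> I \<or> j \<notin> I \<Longrightarrow> Z i j = 0"
  by (auto simp: Z_def T_def N_mult) (auto simp: N_def)

definition ker :: "nat \<Rightarrow> (nat \<Rightarrow> nat \<Rightarrow> nat \<times> nat \<Rightarrow> nat \<times> nat \<Rightarrow> complex) \<Rightarrow>
    nat \<Rightarrow> nat \<Rightarrow> nat \<times> nat \<Rightarrow> nat \<times> nat \<Rightarrow> nat \<times> nat \<Rightarrow> nat \<times> nat \<Rightarrow> complex" where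
  "ker n l p q x x' y y' = (\<Sum>f<n. cnj (l f p x y) * l f q x' y')"

text \<open>Here \<open>l f p x y\<close> are the coefficients of a bilinear map \<open>(X, Y) \<mapsto> L(X, Y)\<close> into matrices,
  and \<open>bform\<close> is the linear extension of \<open>L(X, Y)\<^sup>* L(X', Y')\<close> in \<open>u = ob X X'\<close>, \<open>v = ob Y Y'\<close>.\<close>
definition bform where
  "bform n a b l u v p q = pairing a (\<lambda>x x'. pairing b (ker n l p q x x') v) u"

lemma bform_alt: "bform n a b l u v p q = pairing b (\<lambda>y y'. pairing a (\<lambda>x x'. ker n l p q x x' y y') u) v"
proof -
  have "bform n a b l u v p q = (\<Sum>x\<in>sq a. \<Sum>x'\<in>sq a. \<Sum>y\<in>sq b. \<Sum>y'\<in>sq b. ker n l p q x x' y y' * u x x' * v y y')"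
    by (simp add: bform_def pairing_def sum_distrib_left sum_distrib_right mult_ac)
  also have "\<dots> = (\<Sum>x\<in>sq a. \<Sum>y\<in>sq b. \<Sum>x'\<in>sq a. \<Sum>y'\<in>sq b. ker n l p q x x' y y' * u x x' * v y y')"
    by (intro sum.cong refl sum.swap)
  also have "\<dots> = (\<Sum>y\<in>sq b. \<Sum>x\<in>sq a. \<Sum>x'\<in>sq a. \<Sum>y'\<in>sq b. ker n l p q x x' y y' * u x x' * v y y')"
    by (rule sum.swap)
  also have "\<dots> = (\<Sum>y\<in>sq b. \<Sum>x\<in>sq a. \<Sum>y'\<in>sq b. \<Sum>x'\<in>sq a. ker n l p q x x' y y' * u x x' * v y y')"
    by (intro sum.cong refl sum.swap)
  also have "\<dots> = (\<Sum>y\<in>sq b. \<Sum>y'\<in>sq b. \<Sum>x\<in>sq a. \<Sum>x'\<in>sq a. ker n l p q x x' y y' * u x x' * v y y')"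
    by (intro sum.cong refl sum.swap)
  finally show ?thesis
    by (simp add: pairing_def sum_distrib_left sum_distrib_right mult_ac)
qed

text \<open>One argument is a plain unitary, while the tensor in the other slot is restricted only
  through its contraction and may thus come from an operation with an ancilla. The scalar may be 0,
  which covers tensors of zero contraction.\<close>

locale two_slot =
  fixes n a b :: nat and l :: "nat \<Rightarrow> nat \<Rightarrow> nat \<times> nat \<Rightarrow> nat \<times> nat \<Rightarrow> complex"
  assumes unit_right: "\<And>Y u c p q. isom b Y \<Longrightarrow> (\<And>i j. i < a \<Longrightarrow> j < a \<Longrightarrow> ctr a u i j = (if i = j then c else 0)) \<Longrightarrow>
      p < n \<Longrightarrow> q < n \<Longrightarrow> bform n a b l u (ob Y Y) p q = (if p = q then c else 0)"
    and unit_left: "\<And>X v c p q. isom a X \<Longrightarrow> (\<And>i j. i < b \<Longrightarrow> j < b \<Longrightarrow> ctr b v i j = (if i = j then c else 0)) \<Longrightarrow>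
      p < n \<Longrightarrow> q < n \<Longrightarrow> bform n a b l (ob X X) v p q = (if p = q then c else 0)"
begin

abbreviation form :: "(nat \<times> nat \<Rightarrow> nat \<times> nat \<Rightarrow> complex) \<Rightarrow> (nat \<times> nat \<Rightarrow> nat \<times> nat \<Rightarrow> complex) \<Rightarrow> nat \<Rightarrow> nat \<Rightarrow> complex" where
  "form \<equiv> bform n a b l"

text \<open>\<open>L(X, V)\<close> as an operator with an ancilla on the second party: rows are
  \<open>(f, \<gamma>)\<close>, columns \<open>(p, \<alpha>)\<close>.\<close>

definition act :: "(nat \<times> nat \<Rightarrow> complex) \<Rightarrow> (nat \<Rightarrow> nat \<Rightarrow> nat \<times> nat \<Rightarrow> complex) \<Rightarrow> nat \<times> nat \<Rightarrow> nat \<times> nat \<Rightarrow> complex" where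
  "act X V = (\<lambda>(f, \<gamma>) (p, \<alpha>). \<Sum>(x, y)\<in>sq a \<times> sq b. l f p x y * X x * V \<gamma> \<alpha> y)"

text \<open>Sesquilinear expansion, general enough for its two uses: sums over ancilla blocks in
  \<open>act_gram\<close> and sums over Kraus labels in the link product.\<close>

lemma form_expand:
  "(\<Sum>f<n. \<Sum>e\<in>E. \<Sum>g\<in>G.
      cnj (\<Sum>x\<in>sq a. \<Sum>y\<in>sq b. l f p x y * X e x * Y g y) * (\<Sum>x\<in>sq a. \<Sum>y\<in>sq b. l f q x y * X' e x * Y' g y)) =
    form (\<lambda>x x'. \<Sum>e\<in>E. ob (X e) (X' e) x x') (\<lambda>y y'. \<Sum>g\<in>G. ob (Y g) (Y' g) y y') p q"
proof -
  let ?S = "sq a \<times> sq b" and ?I = "{..<n} \<times> E \<times> G"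
  define A where "A = (\<lambda>(f, e, g) z. l f p (fst z) (snd z) * X e (fst z) * Y g (snd z))"
  define B where "B = (\<lambda>(f, e, g) z. l f q (fst z) (snd z) * X' e (fst z) * Y' g (snd z))"
  have inner: "(\<Sum>s\<in>?I. cnj (A s z) * B s z') = ker n l p q (fst z) (fst z') (snd z) (snd z') *
      (\<Sum>e\<in>E. ob (X e) (X' e) (fst z) (fst z')) * (\<Sum>g\<in>G. ob (Y g) (Y' g) (snd z) (snd z'))" for z z'
  proof -
    have "(\<Sum>s\<in>?I. cnj (A s z) * B s z') = (\<Sum>f<n. \<Sum>e\<in>E. \<Sum>g\<in>G.
        cnj (l f p (fst z) (snd z)) * l f q (fst z') (snd z') * (ob (X e) (X' e) (fst z) (fst z') * ob (Y g) (Y' g) (snd z) (snd z')))"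
      by (simp add: sum.cartesian_product' A_def B_def ob_def algebra_simps)
    also have "\<dots> = ker n l p q (fst z) (fst z') (snd z) (snd z') *
      ((\<Sum>e\<in>E. ob (X e) (X' e) (fst z) (fst z')) * (\<Sum>g\<in>G. ob (Y g) (Y' g) (snd z) (snd z')))"
      unfolding sum_product ker_def sum_distrib_right by (simp add: sum_distrib_left)
    finally show ?thesis by (simp add: mult.assoc)
  qed
  have "(\<Sum>f<n. \<Sum>e\<in>E. \<Sum>g\<in>G.
      cnj (\<Sum>x\<in>sq a. \<Sum>y\<in>sq b. l f p x y * X e x * Y g y) * (\<Sum>x\<in>sq a. \<Sum>y\<in>sq b. l f q x y * X' e x * Y' g y)) =
     (\<Sum>s\<in>?I. (\<Sum>z\<in>?S. cnj (A s z)) * (\<Sum>z\<in>?S. B s z))"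
    by (simp add: A_def B_def sum.cartesian_product')
  also have "\<dots> = (\<Sum>s\<in>?I. \<Sum>z\<in>?S. \<Sum>z'\<in>?S. cnj (A s z) * B s z')"
    by (simp add: sum_product)
  also have "\<dots> = (\<Sum>z\<in>?S. \<Sum>s\<in>?I. \<Sum>z'\<in>?S. cnj (A s z) * B s z')"
    by (rule sum.swap)
  also have "\<dots> = (\<Sum>z\<in>?S. \<Sum>z'\<in>?S. \<Sum>s\<in>?I. cnj (A s z) * B s z')"
    by (intro sum.cong refl sum.swap)
  also have "\<dots> = (\<Sum>x\<in>sq a. \<Sum>y\<in>sq b. \<Sum>x'\<in>sq a. \<Sum>y'\<in>sq b.
      ker n l p q x x' y y' * (\<Sum>e\<in>E. ob (X e) (X' e) x x') * (\<Sum>g\<in>G. ob (Y g) (Y' g) y y'))"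
    unfolding inner by (simp only: sum.cartesian_product' fst_conv snd_conv)
  also have "\<dots> = (\<Sum>x\<in>sq a. \<Sum>x'\<in>sq a. \<Sum>y\<in>sq b. \<Sum>y'\<in>sq b.
      ker n l p q x x' y y' * (\<Sum>e\<in>E. ob (X e) (X' e) x x') * (\<Sum>g\<in>G. ob (Y g) (Y' g) y y'))"
    by (intro sum.cong refl sum.swap)
  also have "\<dots> = form (\<lambda>x x'. \<Sum>e\<in>E. ob (X e) (X' e) x x') (\<lambda>y y'. \<Sum>g\<in>G. ob (Y g) (Y' g) y y') p q"
    unfolding bform_def pairing_def sum_distrib_right by (intro sum.cong refl) (simp add: mult_ac)
  finally show ?thesis .
qed

lemma act_gram:
  "(\<Sum>s\<in>{..<n} \<times> {..<k}. cnj (act X V s (p, \<alpha>)) * act X' V s (q, \<beta>)) = form (ob X X') (gram k V \<alpha> \<beta>) p q"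
  using form_expand[where E = "{()}" and G = "{..<k}" and p = p and q = q and X = "\<lambda>_. X" and X' = "\<lambda>_. X'"
      and Y = "\<lambda>\<gamma>. V \<gamma> \<alpha>" and Y' = "\<lambda>\<gamma>. V \<gamma> \<beta>"]
  by (simp add: act_def gram_def sum.cartesian_product')

lemma act_sum: "act (\<lambda>x. \<Sum>\<mu>\<in>M. c \<mu> * P \<mu> x) V s t = (\<Sum>\<mu>\<in>M. c \<mu> * act (P \<mu>) V s t)"
proof -
  have "act (\<lambda>x. \<Sum>\<mu>\<in>M. c \<mu> * P \<mu> x) V s t =
    (\<Sum>z\<in>sq a \<times> sq b. \<Sum>\<mu>\<in>M. c \<mu> * (l (fst s) (fst t) (fst z) (snd z) * P \<mu> (fst z) * V (snd s) (snd t) (snd z)))"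
    by (simp add: act_def case_prod_unfold sum_distrib_left sum_distrib_right algebra_simps)
  also have "\<dots> = (\<Sum>\<mu>\<in>M. \<Sum>z\<in>sq a \<times> sq b. c \<mu> * (l (fst s) (fst t) (fst z) (snd z) * P \<mu> (fst z) * V (snd s) (snd t) (snd z)))"
    by (rule sum.swap)
  finally show ?thesis
    by (simp add: act_def case_prod_unfold sum_distrib_left)
qed


end

lemma pauli_entries:
  assumes "r \<noteq> r'" "c \<noteq> c'"
  shows "pauli d r r' c c' \<tau> 0 (s, x) = (if s = r then if x = c then 1 else 0 else if s = r' then if x = c' then 1 else 0 else 0)"
    "pauli d r r' c c' \<tau> 1 (s, x) = (if s = r then if x = c' then 1 else 0 else if s = r' then if x = c then 1 else 0 else 0)"
    "pauli d r r' c c' \<tau> 2 (s, x) = (if s = r then if x = c' then - \<i> else 0 else if s = r' then if x = c then \<i> else 0 else 0)"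
    "pauli d r r' c c' \<tau> 3 (s, x) = (if s = r then if x = c then 1 else 0 else if s = r' then if x = c' then - 1 else 0 else 0)"
    "pauli d r r' c c' \<tau> 4 (s, x) = (if x < d \<and> x \<noteq> c \<and> x \<noteq> c' \<and> s = \<tau> x then 1 else 0)"
  using assms by (simp_all add: pauli_def entry_def)

lemma isom_pauli:
  assumes b: "r < d" "r' < d" "c < d" "c' < d" "r \<noteq> r'" "c \<noteq> c'"
    and \<tau>: "bij_betw \<tau> ({..<d} - {c, c'}) ({..<d} - {r, r'})"
    and k: "pauli_unitary k"
  shows "isom d (\<lambda>y. \<Sum>\<mu><5. k \<mu> * pauli d r r' c c' \<tau> \<mu> y)"
proof -
  define X where "X = (\<lambda>y. \<Sum>\<mu><5. k \<mu> * pauli d r r' c c' \<tau> \<mu> y)"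
  \<comment> \<open>The two-by-two block: \<open>m0\<close>, \<open>m1\<close> form its column
    \<open>c\<close> and \<open>w0\<close>, \<open>w1\<close> its column \<open>c'\<close>;
    \<open>rel\<close> expresses unitarity.\<close>
  define m0 m1 w0 w1 where "m0 = k 0 + k 3" and "m1 = k 1 + \<i> * k 2"
    and "w0 = k 1 - \<i> * k 2" and "w1 = k 0 - k 3"
  have rel: "cnj m0 * m0 + cnj m1 * m1 = 1" "cnj w0 * w0 + cnj w1 * w1 = 1"
    "cnj m0 * w0 + cnj m1 * w1 = 0" "cnj (k 4) * k 4 = 1"
    using k by (simp_all add: pauli_unitary_def m0_def m1_def w0_def w1_def)
  have rel': "cnj w0 * m0 + cnj w1 * m1 = 0"
    using arg_cong[OF rel(3), of cnj] by (simp add: mult.commute)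
  have five: "(\<Sum>\<mu><5. h \<mu>) = h 0 + h 1 + h 2 + h 3 + h (4::nat)" for h :: "nat \<Rightarrow> complex"
    by (simp add: eval_nat_numeral)
  have tin: "\<tau> j < d \<and> \<tau> j \<noteq> r \<and> \<tau> j \<noteq> r'" if "j < d" "j \<noteq> c" "j \<noteq> c'" for j
    using bij_betwE[OF \<tau>] that by simp
  have tinj: "\<tau> i = \<tau> j \<longleftrightarrow> i = j" if "j < d" "j \<noteq> c" "j \<noteq> c'" "i < d" "i \<noteq> c" "i \<noteq> c'" for i j
    using inj_on_eq_iff[OF bij_betw_imp_inj_on[OF \<tau>], of i j] that by simp
  note P = pauli_entries[OF b(5,6)]
  have Xc: "X (s, c) = (if s = r then m0 else if s = r' then m1 else 0)" for s
    using b(5,6) unfolding X_def five P by (simp add: m0_def m1_def w0_def w1_def)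
  have Xc': "X (s, c') = (if s = r then w0 else if s = r' then w1 else 0)" for s
    using b(5,6) unfolding X_def five P by (simp add: m0_def m1_def w0_def w1_def)
  have Xj: "X (s, j) = (if s = \<tau> j then k 4 else 0)" if "j < d" "j \<noteq> c" "j \<noteq> c'" for s j
    using that unfolding X_def five P by simp
  have two: "(\<Sum>s<d. if s = r then A else if s = r' then B else 0) = A + B" for A B :: complex
  proof -
    have "(if x = r then A else if x = r' then B else 0) = (if x = r then A else 0) + (if x = r' then B else 0)" for x
      using b(5) by auto
    then show ?thesis using b by (simp add: sum.distrib)
  qed
  have prod2: "cnj (if s = r then A else if s = r' then B else 0) * (if s = r then C else if s = r' then D else 0) =
     (if s = r then cnj A * C else if s = r' then cnj B * D else 0)" for s and A B C D :: complex
    by simp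
  have prodt: "cnj (if s = r then A else if s = r' then B else 0) * (if s = \<tau> j then C else 0) = 0"
      "cnj (if s = \<tau> j then C else 0) * (if s = r then A else if s = r' then B else 0) = 0"
    if "j < d" "j \<noteq> c" "j \<noteq> c'" for s j and A B C :: complex
    using tin[OF that] by auto
  have prodtt: "cnj (if s = \<tau> i then C else 0) * (if s = \<tau> j then C else 0) = (if s = \<tau> i then if i = j then cnj C * C else 0 else 0)"
    if "j < d" "j \<noteq> c" "j \<noteq> c'" "i < d" "i \<noteq> c" "i \<noteq> c'" for s i j and C :: complex
    using tinj[OF that] by auto
  have "ctr d (ob X X) i j = (if i = j then 1 else 0)" if ij: "i < d" "j < d" for i j
  proof -
    consider (1) "i = c" "j = c" |
        (2) "i = c" "j = c'" |
        (3) "i = c" "j \<noteq> c" "j \<noteq> c'" |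
        (4) "i = c'" "j = c" |
        (5) "i = c'" "j = c'" |
        (6) "i = c'" "j \<noteq> c" "j \<noteq> c'" |
        (7) "j = c" "i \<noteq> c" "i \<noteq> c'" |
        (8) "j = c'" "i \<noteq> c" "i \<noteq> c'" |
        (9) "i \<noteq> c" "i \<noteq> c'" "j \<noteq> c" "j \<noteq> c'"
      by blast
    then have "(\<Sum>s<d. cnj (X (s, i)) * X (s, j)) = (if i = j then 1 else 0)"
    proof cases
      case h: 1
      show ?thesis unfolding h Xc prod2 two rel by simp
    next
      case h: 2
      show ?thesis using b(6) unfolding h Xc Xc' prod2 two rel by simp
    next
      case h: 3
      show ?thesis unfolding h(1) Xc Xj[OF ij(2) h(2,3)] prodt[OF ij(2) h(2,3)] using h by simp
    next
      case h: 4
      show ?thesis using b(6) unfolding h Xc Xc' prod2 two rel' by simp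
    next
      case h: 5
      show ?thesis unfolding h Xc' prod2 two rel by simp
    next
      case h: 6
      show ?thesis unfolding h(1) Xc' Xj[OF ij(2) h(2,3)] prodt[OF ij(2) h(2,3)] using h by simp
    next
      case h: 7
      show ?thesis unfolding h(1) Xc Xj[OF ij(1) h(2,3)] prodt[OF ij(1) h(2,3)] using h by simp
    next
      case h: 8
      show ?thesis unfolding h(1) Xc' Xj[OF ij(1) h(2,3)] prodt[OF ij(1) h(2,3)] using h by simp
    next
      case h: 9
      show ?thesis unfolding Xj[OF ij(1) h(1,2)] Xj[OF ij(2) h(3,4)] prodtt[OF ij(2) h(3,4) ij(1) h(1,2)]
        using tin[OF ij(1) h(1,2)] by (simp add: rel)
    qed
    then show ?thesis by (simp add: ctr_def ob_def)
  qed
  then show ?thesis by (simp add: isom_def X_def)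
qed

text \<open>This is \<open>\<sigma>_x \<sigma>_y = \<i> \<sigma>_z\<close> written as a vanishing
  contraction. The form of this tensor gives the entries of \<open>Z\<close>, so
  \<open>unitary_null_slice\<close> applies to the defect.\<close>

lemma ctr_pauli_relation:
  assumes b: "r < d" "r' < d" "c < d" "c' < d" "r \<noteq> r'" "c \<noteq> c'"
  shows "ctr d (\<lambda>x x'. \<i> * ob (pauli d r r' c c' \<tau> 1) (pauli d r r' c c' \<tau> 2) x x' +
    ob (pauli d r r' c c' \<tau> 0) (pauli d r r' c c' \<tau> 3) x x') i j = 0"
proof -
  note P = pauli_entries[OF b(5,6)]
  have "\<i> * ob (pauli d r r' c c' \<tau> 1) (pauli d r r' c c' \<tau> 2) (s, i) (s, j) +
      ob (pauli d r r' c c' \<tau> 0) (pauli d r r' c c' \<tau> 3) (s, i) (s, j) =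
     (if s = r then (if i = c' \<and> j = c' then 1 else 0) + (if i = c \<and> j = c then 1 else 0) else 0) -
     (if s = r' then (if i = c' \<and> j = c' then 1 else 0) + (if i = c \<and> j = c then 1 else 0) else 0)" for s
    using b(5,6) unfolding ob_def P by simp
  then show ?thesis
    using b by (simp add: ctr_def sum_subtractf)
qed

section \<open>The multiplicativity defect and its vanishing\<close>

context two_slot
begin

text \<open>Each Gram block of \<open>V\<close> has contraction 1 or 0 times the identity, so
  \<open>unit_left\<close> applies although \<open>V\<close> involves an ancilla.\<close>

lemma pauli_frame_act:
  assumes b: "r < a" "r' < a" "c < a" "c' < a" "r \<noteq> r'" "c \<noteq> c'"
    and \<tau>: "bij_betw \<tau> ({..<a} - {c, c'}) ({..<a} - {r, r'})"
    and V: "block_isom k b V"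
  shows "pauli_frame ({..<n} \<times> {..<k}) (\<lambda>\<mu>. act (pauli a r r' c c' \<tau> \<mu>) V)"
proof
  fix w i j assume w: "pauli_unitary w" and ij: "i \<in> {..<n} \<times> {..<k}" "j \<in> {..<n} \<times> {..<k}"
  obtain p \<alpha> q \<beta> where pq: "i = (p, \<alpha>)" "j = (q, \<beta>)" by fastforce
  let ?P = "pauli a r r' c c' \<tau>" and ?I = "{..<n} \<times> {..<k}"
  let ?X = "\<lambda>x. \<Sum>\<mu><5. w \<mu> * ?P \<mu> x"
  have "(\<Sum>\<mu><5. \<Sum>\<nu><5. cnj (w \<mu>) * w \<nu> * (\<Sum>s\<in>?I. cnj (act (?P \<mu>) V s i) * act (?P \<nu>) V s j))
     = (\<Sum>\<mu><5. \<Sum>\<nu><5. \<Sum>s\<in>?I. (cnj (w \<mu>) * cnj (act (?P \<mu>) V s i)) * (w \<nu> * act (?P \<nu>) V s j))"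
    by (simp add: sum_distrib_left mult_ac)
  also have "\<dots> = (\<Sum>\<mu><5. \<Sum>s\<in>?I. \<Sum>\<nu><5. (cnj (w \<mu>) * cnj (act (?P \<mu>) V s i)) * (w \<nu> * act (?P \<nu>) V s j))"
    by (intro sum.cong refl sum.swap)
  also have "\<dots> = (\<Sum>s\<in>?I. \<Sum>\<mu><5. \<Sum>\<nu><5. (cnj (w \<mu>) * cnj (act (?P \<mu>) V s i)) * (w \<nu> * act (?P \<nu>) V s j))"
    by (rule sum.swap)
  also have "\<dots> = (\<Sum>s\<in>?I. cnj (act ?X V s i) * act ?X V s j)"
    by (simp add: act_sum flip: sum_product)
  also have "\<dots> = form (ob ?X ?X) (gram k V \<alpha> \<beta>) p q"
    unfolding pq by (rule act_gram)
  also have "\<dots> = (if p = q then (if \<alpha> = \<beta> then 1 else 0) else 0)"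
    using V ij unfolding pq by (intro unit_left isom_pauli b \<tau> w) (auto simp: block_isom_def)
  finally show "(\<Sum>\<mu><5. \<Sum>\<nu><5. cnj (w \<mu>) * w \<nu> * (\<Sum>s\<in>?I. cnj (act (?P \<mu>) V s i) * act (?P \<nu>) V s j))
    = (if i = j then 1 else 0)"
    by (simp add: pq)
qed simp

definition slice :: "(nat \<times> nat \<Rightarrow> nat \<times> nat \<Rightarrow> complex) \<Rightarrow> nat \<Rightarrow> nat \<Rightarrow> nat \<times> nat \<Rightarrow> nat \<times> nat \<Rightarrow> complex" where
  "slice u p q = (\<lambda>y y'. pairing a (\<lambda>x x'. ker n l p q x x' y y') u)"

lemma form_slice: "form u v p q = pairing b (slice u p q) v"
  by (simp add: bform_alt slice_def)

lemma form_add: "form (\<lambda>x x'. u x x' + w x x') v p q = form u v p q + form w v p q"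
  and form_diff: "form (\<lambda>x x'. u x x' - w x x') v p q = form u v p q - form w v p q"
  and form_scale: "form (\<lambda>x x'. s * u x x') v p q = s * form u v p q"
  by (simp_all add: bform_def pairing_add pairing_diff pairing_scale)

text \<open>The case \<open>c = 0\<close> of \<open>unit_right\<close>. Here the unitaries of the
  second party vary, whereas \<open>pauli_frame_act\<close> varies those of the first.\<close>

lemma unitary_null_slice:
  assumes "\<And>i j. i < a \<Longrightarrow> j < a \<Longrightarrow> ctr a u i j = 0" "p < n" "q < n"
  shows "unitary_null b (slice u p q)"
  using unit_right[of _ u 0 p q] assms by unfold_locales (simp add: form_slice)

text \<open>The multiplicativity defect of the block Pauli matrices is scaled by \<open>16/25\<close> when the
  reflection \<open>H\<close> is replaced by its rotation. As the cube of a defect is four times that defect, it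
  vanishes.\<close>
lemma defect_zero:
  assumes b: "r < a" "r' < a" "c < a" "c' < a" "r \<noteq> r'" "c \<noteq> c'"
    and \<tau>: "bij_betw \<tau> ({..<a} - {c, c'}) ({..<a} - {r, r'})"
    and H: "block_isom k b H" "block_herm k b H"
    and pq: "p < n" "q < n" "\<alpha> < k" "\<beta> < k"
  shows "form (\<lambda>x x'. \<i> * ob (pauli a r r' c c' \<tau> 1) (pauli a r r' c c' \<tau> 2) x x' +
    ob (pauli a r r' c c' \<tau> 0) (pauli a r r' c c' \<tau> 3) x x') (gram k H \<alpha> \<beta>) p q = 0"
proof -
  let ?I = "{..<n} \<times> {..<k}" and ?P = "pauli a r r' c c' \<tau>"
  let ?u = "\<lambda>x x'. \<i> * ob (?P 1) (?P 2) x x' + ob (?P 0) (?P 3) x x'"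
  interpret F: pauli_frame ?I "\<lambda>\<mu>. act (?P \<mu>) H"
    by (rule pauli_frame_act[OF b \<tau> H(1)])
  interpret R: pauli_frame ?I "\<lambda>\<mu>. act (?P \<mu>) (rotation H)"
    by (rule pauli_frame_act[OF b \<tau> block_isom_rotation[OF H]])
  have ZF: "F.Z (p, \<alpha>) (q, \<beta>) = form ?u (gram k H \<alpha> \<beta>) p q"
    and ZR: "R.Z (p, \<alpha>) (q, \<beta>) = form ?u (gram k (rotation H) \<alpha> \<beta>) p q"
    if "p < n" "q < n" "\<alpha> < k" "\<beta> < k" for p q \<alpha> \<beta>
    using that by (simp_all add: F.Z_apply R.Z_apply F.J_def R.J_def act_gram form_add form_scale)
  have "form ?u (gram k (rotation H) \<alpha> \<beta>) p q = 16/25 * form ?u (gram k H \<alpha> \<beta>) p q"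
    if "p < n" "q < n" "\<alpha> < k" "\<beta> < k" for p q \<alpha> \<beta>
  proof -
    interpret unitary_null b "slice ?u p q"
      using that by (intro unitary_null_slice ctr_pauli_relation b)
    show ?thesis
      unfolding form_slice by (rule pairing_gram_rotation) (use H that in auto)
  qed
  then have "R.Z i j = 16/25 * F.Z i j" if "i \<in> ?I" "j \<in> ?I" for i j
    using that by (cases i; cases j) (simp add: ZF ZR)
  \<comment> \<open>\<open>Z_cubed\<close> is an equation of functions, so the scaling is also
    needed outside \<open>?I\<close>, where both defects are 0.\<close>
  then have scale: "R.Z = (\<lambda>i j. 16/25 * F.Z i j)"
    by (intro ext) (metis F.Z_outside R.Z_outside mult_zero_right)
  have "4 * (16/25 * F.Z i j) = 16/25 * (16/25 * (16/25 * (4 * F.Z i j)))" for i j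
    using fun_cong[OF fun_cong[OF R.Z_cubed], of i j] fun_cong[OF fun_cong[OF F.Z_cubed], of i j]
    unfolding scale kmul_scale_left kmul_scale_right by simp
  then have "F.Z (p, \<alpha>) (q, \<beta>) = 0" 
    by (simp add: algebra_simps)
  then show ?thesis using ZF pq by simp
qed

text \<open>With zero defect the form depends on two block Pauli matrices only through their
  product. Matrix units follow suit: the adjoint of one times another is 0 for distinct rows, and
  for a common row it does not depend on that row.\<close>

lemma form_reflection:
  assumes b: "r < a" "r' < a" "c < a" "c' < a" "r \<noteq> r'"
    and H: "block_isom k b H" "block_herm k b H"
    and pq: "p < n" "q < n" "\<alpha> < k" "\<beta> < k"
  shows "form (ob (entry r c) (entry r' c')) (gram k H \<alpha> \<beta>) p q = 0"
    and "form (ob (entry r c) (entry r c')) (gram k H \<alpha> \<beta>) p q =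
      form (ob (entry r' c) (entry r' c')) (gram k H \<alpha> \<beta>) p q"
proof -
  let ?f = "\<lambda>x x'. form (ob x x') (gram k H \<alpha> \<beta>) p q"
  have *: "?f (entry r c) (entry r' c') = 0 \<and> ?f (entry r c) (entry r' c) = 0 \<and>
      ?f (entry r c) (entry r c') = ?f (entry r' c) (entry r' c') \<and> ?f (entry r c) (entry r c) = ?f (entry r' c) (entry r' c)"
    if c: "c < a" "c' < a" "c \<noteq> c'" for c c'
  proof -
    \<comment> \<open>Any bijection of the remaining columns and rows completes the block to a
      unitary.\<close>
    have "card ({..<a} - {c, c'}) = card ({..<a} - {r, r'})"
      using b c by (simp add: card_Diff_subset)
    then obtain \<tau> where \<tau>: "bij_betw \<tau> ({..<a} - {c, c'}) ({..<a} - {r, r'})"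
      using finite_same_card_bij[of "{..<a} - {c, c'}" "{..<a} - {r, r'}"] by blast
    let ?I = "{..<n} \<times> {..<k}" and ?P = "pauli a r r' c c' \<tau>"
    interpret F: pauli_frame ?I "\<lambda>\<mu>. act (?P \<mu>) H"
      by (rule pauli_frame_act[OF b(1,2) c(1,2) b(5) c(3) \<tau> H(1)])
    let ?i = "(p, \<alpha>)" and ?j = "(q, \<beta>)"
    have ij: "?i \<in> ?I" "?j \<in> ?I" using pq by auto
    have J: "F.J \<mu> \<nu> (p, \<alpha>) (q, \<beta>) = form (ob (?P \<mu>) (?P \<nu>)) (gram k H \<alpha> \<beta>) p q" for \<mu> \<nu> p q \<alpha> \<beta>
      by (simp add: F.J_def act_gram)
    have "\<i> * F.J 1 2 i j + F.J 0 3 i j = 0" if "i \<in> ?I" "j \<in> ?I" for i j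
      using that defect_zero[OF b(1,2) c(1,2) b(5) c(3) \<tau> H]
      by (cases i; cases j) (simp add: J form_add form_scale)
    note mult = F.J_multiplicative[OF this ij] and lin = F.J_linear_relations[OF ij]
    define g where "g \<mu> \<nu> = F.J \<mu> \<nu> ?i ?j" for \<mu> \<nu>
    have rel: "g 1 1 = g 0 0" "g 2 2 = g 0 0" "g 3 3 = g 0 0"
      "g 1 0 = g 0 1" "g 2 0 = g 0 2" "g 3 0 = g 0 3"
      "g 1 2 = \<i> * g 0 3" "g 2 1 = - \<i> * g 0 3" "g 1 3 = - \<i> * g 0 2" "g 3 1 = \<i> * g 0 2"
      "g 2 3 = \<i> * g 0 1" "g 3 2 = - \<i> * g 0 1"
      unfolding g_def using mult lin(3)[of 1] lin(3)[of 2] lin(3)[of 3] lin(4)[of 1] lin(4)[of 2] lin(4)[of 3] lin(5,6,7)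
      by simp_all
    have E: "entry r c = (\<lambda>y. 1/2 * ?P 0 y + 1/2 * ?P 3 y)" "entry r' c' = (\<lambda>y. 1/2 * ?P 0 y + (- 1/2) * ?P 3 y)"
       "entry r c' = (\<lambda>y. 1/2 * ?P 1 y + \<i>/2 * ?P 2 y)" "entry r' c = (\<lambda>y. 1/2 * ?P 1 y + (- \<i>/2) * ?P 2 y)"
      by (simp_all add: pauli_def fun_eq_iff algebra_simps)
    have comb: "?f (\<lambda>y. s * ?P \<mu> y + t * ?P \<nu> y) (\<lambda>y. s' * ?P \<mu>' y + t' * ?P \<nu>' y) =
        cnj s * s' * g \<mu> \<mu>' + cnj s * t' * g \<mu> \<nu>' + cnj t * s' * g \<nu> \<mu>' + cnj t * t' * g \<nu> \<nu>'"
      for s t s' t' \<mu> \<nu> \<mu>' \<nu>'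
    proof -
      have "ob (\<lambda>y. s * ?P \<mu> y + t * ?P \<nu> y) (\<lambda>y. s' * ?P \<mu>' y + t' * ?P \<nu>' y) = (\<lambda>x x'.
        cnj s * s' * ob (?P \<mu>) (?P \<mu>') x x' + cnj s * t' * ob (?P \<mu>) (?P \<nu>') x x' +
        cnj t * s' * ob (?P \<nu>) (?P \<mu>') x x' + cnj t * t' * ob (?P \<nu>) (?P \<nu>') x x')"
        by (simp add: ob_def fun_eq_iff algebra_simps)
      then show ?thesis by (simp only: form_add form_scale g_def J)
    qed
    show ?thesis
      unfolding E comb rel by simp
  qed
  show "?f (entry r c) (entry r' c') = 0" "?f (entry r c) (entry r c') = ?f (entry r' c) (entry r' c')"
  proof -
    \<comment> \<open>\<open>*\<close> requires distinct columns. For \<open>c = c'\<close> it is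
      used with an auxiliary column, which exists because \<open>r\<close> and \<open>r'\<close> are
      distinct indices below \<open>a\<close>.\<close>
    obtain d where d: "d < a" "d \<noteq> c"
      using b(1,2,5) by (metis)
    show "?f (entry r c) (entry r' c') = 0" "?f (entry r c) (entry r c') = ?f (entry r' c) (entry r' c')"
      using *[OF b(3,4)] *[OF b(3) d(1) d(2)[symmetric]] by (cases "c = c'", auto)+
  qed
qed

text \<open>The first party is reduced to matrix units by \<open>pairing_eq_0\<close>, the second to
  reflections with a three-dimensional ancilla; \<open>form_reflection\<close> treats exactly this
  combination.\<close>

lemma form_zero:
  assumes u: "\<And>i j. i < a \<Longrightarrow> j < a \<Longrightarrow> ctr a u i j = 0"
    and v: "\<And>i j. i < b \<Longrightarrow> j < b \<Longrightarrow> ctr b v i j = 0"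
    and pq: "p < n" "q < n"
  shows "form u v p q = 0"
  unfolding bform_def
proof (rule pairing_eq_0[OF _ _ u])
  let ?g = "\<lambda>x x'. pairing b (ker n l p q x x') v"
  fix r r' c c' assume b: "r < a" "r' < a" "c < a" "c' < a" "r \<noteq> r'"
  have g: "?g (s, d) (s', d') = form (ob (entry s d) (entry s' d')) v p q" if "s < a" "s' < a" "d < a" "d' < a" for s s' d d'
    using that by (simp add: bform_def pairing_entry)
  have "form (ob (entry r c) (entry r' c')) v p q = 0"
    unfolding form_slice
  proof (rule pairing_zero_of_reflections[OF _ v])
    fix H assume "block_herm 3 b H" "block_isom 3 b H"
    then show "pairing b (slice (ob (entry r c) (entry r' c')) p q) (gram 3 H 0 1) = 0"
      using form_reflection(1)[OF b _ _ pq, of 3 H 0 1] by (simp add: form_slice)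
  qed
  then show "?g (r, c) (r', c') = 0" using b by (simp add: g)
  have "form (\<lambda>x x'. ob (entry r c) (entry r c') x x' - ob (entry r' c) (entry r' c') x x') v p q = 0"
    unfolding form_slice
  proof (rule pairing_zero_of_reflections[OF _ v])
    fix H assume "block_herm 3 b H" "block_isom 3 b H"
    then show "pairing b (slice (\<lambda>x x'. ob (entry r c) (entry r c') x x' - ob (entry r' c) (entry r' c') x x') p q) (gram 3 H 0 1) = 0"
      using form_reflection(2)[OF b _ _ pq, of 3 H 0 1] unfolding form_slice[symmetric] form_diff by simp
  qed
  then show "?g (r, c) (r, c') = ?g (r', c) (r', c')" using b by (simp add: g form_diff)
qed

lemma form_unital:
  assumes u: "\<And>i j. i < a \<Longrightarrow> j < a \<Longrightarrow> ctr a u i j = (if i = j then s else 0)"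
    and v: "\<And>i j. i < b \<Longrightarrow> j < b \<Longrightarrow> ctr b v i j = (if i = j then t else 0)"
    and pq: "p < n" "q < n"
  shows "form u v p q = (if p = q then s * t else 0)"
proof -
  let ?u = "\<lambda>x x'. u x x' - s * ob idk idk x x'" and ?v = "\<lambda>y y'. v y y' - t * ob idk idk y y'"
  have right: "form w (\<lambda>y y'. v y y' - t * ob idk idk y y') p q = form w v p q - t * form w (ob idk idk) p q" for w
    by (simp add: form_slice pairing_diff pairing_scale)
  have "form ?u ?v p q = 0"
    by (rule form_zero) (simp_all add: ctr_diff ctr_scale ctr_idk u v pq)
  \<comment> \<open>Each remaining term has an identity tensor as an argument, so the locale
    assumptions evaluate it to \<open>s * t\<close> for \<open>p = q\<close> and to 0
    otherwise.\<close>
  then have "form u v p q = t * form u (ob idk idk) p q + s * form (ob idk idk) v p q - s * t * form (ob idk idk) (ob idk idk) p q"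
    unfolding right form_diff form_scale by (simp add: algebra_simps)
  then show ?thesis
    using unit_right[OF isom_idk u pq] unit_left[OF isom_idk v pq] unit_left[OF isom_idk ctr_idk pq] by simp
qed

end

section \<open>Positive forms and Choi operators\<close>

definition quad :: "'i set \<Rightarrow> ('i \<Rightarrow> 'i \<Rightarrow> complex) \<Rightarrow> ('i \<Rightarrow> complex) \<Rightarrow> complex" where
  "quad I A v = (\<Sum>i\<in>I. \<Sum>j\<in>I. cnj (v i) * A i j * v j)"

lemma quad_insert:
  assumes "finite I" "x \<notin> I"
  shows "quad (insert x I) A v = cnj (v x) * A x x * v x + cnj (v x) * (\<Sum>j\<in>I. A x j * v j) +
    (\<Sum>i\<in>I. cnj (v i) * A i x) * v x + quad I A v"
  using assms by (simp add: quad_def sum.distrib sum_distrib_left sum_distrib_right mult.assoc)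

lemma quad_cong: "(\<And>i. i \<in> I \<Longrightarrow> v i = w i) \<Longrightarrow> quad I A v = quad I A w"
  by (simp add: quad_def)

lemma quad_two_points:
  assumes "finite I" "i \<in> I" "j \<in> I" "i \<noteq> j"
  shows "quad I A (\<lambda>k. if k = i then s else if k = j then t else 0) =
    cnj s * A i i * s + cnj s * A i j * t + cnj t * A j i * s + cnj t * A j j * t"
proof -
  have e: "cnj (if k = i then s else if k = j then t else 0) * X = (if k = i then cnj s * X else 0) + (if k = j then cnj t * X else 0)"
    "X * (if k = i then s else if k = j then t else 0) = (if k = i then X * s else 0) + (if k = j then X * t else 0)"
    "(if P then X else 0) * Y = (if P then X * Y else 0)"
    for k P and X Y :: complex using assms(4) by auto
  show ?thesis using assms
    by (simp add: quad_def e sum.distrib distrib_left distrib_right mult.assoc)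
qed

definition pos_form :: "'i set \<Rightarrow> ('i \<Rightarrow> 'i \<Rightarrow> complex) \<Rightarrow> bool" where
  "pos_form I A \<longleftrightarrow> (\<forall>v. Im (quad I A v) = 0 \<and> 0 \<le> Re (quad I A v))"

lemma pos_form_diag:
  assumes "pos_form I A" "finite I" "i \<in> I"
  shows "Im (A i i) = 0" "0 \<le> Re (A i i)"
proof -
  have e: "cnj (if k = i then 1 else 0) * X = (if k = i then X else 0)" "X * (if k = i then 1 else 0) = (if k = i then X else 0)" for k and X :: complex
    by auto
  have "quad I A (\<lambda>k. if k = i then 1 else 0) = A i i"
    using assms by (simp add: quad_def e mult.assoc)
  then show "Im (A i i) = 0" "0 \<le> Re (A i i)"
    using assms(1) by (auto simp: pos_form_def dest: spec[of _ "\<lambda>k. if k = i then 1 else 0"])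
qed

lemma pos_form_herm:
  assumes pos: "pos_form I A" and fin: "finite I" and ij: "i \<in> I" "j \<in> I"
  shows "A j i = cnj (A i j)"
proof (cases "i = j")
  case True
  then show ?thesis using pos_form_diag[OF pos fin ij(1)] by (simp add: complex_eq_iff)
next
  case False
  have im: "Im (quad I A v) = 0" for v using pos by (simp add: pos_form_def)
  show ?thesis
    using im[of "\<lambda>k. if k = i then 1 else if k = j then 1 else 0"] im[of "\<lambda>k. if k = i then 1 else if k = j then \<i> else 0"]
      pos_form_diag[OF pos fin ij(1)] pos_form_diag[OF pos fin ij(2)]
    unfolding quad_two_points[OF fin ij False] by (simp add: complex_eq_iff)
qed

lemma pos_form_null_row:
  assumes pos: "pos_form I A" and fin: "finite I" and ij: "i \<in> I" "j \<in> I" and z: "A i i = 0"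
  shows "A i j = 0"
proof (rule ccontr)
  assume nz: "A i j \<noteq> 0"
  then have ne: "i \<noteq> j" using z by auto
  define N where "N = (cmod (A i j))\<^sup>2"
  have N: "N > 0" using nz by (simp add: N_def)
  have N_alt: "N = Re (A i j) * Re (A i j) + Im (A i j) * Im (A i j)"
    by (simp add: N_def cmod_power2 flip: power2_eq_square)
  \<comment> \<open>Chosen so that the form takes the value -1.\<close>
  define s where "s = (Re (A j j) + 1) / (2 * N)"
  have "0 \<le> Re (quad I A (\<lambda>k. if k = i then - (s * A i j) else if k = j then 1 else 0))"
    using pos by (simp add: pos_form_def)
  also have "\<dots> = - 2 * s * N + Re (A j j)"
    unfolding quad_two_points[OF fin ij ne] pos_form_herm[OF pos fin ij]
    by (simp add: z N_alt algebra_simps)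
  also have "\<dots> = - 1"
    using N by (simp add: s_def field_simps)
  finally show False by simp
qed

text \<open>A positive semidefinite kernel is a sum of rank-one kernels: split off one row at a time by a
  Schur complement (where a zero pivot forces a zero row, matching \<open>x / 0 = 0\<close>).\<close>
lemma pos_form_gram:
  assumes "finite I" "pos_form I A"
  shows "\<exists>m f. \<forall>i\<in>I. \<forall>j\<in>I. A i j = (\<Sum>k<m::nat. f k i * cnj (f k j))"
  using assms
proof (induction I arbitrary: A rule: finite_induct)
  case (insert x I)
  let ?X = "insert x I"
  have fin: "finite ?X" using insert by simp
  note diag = pos_form_diag[OF insert.prems fin, of x] and herm = pos_form_herm[OF insert.prems fin]
    and null = pos_form_null_row[OF insert.prems fin, of x]
  define d where "d = Re (A x x)"
  have d: "A x x = of_real d" "0 \<le> d" using diag by (simp_all add: d_def complex_eq_iff)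
  define B where "B i j = A i j - A i x * A x j / of_real d" for i j
  have "pos_form I B"
    unfolding pos_form_def
  proof
    fix v
    define S where "S = (\<Sum>j\<in>I. A x j * v j)"
    \<comment> \<open>For \<open>d > 0\<close> this entry minimizes the form for given
      \<open>v\<close>, and the minimum is the Schur complement. For \<open>d = 0\<close> it is 0,
      and \<open>S = 0\<close> because a zero pivot forces a zero row.\<close>
    define w where "w = v(x := - S / of_real d)"
    have cS: "(\<Sum>i\<in>I. cnj (v i) * A i x) = cnj S"
      using herm[of x] by (simp add: S_def mult.commute)
    have wv: "w i = v i" if "i \<in> I" for i using that insert.hyps by (auto simp: w_def)
    have "quad I B v = quad I A v - cnj S * S / of_real d"
    proof -
      have "quad I B v = quad I A v - (\<Sum>i\<in>I. \<Sum>j\<in>I. (cnj (v i) * A i x) * (A x j * v j)) / of_real d"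
        by (simp add: quad_def B_def sum_subtractf sum_divide_distrib algebra_simps)
      then show ?thesis by (simp add: sum_product[symmetric] cS flip: S_def)
    qed
    moreover have "quad ?X A w = cnj (w x) * of_real d * w x + cnj (w x) * S + cnj S * w x + quad I A v"
    proof -
      have "(\<Sum>j\<in>I. A x j * w j) = S" "(\<Sum>i\<in>I. cnj (w i) * A i x) = cnj S"
      proof -
        have "(\<Sum>i\<in>I. cnj (w i) * A i x) = (\<Sum>i\<in>I. cnj (v i) * A i x)"
          by (intro sum.cong refl) (simp add: wv)
        then show "(\<Sum>j\<in>I. A x j * w j) = S" "(\<Sum>i\<in>I. cnj (w i) * A i x) = cnj S"
          using cS by (simp_all add: S_def wv)
      qed
      moreover have "quad I A w = quad I A v"
        by (rule quad_cong) (rule wv)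
      ultimately show ?thesis
        unfolding quad_insert[OF insert.hyps] d(1) by simp
    qed
    ultimately have "quad ?X A w = quad I B v"
    proof (cases "d = 0")
      case True
      then have "S = 0" using null d by (simp add: S_def)
      then show ?thesis using \<open>quad ?X A w = _\<close> \<open>quad I B v = _\<close> by (simp add: w_def)
    next
      case False
      then have "cnj (w x) * of_real d * w x + cnj (w x) * S + cnj S * w x = - (cnj S * S / of_real d)"
        by (simp add: w_def field_simps)
      then show ?thesis using \<open>quad ?X A w = _\<close> \<open>quad I B v = _\<close> by simp
    qed
    then show "Im (quad I B v) = 0 \<and> 0 \<le> Re (quad I B v)"
      using insert.prems unfolding pos_form_def by metis
  qed
  then obtain m f where f: "\<And>i j. i \<in> I \<Longrightarrow> j \<in> I \<Longrightarrow> B i j = (\<Sum>k<m::nat. f k i * cnj (f k j))"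
    using insert.IH by blast
  define g where "g k i = (if k = m then A i x / of_real (sqrt d) else if i = x then 0 else f k i)" for k i
  have sq: "complex_of_real (sqrt d) * complex_of_real (sqrt d) = of_real d"
    using d(2) by (simp flip: of_real_mult)
  have "A i j = (\<Sum>k<Suc m. g k i * cnj (g k j))" if ij: "i \<in> ?X" "j \<in> ?X" for i j
  proof -
    have "A i j = (if i = x \<or> j = x then 0 else B i j) + A i x * A x j / of_real d"
    proof (cases "d = 0")
      case True
      then show ?thesis using null[of j] null[of i] herm[of x i] ij d(1) by (auto simp: B_def)
    next
      case False
      then show ?thesis using d(1) by (auto simp: B_def)
    qed
    moreover have "A i x * A x j / of_real d = g m i * cnj (g m j)"
      using herm[of j x] ij sq by (simp add: g_def)
    moreover have "(if i = x \<or> j = x then 0 else B i j) = (\<Sum>k<m. g k i * cnj (g k j))"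
      using ij f[of i j] by (auto simp: g_def)
    ultimately show ?thesis by simp
  qed
  then show ?case by blast
qed simp

lemma cinner_mat:
  assumes "A \<in> carrier_mat N N" "v \<in> carrier_vec N"
  shows "cinner v (A *\<^sub>v v) = quad {..<N} (\<lambda>i j. A $$ (i, j)) (\<lambda>i. v $ i)"
  using assms by (simp add: cinner_def quad_def scalar_prod_def sum_distrib_left mult.assoc atLeast0LessThan)

lemma psd_iff_pos_form:
  "psd N A \<longleftrightarrow> A \<in> carrier_mat N N \<and> pos_form {..<N} (\<lambda>i j. A $$ (i, j))"
proof -
  have "(\<forall>v\<in>carrier_vec N. Im (cinner v (A *\<^sub>v v)) = 0 \<and> 0 \<le> Re (cinner v (A *\<^sub>v v)))
    \<longleftrightarrow> pos_form {..<N} (\<lambda>i j. A $$ (i, j))" if A: "A \<in> carrier_mat N N"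
  proof
    assume h: "\<forall>v\<in>carrier_vec N. Im (cinner v (A *\<^sub>v v)) = 0 \<and> 0 \<le> Re (cinner v (A *\<^sub>v v))"
    show "pos_form {..<N} (\<lambda>i j. A $$ (i, j))"
      unfolding pos_form_def
    proof
      fix v
      have "quad {..<N} (\<lambda>i j. A $$ (i, j)) v = cinner (vec N v) (A *\<^sub>v vec N v)"
        by (subst cinner_mat[OF A]) (simp_all add: quad_def)
      then show "Im (quad {..<N} (\<lambda>i j. A $$ (i, j)) v) = 0 \<and> 0 \<le> Re (quad {..<N} (\<lambda>i j. A $$ (i, j)) v)"
        using h by simp
    qed
  qed (simp add: pos_form_def cinner_mat[OF A])
  then show ?thesis unfolding psd_def by blast
qed

lemma psd_of_gram:
  assumes A: "A \<in> carrier_mat N N"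
    and gram: "\<And>i j. i < N \<Longrightarrow> j < N \<Longrightarrow> A $$ (i, j) = (\<Sum>k\<in>K. f k i * cnj (f k j))"
  shows "psd N A"
  unfolding psd_iff_pos_form pos_form_def
proof (intro conjI A allI)
  fix v
  define S where "S k = (\<Sum>i<N. cnj (v i) * f k i)" for k
  have "quad {..<N} (\<lambda>i j. A $$ (i, j)) v = (\<Sum>i<N. \<Sum>j<N. \<Sum>k\<in>K. (cnj (v i) * f k i) * (cnj (f k j) * v j))"
    by (simp add: quad_def gram sum_distrib_left sum_distrib_right mult.assoc)
  also have "\<dots> = (\<Sum>i<N. \<Sum>k\<in>K. \<Sum>j<N. (cnj (v i) * f k i) * (cnj (f k j) * v j))"
    by (intro sum.cong refl sum.swap)
  also have "\<dots> = (\<Sum>k\<in>K. \<Sum>i<N. \<Sum>j<N. (cnj (v i) * f k i) * (cnj (f k j) * v j))"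
    by (rule sum.swap)
  also have "\<dots> = (\<Sum>k\<in>K. S k * cnj (S k))"
    unfolding S_def cnj_sum sum_product by (simp add: mult.commute)
  also have "\<dots> = of_real (\<Sum>k\<in>K. (cmod (S k))\<^sup>2)"
    unfolding of_real_sum complex_norm_square ..
  finally have "quad {..<N} (\<lambda>i j. A $$ (i, j)) v = of_real (\<Sum>k\<in>K. (cmod (S k))\<^sup>2)" .
  then show "Im (quad {..<N} (\<lambda>i j. A $$ (i, j)) v) = 0" "0 \<le> Re (quad {..<N} (\<lambda>i j. A $$ (i, j)) v)"
    by (simp_all add: sum_nonneg)
qed

section \<open>Channels and Gram decompositions of Choi operators\<close>

lemma pair_index_less: "i < m \<Longrightarrow> j < n \<Longrightarrow> i * n + j < m * (n::nat)"
proof -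
  assume "i < m" "j < n"
  then have "i * n + j < Suc i * n" "Suc i * n \<le> m * n" by (simp, intro mult_le_mono1, simp)
  then show ?thesis by linarith
qed

text \<open>One half of Choi's theorem. Complete positivity is applied to the unnormalized maximally
  entangled operator; the result is the Choi operator with its factors exchanged, so
  \<open>f\<close> is read at \<open>y * m + a\<close>. The ancilla has dimension \<open>m\<close>,
  which must be positive.\<close>

lemma CPTP_choi_gram:
  assumes cptp: "CPTP m n M" and m: "0 < m"
  obtains K :: nat and \<kappa> where
    "\<And>a b y y'. a < m \<Longrightarrow> b < m \<Longrightarrow> y < n \<Longrightarrow> y' < n \<Longrightarrow>
       choi m n M $$ (a * n + y, b * n + y') = (\<Sum>k<K. \<kappa> k a y * cnj (\<kappa> k b y'))"
    "\<And>a b. a < m \<Longrightarrow> b < m \<Longrightarrow> (\<Sum>y<n. \<Sum>k<K. \<kappa> k a y * cnj (\<kappa> k b y)) = (if a = b then 1 else 0)"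
proof -
  define om :: "nat \<Rightarrow> complex" where "om s = (if s div m = s mod m then 1 else 0)" for s
  define \<rho> where "\<rho> = mat (m * m) (m * m) (\<lambda>(s, t). om s * cnj (om t))"
  have "psd (m * m) \<rho>"
    by (rule psd_of_gram[where K = "{()}" and f = "\<lambda>_. om"]) (auto simp: \<rho>_def)
  then have "psd (n * m) (ext_id m n M m \<rho>)"
    using cptp m by (auto simp: CPTP_def)
  then obtain K f where f: "\<And>i j. i < n * m \<Longrightarrow> j < n * m \<Longrightarrow>
      ext_id m n M m \<rho> $$ (i, j) = (\<Sum>k<K::nat. f k i * cnj (f k j))"
    using pos_form_gram[of "{..<n * m}"] unfolding psd_iff_pos_form by blast
  have blk: "blk m m \<rho> a b = unit_op m a b" if "a < m" "b < m" for a b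
    using that by (intro eq_matI) (auto simp: blk_def unit_op_def \<rho>_def om_def pair_index_less)
  have C: "choi m n M $$ (a * n + y, b * n + y') = M (unit_op m a b) $$ (y, y')"
    if "a < m" "b < m" "y < n" "y' < n" for a b y y'
    using that by (simp add: choi_def pair_index_less)
  have G: "choi m n M $$ (a * n + y, b * n + y') = (\<Sum>k<K. f k (y * m + a) * cnj (f k (y' * m + b)))"
    if "a < m" "b < m" "y < n" "y' < n" for a b y y'
    using f[of "y * m + a" "y' * m + b"] that
    by (simp add: C ext_id_def pair_index_less blk)
  have T: "(\<Sum>y<n. \<Sum>k<K. f k (y * m + a) * cnj (f k (y * m + b))) = (if a = b then 1 else 0)"
    if ab: "a < m" "b < m" for a b
  proof -
    have u: "unit_op m a b \<in> carrier_mat m m" by (simp add: unit_op_def)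
    then have Mu: "M (unit_op m a b) \<in> carrier_mat n n"
      using cptp by (auto simp: CPTP_def superop_def)
    have "(\<Sum>y<n. \<Sum>k<K. f k (y * m + a) * cnj (f k (y * m + b))) = mtrace (M (unit_op m a b))"
      using ab Mu by (simp add: mtrace_def flip: G C)
    also have "\<dots> = mtrace (unit_op m a b)"
      using cptp u by (auto simp: CPTP_def)
    also have "\<dots> = (if a = b then 1 else 0)"
    proof -
      have "(if i = a \<and> i = b then 1 else 0 :: complex) = (if i = a then if a = b then 1 else 0 else 0)" for i by auto
      then show ?thesis using ab by (simp add: mtrace_def unit_op_def)
    qed
    finally show ?thesis .
  qed
  show ?thesis using that[where K = K and \<kappa> = "\<lambda>k a y. f k (y * m + a)"] G T by blast
qed

text \<open>The converse half: \<open>\<kappa>\<close> lists the entries of Kraus operators, which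
  carry a Gram decomposition of a state with ancilla to one of its image.\<close>

lemma is_CPTP_choi_of_gram:
  assumes C: "C \<in> carrier_mat (m * n) (m * n)"
    and gram: "\<And>a b y y'. a < m \<Longrightarrow> b < m \<Longrightarrow> y < n \<Longrightarrow> y' < n \<Longrightarrow>
       C $$ (a * n + y, b * n + y') = (\<Sum>k\<in>K. \<kappa> k a y * cnj (\<kappa> k b y'))"
    and trace: "\<And>a b. a < m \<Longrightarrow> b < m \<Longrightarrow> (\<Sum>y<n. \<Sum>k\<in>K. \<kappa> k a y * cnj (\<kappa> k b y)) = (if a = b then 1 else 0)"
  shows "is_CPTP_choi m n C"
proof -
  define M where "M \<rho> = mat n n (\<lambda>(y, y'). \<Sum>a<m. \<Sum>b<m. \<rho> $$ (a, b) * (\<Sum>k\<in>K. \<kappa> k a y * cnj (\<kappa> k b y')))" for \<rho> :: "complex mat"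
  have "superop m n M"
    unfolding superop_def
  proof (intro conjI ballI allI)
    fix X Y :: "complex mat" and s t assume "X \<in> carrier_mat m m" "Y \<in> carrier_mat m m"
    then show "M (s \<cdot>\<^sub>m X + t \<cdot>\<^sub>m Y) = s \<cdot>\<^sub>m M X + t \<cdot>\<^sub>m M Y"
      by (intro eq_matI) (simp_all add: M_def sum.distrib distrib_right sum_distrib_left mult.assoc)
  qed (simp add: M_def)
  moreover have "psd (n * e) (ext_id m n M e \<rho>)" if e: "0 < e" and \<rho>: "psd (m * e) \<rho>" for e \<rho>
  proof -
    obtain R \<eta> where \<eta>: "\<And>i j. i < m * e \<Longrightarrow> j < m * e \<Longrightarrow> \<rho> $$ (i, j) = (\<Sum>r<R::nat. \<eta> r i * cnj (\<eta> r j))"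
      using pos_form_gram[of "{..<m * e}"] \<rho> unfolding psd_iff_pos_form by blast
    define F where "F = (\<lambda>(r, k) s. \<Sum>a<m. \<eta> r (a * e + s mod e) * \<kappa> k a (s div e))"
    show ?thesis
    proof (rule psd_of_gram[where K = "{..<R} \<times> K" and f = F])
      fix s t assume st: "s < n * e" "t < n * e"
      have lt: "s mod e < e" "t mod e < e" "s div e < n" "t div e < n"
        using st e by (simp_all add: less_mult_imp_div_less)
      have "ext_id m n M e \<rho> $$ (s, t) = (\<Sum>a<m. \<Sum>b<m. (\<Sum>r<R. \<eta> r (a * e + s mod e) * cnj (\<eta> r (b * e + t mod e))) *
          (\<Sum>k\<in>K. \<kappa> k a (s div e) * cnj (\<kappa> k b (t div e))))"
        using st lt by (simp add: ext_id_def M_def blk_def \<eta> pair_index_less)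
      also have "\<dots> = (\<Sum>a<m. \<Sum>b<m. \<Sum>(r, k)\<in>{..<R} \<times> K.
          (\<eta> r (a * e + s mod e) * \<kappa> k a (s div e)) * (cnj (\<eta> r (b * e + t mod e) * \<kappa> k b (t div e))))"
        unfolding sum_product sum.cartesian_product case_prod_unfold by (simp add: mult_ac)
      also have "\<dots> = (\<Sum>a<m. \<Sum>(r, k)\<in>{..<R} \<times> K. \<Sum>b<m.
          (\<eta> r (a * e + s mod e) * \<kappa> k a (s div e)) * (cnj (\<eta> r (b * e + t mod e) * \<kappa> k b (t div e))))"
        unfolding case_prod_unfold by (intro sum.cong refl sum.swap)
      also have "\<dots> = (\<Sum>(r, k)\<in>{..<R} \<times> K. \<Sum>a<m. \<Sum>b<m.
          (\<eta> r (a * e + s mod e) * \<kappa> k a (s div e)) * (cnj (\<eta> r (b * e + t mod e) * \<kappa> k b (t div e))))"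
        unfolding case_prod_unfold by (rule sum.swap)
      also have "\<dots> = (\<Sum>x\<in>{..<R} \<times> K. F x s * cnj (F x t))"
        by (simp add: F_def sum_product case_prod_unfold)
      finally show "ext_id m n M e \<rho> $$ (s, t) = (\<Sum>x\<in>{..<R} \<times> K. F x s * cnj (F x t))" .
    qed (simp_all add: ext_id_def)
  qed
  moreover have "mtrace (M X) = mtrace X" if X: "X \<in> carrier_mat m m" for X
  proof -
    have "mtrace (M X) = (\<Sum>y<n. \<Sum>a<m. \<Sum>b<m. X $$ (a, b) * (\<Sum>k\<in>K. \<kappa> k a y * cnj (\<kappa> k b y)))"
      by (simp add: mtrace_def M_def)
    also have "\<dots> = (\<Sum>a<m. \<Sum>y<n. \<Sum>b<m. X $$ (a, b) * (\<Sum>k\<in>K. \<kappa> k a y * cnj (\<kappa> k b y)))"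
      by (rule sum.swap)
    also have "\<dots> = (\<Sum>a<m. \<Sum>b<m. \<Sum>y<n. X $$ (a, b) * (\<Sum>k\<in>K. \<kappa> k a y * cnj (\<kappa> k b y)))"
      by (intro sum.cong refl sum.swap)
    also have "\<dots> = (\<Sum>a<m. \<Sum>b<m. if a = b then X $$ (a, b) else 0)"
      by (intro sum.cong refl) (simp add: trace flip: sum_distrib_left)
    also have "\<dots> = mtrace X" using X by (simp add: mtrace_def)
    finally show ?thesis .
  qed
  moreover have "choi m n M = C"
  proof (rule eq_matI)
    fix r c assume rc: "r < dim_row C" "c < dim_col C"
    then have rc': "r < m * n" "c < m * n" using C by auto
    then have n: "0 < n" by (cases n) auto
    have lt: "r div n < m" "c div n < m" "r mod n < n" "c mod n < n"
      using rc' n by (simp_all add: less_mult_imp_div_less)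
    have "choi m n M $$ (r, c) = (\<Sum>a<m. \<Sum>b<m. (if a = r div n \<and> b = c div n then 1 else 0) *
        (\<Sum>k\<in>K. \<kappa> k a (r mod n) * cnj (\<kappa> k b (c mod n))))"
      using rc' lt by (simp add: choi_def M_def unit_op_def)
    also have "\<dots> = (\<Sum>a<m. \<Sum>b<m. if b = c div n then if a = r div n then
        (\<Sum>k\<in>K. \<kappa> k a (r mod n) * cnj (\<kappa> k b (c mod n))) else 0 else 0)"
      by (intro sum.cong refl) auto
    also have "\<dots> = C $$ (r, c)"
      using lt gram[of "r div n" "c div n" "r mod n" "c mod n"] by simp
    finally show "choi m n M $$ (r, c) = C $$ (r, c)" .
  qed (use C in \<open>auto simp: choi_def\<close>)
  ultimately show ?thesis unfolding is_CPTP_choi_def CPTP_def by blast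
qed

section \<open>The link product\<close>

lemma enc_Nil: "enc [] [] = 0"
  by (simp add: enc_def)

lemma foldl_enc:
  "length is = length ds \<Longrightarrow>
    foldl (\<lambda>acc (d, i). acc * d + i) acc (zip ds is) = acc * prod_list ds + enc ds is"
proof (induction ds "is" arbitrary: acc rule: list_induct2')
  case (4 d ds i "is")
  then have IH: "foldl (\<lambda>acc (d, i). acc * d + i) acc (zip ds is) = acc * prod_list ds + enc ds is" for acc
    by simp
  have "enc (d # ds) (i # is) = i * prod_list ds + enc ds is"
    using IH[of i] unfolding enc_def[of "d # ds"] by simp
  then show ?case
    using IH[of "acc * d + i"] by (simp add: algebra_simps)
qed (simp_all add: enc_Nil)

lemma enc_Cons: "length is = length ds \<Longrightarrow> enc (d # ds) (i # is) = i * prod_list ds + enc ds is"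
  using foldl_enc[of "is" ds i] unfolding enc_def[of "d # ds"] by simp

lemma enc_less: "list_all2 (<) is ds \<Longrightarrow> enc ds is < prod_list ds"
proof (induction "is" ds rule: list_all2_induct)
  case (Cons i "is" d ds)
  have "length is = length ds" using Cons(2) by (rule list_all2_lengthD)
  then have "enc (d # ds) (i # is) < Suc i * prod_list ds"
    using Cons by (simp add: enc_Cons)
  also have "\<dots> \<le> d * prod_list ds"
    using Cons by (intro mult_le_mono1) simp
  finally show ?case by simp
qed (simp add: enc_Nil)

lemma dec_enc: "list_all2 (<) is ds \<Longrightarrow> dec ds (enc ds is) = is"
proof (induction "is" ds rule: list_all2_induct)
  case (Cons i "is" d ds)
  have "length is = length ds" using Cons(2) by (rule list_all2_lengthD)
  then show ?case
    using Cons enc_less[OF Cons(2)] gr_implies_not0[OF enc_less[OF Cons(2)]] by (simp add: enc_Cons)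
qed simp

lemma sum_pair_index: "(\<Sum>y<m * n. h y) = (\<Sum>i<m. \<Sum>j<n. h (i * n + j :: nat))"
  for h :: "nat \<Rightarrow> 'a::comm_monoid_add"
proof (induction m)
  case (Suc m)
  have "(\<Sum>y<Suc m * n. h y) = (\<Sum>y<m * n. h y) + (\<Sum>y\<in>{m * n..<m * n + n}. h y)"
  proof -
    have "{..<Suc m * n} = {..<m * n} \<union> {m * n..<m * n + n}" by auto
    then show ?thesis by (simp add: sum.union_disjoint ivl_disj_int)
  qed
  also have "(\<Sum>y\<in>{m * n..<m * n + n}. h y) = (\<Sum>j<n. h (m * n + j))"
    using sum.shift_bounds_nat_ivl[of h 0 "m * n" n] by (simp add: lessThan_atLeast0 add.commute)
  finally show ?case using Suc.IH by simp
qed simp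

lemma pair_index_cong:
  fixes j :: nat
  assumes j: "j < n" "j' < n"
  shows "i * n + j = i' * n + j' \<longleftrightarrow> i = i' \<and> j = j'"
proof
  assume eq: "i * n + j = i' * n + j'"
  have "(i * n + j) div n = i" "(i * n + j) mod n = j" "(i' * n + j') div n = i'" "(i' * n + j') mod n = j'"
    using j by simp_all
  then show "i = i' \<and> j = j'" using eq by metis
qed simp

text \<open>\<open>\<kappa> k c r\<close> is entry \<open>(r, c)\<close> of the \<open>k\<close>-th Kraus operator of a channel from dimension \<open>m\<close> to
  dimension \<open>n\<close> with Choi operator \<open>C\<close>.\<close>
definition kraus_choi :: "nat \<Rightarrow> nat \<Rightarrow> 'k set \<Rightarrow> ('k \<Rightarrow> nat \<Rightarrow> nat \<Rightarrow> complex) \<Rightarrow> complex mat \<Rightarrow> bool" where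
  "kraus_choi m n K \<kappa> C \<longleftrightarrow> finite K \<and>
     (\<forall>c<m. \<forall>c'<m. \<forall>r<n. \<forall>r'<n. C $$ (c * n + r, c' * n + r') = (\<Sum>k\<in>K. \<kappa> k c r * cnj (\<kappa> k c' r'))) \<and>
     (\<forall>c<m. \<forall>c'<m. (\<Sum>r<n. \<Sum>k\<in>K. \<kappa> k c r * cnj (\<kappa> k c' r)) = (if c = c' then 1 else 0))"

lemma kraus_choiD:
  assumes "kraus_choi m n K \<kappa> C"
  shows "finite K"
    and "c < m \<Longrightarrow> c' < m \<Longrightarrow> r < n \<Longrightarrow> r' < n \<Longrightarrow>
      C $$ (c * n + r, c' * n + r') = (\<Sum>k\<in>K. \<kappa> k c r * cnj (\<kappa> k c' r'))"
    and "c < m \<Longrightarrow> c' < m \<Longrightarrow> (\<Sum>r<n. \<Sum>k\<in>K. \<kappa> k c r * cnj (\<kappa> k c' r)) = (if c = c' then 1 else 0)"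
  using assms unfolding kraus_choi_def by blast+


text \<open>Trace preservation in the form required by \<open>form_unital\<close>: the ancilla
  inputs \<open>i\<close>, \<open>i'\<close> stay fixed, and the Kraus label and the ancilla output
  are summed. The scalar is 0 for distinct ancilla inputs.\<close>

lemma kraus_choi_ctr:
  assumes K: "kraus_choi (d * s) (d * s') K \<kappa> C" and i: "i < s" "i' < s" and ci: "c < d" "c' < d"
  shows "ctr d (\<lambda>x x'. \<Sum>(k, o')\<in>K \<times> {..<s'}.
      ob (\<lambda>x. \<kappa> k (snd x * s + i') (fst x * s' + o')) (\<lambda>x. \<kappa> k (snd x * s + i) (fst x * s' + o')) x x') c c' =
    (if c = c' then if i = i' then 1 else 0 else 0)"
proof -
  have "ctr d (\<lambda>x x'. \<Sum>(k, o')\<in>K \<times> {..<s'}.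
      ob (\<lambda>x. \<kappa> k (snd x * s + i') (fst x * s' + o')) (\<lambda>x. \<kappa> k (snd x * s + i) (fst x * s' + o')) x x') c c'
     = (\<Sum>r<d. \<Sum>k\<in>K. \<Sum>o'<s'. \<kappa> k (c' * s + i) (r * s' + o') * cnj (\<kappa> k (c * s + i') (r * s' + o')))"
    by (simp add: ctr_def ob_def mult.commute flip: sum.cartesian_product)
  also have "\<dots> = (\<Sum>r<d. \<Sum>o'<s'. \<Sum>k\<in>K. \<kappa> k (c' * s + i) (r * s' + o') * cnj (\<kappa> k (c * s + i') (r * s' + o')))"
    by (intro sum.cong refl sum.swap)
  also have "\<dots> = (\<Sum>y<d * s'. \<Sum>k\<in>K. \<kappa> k (c' * s + i) y * cnj (\<kappa> k (c * s + i') y))"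
    by (simp add: sum_pair_index)
  also have "\<dots> = (if c' * s + i = c * s + i' then 1 else 0)"
    using K i ci unfolding kraus_choi_def by (simp add: pair_index_less)
  finally show ?thesis using i by (auto simp: pair_index_cong)
qed

text \<open>Pairs are (row, column), hence (output, input), while \<open>w\<close> lists the input
  space of each party first.\<close>

definition w_coeff :: "nat \<Rightarrow> nat \<Rightarrow> nat \<Rightarrow> complex vec \<Rightarrow> nat \<Rightarrow> nat \<Rightarrow> nat \<times> nat \<Rightarrow> nat \<times> nat \<Rightarrow> complex" where
  "w_coeff n a b w f p x y = w $ enc [n, n, a, a, b, b] [p, f, snd x, fst x, snd y, fst y]"

text \<open>\<open>L\<close> applied to Kraus operators of both parties. The divisions and
  remainders decode \<open>c\<close> into the input from \<open>P\<close> and the two ancilla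
  inputs, and \<open>r\<close> into the output in \<open>F\<close> and the two ancilla
  outputs.\<close>

definition link_kraus where
  "link_kraus n a b s s' t t' w \<kappa> \<mu> = (\<lambda>(k, l) c r.
     \<Sum>x\<in>sq a. \<Sum>y\<in>sq b. w_coeff n a b w (r div t' div s') (c div t div s) x y *
       \<kappa> k (snd x * s + c div t mod s) (fst x * s' + r div t' mod s') *
       \<mu> l (snd y * t + c mod t) (fst y * t' + r mod t'))"

lemma sum_swap4: "(\<Sum>i<a. \<Sum>j<a. \<Sum>k<b. \<Sum>l<b. h j i l k) = (\<Sum>j<a. \<Sum>i<a. \<Sum>l<b. \<Sum>k<b. h j i l k :: complex)"
  for a b :: nat
  by (rule trans[OF sum.swap], rule sum.cong[OF refl], rule sum.cong[OF refl], rule sum.swap)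

text \<open>\<open>W\<close> has rank one, and the partial transpose exchanges the party indices of
  its row with those of its column. The factor \<open>w\<close> then shares its indices with the
  rows of both Choi operators and the conjugate factor with their columns, so the eightfold sum
  splits.\<close>

lemma link_entry:
  assumes w: "dim_vec w = n * n * a * a * b * b"
    and pos: "0 < s" "0 < s'" "0 < t" "0 < t'"
    and X: "kraus_choi (a * s) (a * s') K \<kappa> Cx" and Y: "kraus_choi (b * t) (b * t') M \<mu> Cy"
    and c: "c < n * s * t" "c' < n * s * t" and r: "r < n * s' * t'" "r' < n * s' * t'"
  shows "link n n a a b b s s' t t' (proj w) Cx Cy $$ (c * (n * s' * t') + r, c' * (n * s' * t') + r') =
    (\<Sum>k\<in>K \<times> M. link_kraus n a b s s' t t' w \<kappa> \<mu> k c r * cnj (link_kraus n a b s s' t t' w \<kappa> \<mu> k c' r'))"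
proof -
  let ?DR = "[n, s, t, n, s', t']" and ?DW = "[n, n, a, a, b, b]"
  let ?DX = "[a, s, a, s']" and ?DY = "[b, t, b, t']"
  have code: "c * (n * s' * t') + r = enc ?DR [c div t div s, c div t mod s, c mod t, r div t' div s', r div t' mod s', r mod t']
      \<and> list_all2 (<) [c div t div s, c div t mod s, c mod t, r div t' div s', r div t' mod s', r mod t'] ?DR"
    if c: "c < n * s * t" and r: "r < n * s' * t'" for c r
  proof -
    have E: "enc ?DR [x1, x2, x3, x4, x5, x6] = ((x1 * s + x2) * t + x3) * (n * s' * t') + ((x4 * s' + x5) * t' + x6)"
      for x1 x2 x3 x4 x5 x6
      by (simp add: enc_Cons enc_Nil algebra_simps)
    have 1: "c * (n * s' * t') + r = enc ?DR [c div t div s, c div t mod s, c mod t, r div t' div s', r div t' mod s', r mod t']"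
      unfolding E div_mult_mod_eq ..
    have "c div t div s < n" "r div t' div s' < n"
      using c r by (simp_all add: less_mult_imp_div_less)
    then show ?thesis using 1 pos by simp
  qed
  define p i j where "p = c div t div s" and "i = c div t mod s" and "j = c mod t"
  define f g h where "f = r div t' div s'" and "g = r div t' mod s'" and "h = r mod t'"
  define p' i' j' where "p' = c' div t div s" and "i' = c' div t mod s" and "j' = c' mod t"
  define f' g' h' where "f' = r' div t' div s'" and "g' = r' div t' mod s'" and "h' = r' mod t'"
  note defs = p_def i_def j_def f_def g_def h_def p'_def i'_def j'_def f'_def g'_def h'_def
  have R: "c * (n * s' * t') + r = enc ?DR [p, i, j, f, g, h]" "list_all2 (<) [p, i, j, f, g, h] ?DR"
    using code[OF c(1) r(1)] by (simp_all add: defs)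
  have R': "c' * (n * s' * t') + r' = enc ?DR [p', i', j', f', g', h']" "list_all2 (<) [p', i', j', f', g', h'] ?DR"
    using code[OF c(2) r(2)] by (simp_all add: defs)
  have lt: "p < n" "i < s" "j < t" "f < n" "g < s'" "h < t'" "p' < n" "i' < s" "j' < t" "f' < n" "g' < s'" "h' < t'"
    using R(2) R'(2) by simp_all
  have WT: "ptrans2 (n * n) (a * a * b * b) (proj w) $$ (enc ?DW [p, f, ai, ao, bi, bo], enc ?DW [p', f', ai2, ao2, bi2, bo2])
      = w_coeff n a b w f p (ao2, ai2) (bo2, bi2) * cnj (w_coeff n a b w f' p' (ao, ai) (bo, bi))"
    if z: "ai < a" "ao < a" "bi < b" "bo < b" "ai2 < a" "ao2 < a" "bi2 < b" "bo2 < b" for ai ao bi bo ai2 ao2 bi2 bo2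
  proof -
    define e where "e = enc [a, a, b, b] [ai, ao, bi, bo]"
    define e2 where "e2 = enc [a, a, b, b] [ai2, ao2, bi2, bo2]"
    have el: "e < a * a * b * b" "e2 < a * a * b * b"
      using enc_less[of "[ai, ao, bi, bo]" "[a, a, b, b]"] enc_less[of "[ai2, ao2, bi2, bo2]" "[a, a, b, b]"] z
      by (simp_all add: e_def e2_def mult.assoc)
    have E: "enc ?DW [u, v, x1, x2, x3, x4] = (u * n + v) * (a * a * b * b) + enc [a, a, b, b] [x1, x2, x3, x4]" for u v x1 x2 x3 x4
      by (simp add: enc_Cons enc_Nil algebra_simps)
    have L: "p * n + f < n * n" "p' * n + f' < n * n" using lt by (simp_all add: pair_index_less)
    have L2: "(p * n + f) * (a * a * b * b) + e2 < n * n * (a * a * b * b)" "(p' * n + f') * (a * a * b * b) + e < n * n * (a * a * b * b)"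
       "(p * n + f) * (a * a * b * b) + e < n * n * (a * a * b * b)" "(p' * n + f') * (a * a * b * b) + e2 < n * n * (a * a * b * b)"
      using L el by (simp_all only: pair_index_less)
    have D: "a * a * b * b \<noteq> 0" using el by linarith
    have w': "dim_vec w = n * n * (a * a * b * b)" using w by (simp add: mult.assoc)
    have "ptrans2 (n * n) (a * a * b * b) (proj w) $$ ((p * n + f) * (a * a * b * b) + e, (p' * n + f') * (a * a * b * b) + e2)
      = proj w $$ ((p * n + f) * (a * a * b * b) + e2, (p' * n + f') * (a * a * b * b) + e)"
      using el L2 D unfolding ptrans2_def by (subst index_mat) simp_all
    also have "\<dots> = w $ ((p * n + f) * (a * a * b * b) + e2) * cnj (w $ ((p' * n + f') * (a * a * b * b) + e))"
      unfolding proj_def using L2(1,2) unfolding w' by (subst index_mat) simp_all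
    finally show ?thesis
      unfolding w_coeff_def E e_def e2_def fst_conv snd_conv .
  qed
  have EX: "enc ?DX [x1, x2, x3, x4] = (x1 * s + x2) * (a * s') + (x3 * s' + x4)" for x1 x2 x3 x4
    by (simp add: enc_Cons enc_Nil algebra_simps)
  have EY: "enc ?DY [x1, x2, x3, x4] = (x1 * t + x2) * (b * t') + (x3 * t' + x4)" for x1 x2 x3 x4
    by (simp add: enc_Cons enc_Nil algebra_simps)
  have CX: "Cx $$ (enc ?DX [ai2, i, ao2, g], enc ?DX [ai, i', ao, g']) =
      (\<Sum>k\<in>K. \<kappa> k (ai2 * s + i) (ao2 * s' + g) * cnj (\<kappa> k (ai * s + i') (ao * s' + g')))"
    if "ai < a" "ao < a" "ai2 < a" "ao2 < a" for ai ao ai2 ao2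
    using X that lt unfolding EX kraus_choi_def by (simp add: pair_index_less)
  have CY: "Cy $$ (enc ?DY [bi2, j, bo2, h], enc ?DY [bi, j', bo, h']) =
      (\<Sum>k\<in>M. \<mu> k (bi2 * t + j) (bo2 * t' + h) * cnj (\<mu> k (bi * t + j') (bo * t' + h')))"
    if "bi < b" "bo < b" "bi2 < b" "bo2 < b" for bi bo bi2 bo2
    using Y that lt unfolding EY kraus_choi_def by (simp add: pair_index_less)
  define F where "F = (\<lambda>(k, l) (ai2, ao2, bi2, bo2). w_coeff n a b w f p (ao2, ai2) (bo2, bi2) *
     \<kappa> k (ai2 * s + i) (ao2 * s' + g) * \<mu> l (bi2 * t + j) (bo2 * t' + h))"
  define F' where "F' = (\<lambda>(k, l) (ai2, ao2, bi2, bo2). w_coeff n a b w f' p' (ao2, ai2) (bo2, bi2) *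
     \<kappa> k (ai2 * s + i') (ao2 * s' + g') * \<mu> l (bi2 * t + j') (bo2 * t' + h'))"
  let ?S = "{..<a} \<times> {..<a} \<times> {..<b} \<times> {..<b}" and ?KM = "K \<times> M"
  have S: "(\<Sum>z\<in>?S. F kl z) = link_kraus n a b s s' t t' w \<kappa> \<mu> kl c r"
    "(\<Sum>z\<in>?S. F' kl z) = link_kraus n a b s s' t t' w \<kappa> \<mu> kl c' r'" for kl
    unfolding link_kraus_def F_def F'_def defs
    by (simp_all add: case_prod_unfold sum.cartesian_product' sum_sq) (rule sum_swap4)+
  have alg: "W * cnj W' * (\<Sum>k\<in>K. x k * cnj (x' k)) * (\<Sum>m\<in>M. y m * cnj (y' m)) =
     (\<Sum>km\<in>K \<times> M. W * x (fst km) * y (snd km) * cnj (W' * x' (fst km) * y' (snd km)))" for W W' x x' y y'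
  proof -
    have "W * cnj W' * (\<Sum>k\<in>K. x k * cnj (x' k)) * (\<Sum>m\<in>M. y m * cnj (y' m)) =
      W * cnj W' * (\<Sum>km\<in>K \<times> M. x (fst km) * cnj (x' (fst km)) * (y (snd km) * cnj (y' (snd km))))"
      unfolding mult.assoc[of "W * cnj W'"] sum_product sum.cartesian_product' by simp
    then show ?thesis by (simp add: sum_distrib_left mult_ac)
  qed
  have lenR: "enc ?DR [p, i, j, f, g, h] < n * s * t * n * s' * t'" "enc ?DR [p', i', j', f', g', h'] < n * s * t * n * s' * t'"
    using enc_less[OF R(2)] enc_less[OF R'(2)] by (simp_all add: mult.assoc)
  have "link n n a a b b s s' t t' (proj w) Cx Cy $$ (c * (n * s' * t') + r, c' * (n * s' * t') + r') =
    (\<Sum>ai<a. \<Sum>ao<a. \<Sum>bi<b. \<Sum>bo<b. \<Sum>ai2<a. \<Sum>ao2<a. \<Sum>bi2<b. \<Sum>bo2<b.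
       ptrans2 (n * n) (a * a * b * b) (proj w) $$ (enc ?DW [p, f, ai, ao, bi, bo], enc ?DW [p', f', ai2, ao2, bi2, bo2])
       * Cx $$ (enc ?DX [ai2, i, ao2, g], enc ?DX [ai, i', ao, g'])
       * Cy $$ (enc ?DY [bi2, j, bo2, h], enc ?DY [bi, j', bo, h']))"
    unfolding R(1) R'(1) link_def Let_def using lenR
    by (simp add: dec_enc[OF R(2)] dec_enc[OF R'(2)] del: dec.simps)
  also have "\<dots> = (\<Sum>ai<a. \<Sum>ao<a. \<Sum>bi<b. \<Sum>bo<b. \<Sum>ai2<a. \<Sum>ao2<a. \<Sum>bi2<b. \<Sum>bo2<b.
      \<Sum>kl\<in>?KM. F kl (ai2, ao2, bi2, bo2) * cnj (F' kl (ai, ao, bi, bo)))"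
  proof (intro sum.cong refl)
    fix ai ao bi bo ai2 ao2 bi2 bo2
    assume "ai \<in> {..<a}" "ao \<in> {..<a}" "bi \<in> {..<b}" "bo \<in> {..<b}"
      "ai2 \<in> {..<a}" "ao2 \<in> {..<a}" "bi2 \<in> {..<b}" "bo2 \<in> {..<b}"
    then have lt: "ai < a" "ao < a" "bi < b" "bo < b" "ai2 < a" "ao2 < a" "bi2 < b" "bo2 < b" by simp_all
    show "ptrans2 (n * n) (a * a * b * b) (proj w) $$ (enc ?DW [p, f, ai, ao, bi, bo], enc ?DW [p', f', ai2, ao2, bi2, bo2])
       * Cx $$ (enc ?DX [ai2, i, ao2, g], enc ?DX [ai, i', ao, g'])
       * Cy $$ (enc ?DY [bi2, j, bo2, h], enc ?DY [bi, j', bo, h']) =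
       (\<Sum>kl\<in>?KM. F kl (ai2, ao2, bi2, bo2) * cnj (F' kl (ai, ao, bi, bo)))"
      unfolding WT[OF lt] CX[OF lt(1,2,5,6)] CY[OF lt(3,4,7,8)] alg
      by (simp add: F_def F'_def case_prod_unfold)
  qed
  also have "\<dots> = (\<Sum>z\<in>?S. \<Sum>z2\<in>?S. \<Sum>kl\<in>?KM. F kl z2 * cnj (F' kl z))"
    by (simp only: sum.cartesian_product')
  also have "\<dots> = (\<Sum>z\<in>?S. \<Sum>kl\<in>?KM. \<Sum>z2\<in>?S. F kl z2 * cnj (F' kl z))"
    by (intro sum.cong refl sum.swap)
  also have "\<dots> = (\<Sum>kl\<in>?KM. \<Sum>z\<in>?S. \<Sum>z2\<in>?S. F kl z2 * cnj (F' kl z))"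
    by (rule sum.swap)
  also have "\<dots> = (\<Sum>kl\<in>?KM. (\<Sum>z\<in>?S. F kl z) * cnj (\<Sum>z\<in>?S. F' kl z))"
    by (simp add: sum_distrib_left sum_distrib_right)
  finally show ?thesis unfolding S .
qed

text \<open>The sum over Kraus labels and ancilla outputs is the form of two tensors whose
  contractions are scalar by \<open>kraus_choi_ctr\<close>, so \<open>form_unital\<close> evaluates
  it.\<close>

lemma (in two_slot) link_kraus_trace:
  assumes l: "l = w_coeff n a b w"
    and pos: "0 < s" "0 < s'" "0 < t" "0 < t'"
    and X: "kraus_choi (a * s) (a * s') K \<kappa> Cx" and Y: "kraus_choi (b * t) (b * t') M \<mu> Cy"
    and c: "c < n * s * t" "c' < n * s * t"
  shows "(\<Sum>r<n * s' * t'. \<Sum>k\<in>K \<times> M. link_kraus n a b s s' t t' w \<kappa> \<mu> k c r * cnj (link_kraus n a b s s' t t' w \<kappa> \<mu> k c' r)) =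
    (if c = c' then 1 else 0)"
proof -
  define p i j where "p = c div t div s" and "i = c div t mod s" and "j = c mod t"
  define p' i' j' where "p' = c' div t div s" and "i' = c' div t mod s" and "j' = c' mod t"
  have lt: "p < n" "i < s" "j < t" "p' < n" "i' < s" "j' < t"
    using c pos by (simp_all add: p_def i_def j_def p'_def i'_def j'_def less_mult_imp_div_less)
  have code: "c = (p * s + i) * t + j" "c' = (p' * s + i') * t + j'"
    by (simp_all add: p_def i_def j_def p'_def i'_def j'_def)
  define A where "A i = (\<lambda>(k, g) x. \<kappa> k (snd x * s + i) (fst x * s' + g))" for i and x :: "nat \<times> nat"
  define B where "B j = (\<lambda>(m, h) y. \<mu> m (snd y * t + j) (fst y * t' + h))" for j and y :: "nat \<times> nat"
  let ?N = "\<lambda>p i j f e g. \<Sum>x\<in>sq a. \<Sum>y\<in>sq b. l f p x y * A i e x * B j g y"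
  have N: "link_kraus n a b s s' t t' w \<kappa> \<mu> (k, m) c ((f * s' + g) * t' + h) = ?N p i j f (k, g) (m, h)"
    "link_kraus n a b s s' t t' w \<kappa> \<mu> (k, m) c' ((f * s' + g) * t' + h) = ?N p' i' j' f (k, g) (m, h)"
    if "g < s'" "h < t'" for k m f g h
    using that by (simp_all add: link_kraus_def A_def B_def l p_def i_def j_def p'_def i'_def j'_def)
  have "(\<Sum>r<n * s' * t'. \<Sum>k\<in>K \<times> M. link_kraus n a b s s' t t' w \<kappa> \<mu> k c r * cnj (link_kraus n a b s s' t t' w \<kappa> \<mu> k c' r))
     = (\<Sum>f<n. \<Sum>g<s'. \<Sum>h<t'. \<Sum>k\<in>K. \<Sum>m\<in>M. ?N p i j f (k, g) (m, h) * cnj (?N p' i' j' f (k, g) (m, h)))"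
    by (simp only: sum_pair_index sum.cartesian_product') (intro sum.cong refl, simp only: N lessThan_iff)
  also have "\<dots> = (\<Sum>f<n. \<Sum>g<s'. \<Sum>k\<in>K. \<Sum>h<t'. \<Sum>m\<in>M. ?N p i j f (k, g) (m, h) * cnj (?N p' i' j' f (k, g) (m, h)))"
    by (rule sum.cong[OF refl], rule sum.cong[OF refl], rule sum.swap)
  also have "\<dots> = (\<Sum>f<n. \<Sum>k\<in>K. \<Sum>g<s'. \<Sum>h<t'. \<Sum>m\<in>M. ?N p i j f (k, g) (m, h) * cnj (?N p' i' j' f (k, g) (m, h)))"
    by (rule sum.cong[OF refl], rule sum.swap)
  also have "\<dots> = (\<Sum>f<n. \<Sum>k\<in>K. \<Sum>g<s'. \<Sum>m\<in>M. \<Sum>h<t'. cnj (?N p' i' j' f (k, g) (m, h)) * ?N p i j f (k, g) (m, h))"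
    by (rule sum.cong[OF refl], rule sum.cong[OF refl], rule sum.cong[OF refl], rule trans[OF sum.swap],
        rule sum.cong[OF refl], rule sum.cong[OF refl], rule mult.commute)
  also have "\<dots> = (\<Sum>f<n. \<Sum>e\<in>K \<times> {..<s'}. \<Sum>g\<in>M \<times> {..<t'}. cnj (?N p' i' j' f e g) * ?N p i j f e g)"
    by (simp only: sum.cartesian_product')
  also have "\<dots> = form (\<lambda>x x'. \<Sum>e\<in>K \<times> {..<s'}. ob (A i' e) (A i e) x x') (\<lambda>y y'. \<Sum>g\<in>M \<times> {..<t'}. ob (B j' g) (B j g) y y') p' p"
    by (rule form_expand)
  also have "\<dots> = (if p' = p then (if i = i' then 1 else 0) * (if j = j' then 1 else 0) else 0)"
  proof (rule form_unital)
    show "ctr a (\<lambda>x x'. \<Sum>e\<in>K \<times> {..<s'}. ob (A i' e) (A i e) x x') c c' = (if c = c' then if i = i' then 1 else 0 else 0)"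
      if "c < a" "c' < a" for c c'
      using kraus_choi_ctr[OF X lt(2,5) that] by (simp add: A_def case_prod_unfold)
    show "ctr b (\<lambda>y y'. \<Sum>g\<in>M \<times> {..<t'}. ob (B j' g) (B j g) y y') c c' = (if c = c' then if j = j' then 1 else 0 else 0)"
      if "c < b" "c' < b" for c c'
      using kraus_choi_ctr[OF Y lt(3,6) that] by (simp add: B_def case_prod_unfold)
  qed (use lt in auto)
  also have "\<dots> = (if c = c' then 1 else 0)"
    unfolding code using lt by (auto simp: pair_index_cong)
  finally show ?thesis .
qed

lemma (in two_slot) kraus_choi_link:
  assumes l: "l = w_coeff n a b w" and w: "dim_vec w = n * n * a * a * b * b"
    and pos: "0 < s" "0 < s'" "0 < t" "0 < t'"
    and X: "kraus_choi (a * s) (a * s') K \<kappa> Cx" and Y: "kraus_choi (b * t) (b * t') M \<mu> Cy"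
  shows "kraus_choi (n * s * t) (n * s' * t') (K \<times> M) (link_kraus n a b s s' t t' w \<kappa> \<mu>)
    (link n n a a b b s s' t t' (proj w) Cx Cy)"
  unfolding kraus_choi_def
proof (intro conjI allI impI)
  show "finite (K \<times> M)" using kraus_choiD(1)[OF X] kraus_choiD(1)[OF Y] by simp
qed (rule link_entry[OF w pos X Y] link_kraus_trace[OF l pos X Y]; assumption)+

lemma link_carrier: "link n n a a b b s s' t t' W Cx Cy \<in> carrier_mat (n * s * t * (n * s' * t')) (n * s * t * (n * s' * t'))"
  by (simp add: link_def Let_def mult.assoc)

section \<open>Unitary maps as channels with a single Kraus operator\<close>

lemma proj_dket_entry:
  assumes "U \<in> carrier_mat n m" "c < m" "c' < m" "r < n" "r' < n"
  shows "proj (dket U) $$ (c * n + r, c' * n + r') = U $$ (r, c) * cnj (U $$ (r', c'))"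
  using assms by (simp add: proj_def dket_def pair_index_less)

lemma unitary_entries:
  assumes U: "U \<in> carrier_mat n m"
  shows "adj U * U = 1\<^sub>m m \<longleftrightarrow> (\<forall>i<m. \<forall>j<m. (\<Sum>r<n. cnj (U $$ (r, i)) * U $$ (r, j)) = (if i = j then 1 else 0))"
proof -
  have e: "(adj U * U) $$ (i, j) = (\<Sum>r<n. cnj (U $$ (r, i)) * U $$ (r, j))" if "i < m" "j < m" for i j
    using U that by (simp add: adj_def scalar_prod_def atLeast0LessThan)
  have d: "dim_row (adj U * U) = m" "dim_col (adj U * U) = m" using U by (simp_all add: adj_def)
  show ?thesis
  proof
    assume "adj U * U = 1\<^sub>m m"
    then show "\<forall>i<m. \<forall>j<m. (\<Sum>r<n. cnj (U $$ (r, i)) * U $$ (r, j)) = (if i = j then 1 else 0)"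
      by (simp flip: e)
  next
    assume "\<forall>i<m. \<forall>j<m. (\<Sum>r<n. cnj (U $$ (r, i)) * U $$ (r, j)) = (if i = j then 1 else 0)"
    then show "adj U * U = 1\<^sub>m m"
      using d by (intro eq_matI) (simp_all add: e del: index_mult_mat)
  qed
qed

lemma unitary_mapI:
  assumes U: "U \<in> carrier_mat n n"
    and iso: "\<And>i j. i < n \<Longrightarrow> j < n \<Longrightarrow> (\<Sum>r<n. cnj (U $$ (r, i)) * U $$ (r, j)) = (if i = j then 1 else 0)"
  shows "unitary_map n n U"
proof -
  have "adj U \<in> carrier_mat n n" using U by (simp add: adj_def)
  moreover have "adj U * U = 1\<^sub>m n" using iso by (simp add: unitary_entries[OF U])
  ultimately show ?thesis
    using U mat_mult_left_right_inverse[of "adj U" n U] by (simp add: unitary_map_def)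
qed

lemma kraus_choi_unitary:
  assumes U: "unitary_map m n U"
  shows "kraus_choi m n {()} (\<lambda>_ c r. U $$ (r, c)) (proj (dket U))"
proof -
  have c: "U \<in> carrier_mat n m" and "adj U * U = 1\<^sub>m m" using U by (simp_all add: unitary_map_def)
  have "(\<Sum>r<n. U $$ (r, i) * cnj (U $$ (r, j))) = (if i = j then 1 else 0)" if "i < m" "j < m" for i j
  proof -
    have "(\<Sum>r<n. cnj (U $$ (r, j)) * U $$ (r, i)) = (if j = i then 1 else 0)"
      using \<open>adj U * U = 1\<^sub>m m\<close> that unitary_entries[OF c] by blast
    then show ?thesis by (auto simp: mult.commute)
  qed
  then show ?thesis unfolding kraus_choi_def by (simp add: proj_dket_entry[OF c])
qed

lemma choi_conj_entry:
  assumes U: "U \<in> carrier_mat n m" and i: "c < m" "c' < m" "r < n" "r' < n"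
  shows "choi m n (\<lambda>\<rho>. U * \<rho> * adj U) $$ (c * n + r, c' * n + r') = U $$ (r, c) * cnj (U $$ (r', c'))"
proof -
  have "choi m n (\<lambda>\<rho>. U * \<rho> * adj U) $$ (c * n + r, c' * n + r') = (U * unit_op m c c' * adj U) $$ (r, r')"
    using i by (simp add: choi_def pair_index_less)
  also have "\<dots> = (\<Sum>k<m. (\<Sum>l<m. U $$ (r, l) * (if l = c \<and> k = c' then 1 else 0)) * cnj (U $$ (r', k)))"
    using U i by (simp add: adj_def unit_op_def scalar_prod_def atLeast0LessThan)
  also have "\<dots> = U $$ (r, c) * cnj (U $$ (r', c'))"
  proof -
    have "U $$ (r, l) * (if l = c \<and> k = c' then 1 else 0) = (if l = c then if k = c' then U $$ (r, c) else 0 else 0)" for k l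
      by auto
    moreover have "(if k = c' then x else 0) * y = (if k = c' then x * y else 0)" for k and x y :: complex
      by simp
    ultimately show ?thesis using i by simp
  qed
  finally show ?thesis .
qed

lemma eq_mat_pair_indexI:
  assumes "A \<in> carrier_mat (m * n) (m * n)" "B \<in> carrier_mat (m * n) (m * n)"
    and "\<And>c c' r r'. c < m \<Longrightarrow> c' < m \<Longrightarrow> r < n \<Longrightarrow> r' < n \<Longrightarrow> A $$ (c * n + r, c' * n + r') = B $$ (c * n + r, c' * n + r')"
  shows "A = B"
proof (rule eq_matI)
  fix i j assume ij: "i < dim_row B" "j < dim_col B"
  then have ij': "i < m * n" "j < m * n" using assms(2) by auto
  then have n: "0 < n" by (cases n) auto
  have "i = i div n * n + i mod n" "j = j div n * n + j mod n" by simp_all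
  then show "A $$ (i, j) = B $$ (i, j)"
    using assms(3)[of "i div n" "j div n" "i mod n" "j mod n"] ij' n by (simp add: less_mult_imp_div_less)
qed (use assms in auto)

lemma is_CPTP_choi_kraus:
  assumes "kraus_choi m n K \<kappa> C" "C \<in> carrier_mat (m * n) (m * n)"
  shows "is_CPTP_choi m n C"
  by (rule is_CPTP_choi_of_gram[OF assms(2) kraus_choiD(2,3)[OF assms(1)]])

lemma is_unitary_choi_kraus:
  assumes K: "kraus_choi m m {k} \<kappa> C" and C: "C \<in> carrier_mat (m * m) (m * m)"
  shows "is_unitary_choi m m C"
proof -
  define N where "N = mat m m (\<lambda>(r, c). \<kappa> k c r)"
  have N: "N \<in> carrier_mat m m" by (simp add: N_def)
  have "unitary_map m m N"
  proof (rule unitary_mapI[OF N])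
    fix i j assume ij: "i < m" "j < m"
    then have "(\<Sum>r<m. \<kappa> k j r * cnj (\<kappa> k i r)) = (if j = i then 1 else 0)"
      using kraus_choiD(3)[OF K, of j i] by simp
    then show "(\<Sum>r<m. cnj (N $$ (r, i)) * N $$ (r, j)) = (if i = j then 1 else 0)"
      using ij by (auto simp: N_def mult.commute)
  qed
  moreover have "choi m m (\<lambda>\<rho>. N * \<rho> * adj N) = C"
    by (rule eq_mat_pair_indexI[OF _ C])
       (simp add: choi_def, simp add: choi_conj_entry[OF N] kraus_choiD(2)[OF K], simp add: N_def)
  ultimately show ?thesis unfolding is_unitary_choi_def by blast
qed

text \<open>For purity both Kraus families are singletons, hence so is that of the
  composite.\<close>

lemma (in two_slot) process_and_pure:
  assumes l: "l = w_coeff n a b w" and w: "dim_vec w = n * n * a * a * b * b"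
    and pos: "0 < a" "0 < b"
  shows "process_matrix n n a a b b (proj w)" and "pure_process n n a a b b (proj w)"
proof -
  have kraus: "\<exists>K \<kappa>. kraus_choi m m' {..<K::nat} \<kappa> (choi m m' M)" if "CPTP m m' M" "0 < m" for m m' M
    by (rule CPTP_choi_gram[OF that], rule exI, rule exI, unfold kraus_choi_def) (intro conjI allI impI finite_lessThan; assumption?; blast)
  show "process_matrix n n a a b b (proj w)"
    unfolding process_matrix_def
  proof (intro conjI allI impI, goal_cases)
    case 1
    show ?case by (simp add: proj_def w)
  next
    case (2 s s' t t' Mx My)
    then obtain Kx \<kappa> Ky \<mu> where "kraus_choi (a * s) (a * s') {..<Kx::nat} \<kappa> (choi (a * s) (a * s') Mx)"
      "kraus_choi (b * t) (b * t') {..<Ky::nat} \<mu> (choi (b * t) (b * t') My)"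
      using kraus[of "a * s" "a * s'" Mx] kraus[of "b * t" "b * t'" My] pos by auto
    then show ?case
      using 2 by (intro is_CPTP_choi_kraus[OF kraus_choi_link[OF l w] link_carrier]) auto
  qed
  show "pure_process n n a a b b (proj w)"
    unfolding pure_process_def
  proof (intro allI impI, goal_cases)
    case (1 s s' t t' U V)
    then have dims: "n * s * t = n * s' * t'" by simp
    have "kraus_choi (n * s * t) (n * s' * t') ({()} \<times> {()})
       (link_kraus n a b s s' t t' w (\<lambda>_ c r. U $$ (r, c)) (\<lambda>_ c r. V $$ (r, c)))
       (link n n a a b b s s' t t' (proj w) (proj (dket U)) (proj (dket V)))"
      using 1 by (intro kraus_choi_link[OF l w] kraus_choi_unitary) auto
    moreover have "{()} \<times> {()} = {((), ())}" by auto
    ultimately have "is_unitary_choi (n * s * t) (n * s * t) (link n n a a b b s s' t t' (proj w) (proj (dket U)) (proj (dket V)))"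
      using link_carrier[of n a b s s' t t' "proj w" "proj (dket U)" "proj (dket V)"]
      unfolding dims[symmetric] by (intro is_unitary_choi_kraus) simp_all
    then show ?case by (simp only: dims)
  qed
qed

section \<open>Frame functions\<close>

lemma isom_iff_unitary: "isom d X \<longleftrightarrow> unitary_map d d (mat d d X)"
proof -
  have c: "mat d d X \<in> carrier_mat d d" by simp
  have "isom d X \<longleftrightarrow> (\<forall>i<d. \<forall>j<d. (\<Sum>r<d. cnj (mat d d X $$ (r, i)) * mat d d X $$ (r, j)) = (if i = j then 1 else 0))"
    by (simp add: isom_def ctr_def ob_def)
  also have "\<dots> \<longleftrightarrow> unitary_map d d (mat d d X)"
  proof
    assume "\<forall>i<d. \<forall>j<d. (\<Sum>r<d. cnj (mat d d X $$ (r, i)) * mat d d X $$ (r, j)) = (if i = j then 1 else 0)"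
    then show "unitary_map d d (mat d d X)" by (intro unitary_mapI[OF c]) (simp only:)
  next
    assume "unitary_map d d (mat d d X)"
    then show "\<forall>i<d. \<forall>j<d. (\<Sum>r<d. cnj (mat d d X $$ (r, i)) * mat d d X $$ (r, j)) = (if i = j then 1 else 0)"
      unfolding unitary_map_def unitary_entries[OF c] by blast
  qed
  finally show ?thesis .
qed

lemma onb_unitariesD:
  assumes "onb_unitaries d U"
  shows "i < d^2 \<Longrightarrow> unitary_map d d (U i)"
    and "i < d^2 \<Longrightarrow> j < d^2 \<Longrightarrow> cinner (dket (U i)) (dket (U j)) = (if i = j then of_nat d else 0)"
proof -
  note parts = assms[unfolded onb_unitaries_def]
  show "i < d^2 \<Longrightarrow> unitary_map d d (U i)"
    using conjunct1[OF parts] by blast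
  show "i < d^2 \<Longrightarrow> j < d^2 \<Longrightarrow> cinner (dket (U i)) (dket (U j)) = (if i = j then of_nat d else 0)"
    using conjunct2[OF conjunct2[OF conjunct2[OF parts]]] by (simp only:)
qed

text \<open>Orthonormality says that the matrix of basis vectors has its scaled adjoint as a left
  inverse; completeness is the same product in the other order.\<close>

lemma onb_completeness:
  assumes onb: "onb_unitaries d U" and d: "0 < d" and xz: "x \<in> sq d" "z \<in> sq d"
  shows "(\<Sum>i<d^2. cnj (U i $$ x) * U i $$ z) = (if x = z then of_nat d else 0)"
proof -
  have d2: "d\<^sup>2 = d * d" by (simp add: power2_eq_square)
  have car: "U i \<in> carrier_mat d d" if "i < d * d" for i
    using onb_unitariesD(1)[OF onb, of i] that by (simp add: unitary_map_def d2)
  define A where "A i k = cnj (dket (U i) $ k) / of_nat d" for i k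
  define B where "B k j = dket (U j) $ k" for k j
  have AB: "(\<Sum>k<d * d. A i k * B k j) = (if i = j then 1 else 0)" if "i < d * d" "j < d * d" for i j
  proof -
    have "cinner (dket (U i)) (dket (U j)) = (if i = j then of_nat d else 0)"
      using onb_unitariesD(2)[OF onb, of i j] that by (simp add: d2)
    moreover have "dim_vec (dket (U i)) = d * d" using car[OF that(1)] by (simp add: dket_def)
    ultimately have "(\<Sum>k<d * d. cnj (dket (U i) $ k) * dket (U j) $ k) = (if i = j then of_nat d else 0)"
      by (simp add: cinner_def)
    then show ?thesis using d by (simp add: A_def B_def flip: sum_divide_distrib)
  qed
  obtain r c r' c' where rc: "x = (r, c)" "z = (r', c')" "r < d" "c < d" "r' < d" "c' < d"
    using xz by (auto simp: sq_def)
  have k: "c * d + r < d * d" "c' * d + r' < d * d" using rc by (simp_all add: pair_index_less)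
  have e: "dket (U i) $ (c * d + r) = U i $$ (r, c)" if "c < d" "r < d" "i < d * d" for i c r
    using car[OF that(3)] that by (simp add: dket_def pair_index_less)
  have "(\<Sum>i<d * d. B (c' * d + r') i * A i (c * d + r)) = (if c' * d + r' = c * d + r then 1 else 0)"
    using k by (intro kernel_left_right_inverse[where A = A and B = B, OF _ AB]) simp_all
  then have "(\<Sum>i<d * d. U i $$ z * cnj (U i $$ x)) = of_nat d * (if x = z then 1 else 0)"
    using d rc by (simp add: A_def B_def e pair_index_cong flip: sum_divide_distrib) auto
  then show ?thesis by (simp add: d2 mult.commute)
qed

text \<open>For a fixed unitary \<open>Y\<close>, expanding first \<open>Y\<close> and then the other argument in the unitary bases
  recovers the coefficients of \<open>g (_, Y)\<close>: each step only uses linearity at unitary arguments.\<close>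
lemma bilinear_coefficients:
  fixes g :: "complex mat \<Rightarrow> complex mat \<Rightarrow> complex"
  assumes U: "onb_unitaries a U" and V: "onb_unitaries b V" and pos: "0 < a" "0 < b"
    and gA: "\<And>X Y. unitary_map a a X \<Longrightarrow> unitary_map b b Y \<Longrightarrow> g X Y = (\<Sum>z\<in>sq a. F Y z * X $$ z)"
    and gB: "\<And>X Y. unitary_map a a X \<Longrightarrow> unitary_map b b Y \<Longrightarrow> g X Y = (\<Sum>z\<in>sq b. H X z * Y $$ z)"
    and Y: "unitary_map b b Y" and x: "x \<in> sq a"
  shows "(\<Sum>y\<in>sq b. (1 / (of_nat a * of_nat b)) *
      (\<Sum>i<a^2. \<Sum>j<b^2. g (U i) (V j) * cnj (U i $$ x) * cnj (V j $$ y)) * Y $$ y) = F Y x"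
proof -
  have uU: "unitary_map a a (U i)" if "i < a^2" for i using onb_unitariesD(1)[OF U that] .
  have uV: "unitary_map b b (V i)" if "i < b^2" for i using onb_unitariesD(1)[OF V that] .
  have gY: "(\<Sum>y\<in>sq b. \<Sum>j<b^2. g (U i) (V j) * cnj (V j $$ y) * Y $$ y) = of_nat b * g (U i) Y" if i: "i < a^2" for i
  proof -
    have "(\<Sum>y\<in>sq b. \<Sum>j<b^2. g (U i) (V j) * cnj (V j $$ y) * Y $$ y) =
      (\<Sum>y\<in>sq b. \<Sum>j<b^2. \<Sum>z\<in>sq b. H (U i) z * Y $$ y * (cnj (V j $$ y) * V j $$ z))"
      using uU[OF i] uV by (intro sum.cong refl) (simp add: gB sum_distrib_left sum_distrib_right mult_ac)
    also have "\<dots> = (\<Sum>y\<in>sq b. \<Sum>z\<in>sq b. H (U i) z * Y $$ y * (\<Sum>j<b^2. cnj (V j $$ y) * V j $$ z))"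
      unfolding sum_distrib_left by (intro sum.cong[OF refl] sum.swap)
    also have "\<dots> = (\<Sum>y\<in>sq b. \<Sum>z\<in>sq b. if y = z then of_nat b * (H (U i) z * Y $$ y) else 0)"
      by (intro sum.cong refl) (simp add: onb_completeness[OF V pos(2)])
    also have "\<dots> = of_nat b * g (U i) Y"
      using uU[OF i] Y by (simp add: gB sum_distrib_left)
    finally show ?thesis .
  qed
  have "(\<Sum>y\<in>sq b. (1 / (of_nat a * of_nat b)) *
      (\<Sum>i<a^2. \<Sum>j<b^2. g (U i) (V j) * cnj (U i $$ x) * cnj (V j $$ y)) * Y $$ y) =
    (1 / (of_nat a * of_nat b)) * (\<Sum>y\<in>sq b. \<Sum>i<a^2. cnj (U i $$ x) * (\<Sum>j<b^2. g (U i) (V j) * cnj (V j $$ y) * Y $$ y))"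
    by (simp add: sum_distrib_left sum_distrib_right mult_ac)
  also have "(\<Sum>y\<in>sq b. \<Sum>i<a^2. cnj (U i $$ x) * (\<Sum>j<b^2. g (U i) (V j) * cnj (V j $$ y) * Y $$ y)) =
    (\<Sum>i<a^2. \<Sum>y\<in>sq b. cnj (U i $$ x) * (\<Sum>j<b^2. g (U i) (V j) * cnj (V j $$ y) * Y $$ y))"
    by (rule sum.swap)
  also have "\<dots> = (\<Sum>i<a^2. cnj (U i $$ x) * (of_nat b * g (U i) Y))"
    by (intro sum.cong refl) (simp add: gY flip: sum_distrib_left)
  also have "\<dots> = (\<Sum>i<a^2. \<Sum>z\<in>sq a. of_nat b * F Y z * (cnj (U i $$ x) * U i $$ z))"
    using uU Y by (intro sum.cong refl) (simp add: gA sum_distrib_left mult_ac)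
  also have "\<dots> = (\<Sum>z\<in>sq a. of_nat b * F Y z * (\<Sum>i<a^2. cnj (U i $$ x) * U i $$ z))"
    unfolding sum_distrib_left by (rule sum.swap)
  also have "\<dots> = (\<Sum>z\<in>sq a. if x = z then of_nat a * of_nat b * F Y z else 0)"
    by (intro sum.cong refl) (simp add: onb_completeness[OF U pos(1) x])
  also have "\<dots> = of_nat a * of_nat b * F Y x"
    using x by simp
  finally show ?thesis using pos by simp
qed

text \<open>The coefficient of \<open>X $$ x\<close> in entry \<open>(f, p)\<close> of
  \<open>\<Phi> (X \<otimes> 1) \<Theta>\<close>.\<close>

definition frame_coeff :: "nat \<Rightarrow> complex mat \<Rightarrow> complex mat \<Rightarrow> nat \<Rightarrow> nat \<Rightarrow> nat \<times> nat \<Rightarrow> complex" where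
  "frame_coeff e \<Phi> \<Theta> f p x = (\<Sum>k<e. \<Phi> $$ (f, fst x * e + k) * \<Theta> $$ (snd x * e + k, p))"

lemma frame_entry:
  assumes \<Phi>: "\<Phi> \<in> carrier_mat n (d * e)" and \<Theta>: "\<Theta> \<in> carrier_mat (d * e) n" and X: "X \<in> carrier_mat d d"
    and fp: "f < n" "p < n"
  shows "(\<Phi> * kron X (1\<^sub>m e) * \<Theta>) $$ (f, p) = (\<Sum>x\<in>sq d. frame_coeff e \<Phi> \<Theta> f p x * X $$ x)"
proof -
  have k: "kron X (1\<^sub>m e) \<in> carrier_mat (d * e) (d * e)" using X by (simp add: kron_def)
  have ke: "kron X (1\<^sub>m e) $$ (r * e + m, c * e + m') = (if m = m' then X $$ (r, c) else 0)"
    if "r < d" "c < d" "m < e" "m' < e" for r c m m'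
    using X that by (simp add: kron_def pair_index_less)
  have "(\<Phi> * kron X (1\<^sub>m e) * \<Theta>) $$ (f, p) =
     (\<Sum>c<d. \<Sum>m'<e. (\<Sum>r<d. \<Sum>m<e. \<Phi> $$ (f, r * e + m) * kron X (1\<^sub>m e) $$ (r * e + m, c * e + m')) * \<Theta> $$ (c * e + m', p))"
    using \<Phi> \<Theta> k fp by (simp add: scalar_prod_def atLeast0LessThan sum_pair_index pair_index_less del: assoc_mult_mat)
  also have "\<dots> = (\<Sum>c<d. \<Sum>m'<e. (\<Sum>r<d. \<Sum>m<e. if m = m' then \<Phi> $$ (f, r * e + m) * X $$ (r, c) else 0) * \<Theta> $$ (c * e + m', p))"
    by (intro sum.cong refl arg_cong2[of _ _ _ _ times]) (simp add: ke)
  also have "\<dots> = (\<Sum>c<d. \<Sum>m'<e. \<Sum>r<d. \<Phi> $$ (f, r * e + m') * \<Theta> $$ (c * e + m', p) * X $$ (r, c))"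
    by (simp add: sum_distrib_left sum_distrib_right mult_ac)
  also have "\<dots> = (\<Sum>c<d. \<Sum>r<d. \<Sum>m'<e. \<Phi> $$ (f, r * e + m') * \<Theta> $$ (c * e + m', p) * X $$ (r, c))"
    by (intro sum.cong[OF refl] sum.swap)
  also have "\<dots> = (\<Sum>r<d. \<Sum>c<d. \<Sum>m'<e. \<Phi> $$ (f, r * e + m') * \<Theta> $$ (c * e + m', p) * X $$ (r, c))"
    by (rule sum.swap)
  finally show ?thesis
    by (simp add: sum_sq frame_coeff_def sum_distrib_right)
qed

text \<open>\<open>\<Phi>\<close> cancels against its adjoint, so only
  \<open>\<Theta>\<^sup>* (X\<^sup>* X' \<otimes> 1) \<Theta>\<close> remains; a scalar contraction
  then lets \<open>\<Theta>\<close> cancel as well.\<close>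

lemma frame_pairing:
  assumes \<Phi>: "unitary_map (d * e) n \<Phi>" and \<Theta>: "unitary_map n (d * e) \<Theta>"
    and ctr: "\<And>i j. i < d \<Longrightarrow> j < d \<Longrightarrow> ctr d u i j = (if i = j then c else 0)" and pq: "p < n" "q < n"
  shows "pairing d (\<lambda>x x'. \<Sum>f<n. cnj (frame_coeff e \<Phi> \<Theta> f p x) * frame_coeff e \<Phi> \<Theta> f q x') u = (if p = q then c else 0)"
proof -
  have \<Phi>1: "(\<Sum>f<n. cnj (\<Phi> $$ (f, i)) * \<Phi> $$ (f, j)) = (if i = j then 1 else 0)" if "i < d * e" "j < d * e" for i j
    using \<Phi> unitary_entries[of \<Phi> n "d * e"] that unfolding unitary_map_def by blast
  have \<Theta>1: "(\<Sum>z<d * e. cnj (\<Theta> $$ (z, p)) * \<Theta> $$ (z, q)) = (if p = q then 1 else 0)"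
    using \<Theta> unitary_entries[of \<Theta> "d * e" n] pq unfolding unitary_map_def by blast
  define h where "h i j = (\<Sum>k<e. cnj (\<Theta> $$ (i * e + k, p)) * \<Theta> $$ (j * e + k, q))" for i j
  have inner: "(\<Sum>f<n. cnj (frame_coeff e \<Phi> \<Theta> f p (r, i)) * frame_coeff e \<Phi> \<Theta> f q (r', j)) = (if r = r' then h i j else 0)"
    if b: "r < d" "r' < d" for r r' i j
  proof -
    have "(\<Sum>f<n. cnj (frame_coeff e \<Phi> \<Theta> f p (r, i)) * frame_coeff e \<Phi> \<Theta> f q (r', j)) =
      (\<Sum>f<n. \<Sum>k<e. \<Sum>k'<e. cnj (\<Theta> $$ (i * e + k, p)) * \<Theta> $$ (j * e + k', q) * (cnj (\<Phi> $$ (f, r * e + k)) * \<Phi> $$ (f, r' * e + k')))"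
      unfolding frame_coeff_def cnj_sum sum_product by (simp add: mult_ac)
    also have "\<dots> = (\<Sum>k<e. \<Sum>f<n. \<Sum>k'<e. cnj (\<Theta> $$ (i * e + k, p)) * \<Theta> $$ (j * e + k', q) * (cnj (\<Phi> $$ (f, r * e + k)) * \<Phi> $$ (f, r' * e + k')))"
      by (rule sum.swap)
    also have "\<dots> = (\<Sum>k<e. \<Sum>k'<e. cnj (\<Theta> $$ (i * e + k, p)) * \<Theta> $$ (j * e + k', q) * (\<Sum>f<n. cnj (\<Phi> $$ (f, r * e + k)) * \<Phi> $$ (f, r' * e + k')))"
      unfolding sum_distrib_left by (intro sum.cong[OF refl] sum.swap)
    also have "\<dots> = (\<Sum>k<e. \<Sum>k'<e. if k = k' then if r = r' then cnj (\<Theta> $$ (i * e + k, p)) * \<Theta> $$ (j * e + k', q) else 0 else 0)"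
      using b by (intro sum.cong refl) (auto simp: \<Phi>1 pair_index_less pair_index_cong)
    also have "\<dots> = (if r = r' then h i j else 0)"
      by (simp add: h_def)
    finally show ?thesis .
  qed
  have "pairing d (\<lambda>x x'. \<Sum>f<n. cnj (frame_coeff e \<Phi> \<Theta> f p x) * frame_coeff e \<Phi> \<Theta> f q x') u =
    (\<Sum>r<d. \<Sum>i<d. \<Sum>r'<d. \<Sum>j<d. (if r = r' then h i j else 0) * u (r, i) (r', j))"
    unfolding pairing_def sum_sq by (intro sum.cong refl arg_cong2[of _ _ _ _ times]) (simp add: inner)
  also have "\<dots> = (\<Sum>r<d. \<Sum>i<d. \<Sum>r'<d. if r = r' then \<Sum>j<d. h i j * u (r, i) (r', j) else 0)"
    by (intro sum.cong refl) auto
  also have "\<dots> = (\<Sum>r<d. \<Sum>i<d. \<Sum>j<d. h i j * u (r, i) (r, j))"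
    by simp
  also have "\<dots> = (\<Sum>i<d. \<Sum>r<d. \<Sum>j<d. h i j * u (r, i) (r, j))"
    by (rule sum.swap)
  also have "\<dots> = (\<Sum>i<d. \<Sum>j<d. h i j * ctr d u i j)"
    unfolding ctr_def sum_distrib_left by (intro sum.cong[OF refl] sum.swap)
  also have "\<dots> = (\<Sum>i<d. \<Sum>j<d. if i = j then c * h i j else 0)"
    by (intro sum.cong refl) (simp add: ctr)
  also have "\<dots> = c * (\<Sum>z<d * e. cnj (\<Theta> $$ (z, p)) * \<Theta> $$ (z, q))"
    by (simp add: h_def sum_pair_index sum_distrib_left)
  finally show ?thesis by (simp add: \<Theta>1)
qed

lemma pairing_ker_ob:
  "pairing b (ker n l p q x x') (ob Y Y) = (\<Sum>f<n. cnj (\<Sum>y\<in>sq b. l f p x y * Y y) * (\<Sum>y\<in>sq b. l f q x' y * Y y))"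
proof -
  have "pairing b (ker n l p q x x') (ob Y Y) =
    (\<Sum>y\<in>sq b. \<Sum>y'\<in>sq b. \<Sum>f<n. cnj (l f p x y * Y y) * (l f q x' y' * Y y'))"
    by (simp add: pairing_def ker_def ob_def sum_distrib_left sum_distrib_right mult_ac)
  also have "\<dots> = (\<Sum>y\<in>sq b. \<Sum>f<n. \<Sum>y'\<in>sq b. cnj (l f p x y * Y y) * (l f q x' y' * Y y'))"
    by (intro sum.cong[OF refl] sum.swap)
  also have "\<dots> = (\<Sum>f<n. \<Sum>y\<in>sq b. \<Sum>y'\<in>sq b. cnj (l f p x y * Y y) * (l f q x' y' * Y y'))"
    by (rule sum.swap)
  finally show ?thesis by (simp only: cnj_sum sum_product)
qed

lemma bform_frame:
  assumes coeff: "\<And>f p x. f < n \<Longrightarrow> p < n \<Longrightarrow> x \<in> sq a \<Longrightarrow> (\<Sum>y\<in>sq b. l f p x y * Y y) = frame_coeff e \<Phi> \<Theta> f p x"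
    and \<Phi>: "unitary_map (a * e) n \<Phi>" and \<Theta>: "unitary_map n (a * e) \<Theta>"
    and ctr: "\<And>i j. i < a \<Longrightarrow> j < a \<Longrightarrow> ctr a u i j = (if i = j then c else 0)" and pq: "p < n" "q < n"
  shows "bform n a b l u (ob Y Y) p q = (if p = q then c else 0)"
proof -
  have "bform n a b l u (ob Y Y) p q =
    pairing a (\<lambda>x x'. \<Sum>f<n. cnj (frame_coeff e \<Phi> \<Theta> f p x) * frame_coeff e \<Phi> \<Theta> f q x') u"
    unfolding bform_def pairing_ker_ob
    unfolding pairing_def using pq by (intro sum.cong refl) (simp add: coeff)
  then show ?thesis using frame_pairing[OF \<Phi> \<Theta> ctr pq] by simp
qed

lemma bform_swap: "bform n a b l u v p q = bform n b a (\<lambda>f p y x. l f p x y) v u p q"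
  unfolding bform_alt[of n a b l] unfolding bform_def by (simp add: ker_def[abs_def])

lemma vkron_index: "i < dim_vec v \<Longrightarrow> j < dim_vec w \<Longrightarrow> vkron v w $ (i * dim_vec w + j) = v $ i * w $ j"
  by (cases "dim_vec w = 0") (simp_all add: vkron_def pair_index_less)

theorem theorem2:
  fixes dP dF dAI dAO dBI dBO dEA dEB dA dB :: nat
    and PiA PhiA PiB PhiB :: "complex mat \<Rightarrow> complex mat"
    and U V :: "nat \<Rightarrow> complex mat"
    and G :: "complex mat \<Rightarrow> complex mat \<Rightarrow> complex mat"
    and w :: "complex vec"
  assumes pos: "0 < dP" "0 < dF" "0 < dAI" "0 < dAO" "0 < dBI" "0 < dBO" "0 < dEA" "0 < dEB"
    and dimA: "dAI = dA" "dAO = dA"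
    and dimB: "dBI = dB" "dBO = dB"
    and dimPF: "dP = dF" "dF = dA * dEA" "dA * dEA = dB * dEB"
    and frA: "frame_function_A dP dF dAI dAO dBI dBO dEA PiA PhiA"
    and frB: "frame_function_B dP dF dAI dAO dBI dBO dEB PiB PhiB"
    and G_def: "\<And>UA UB. G UA UB = PhiA UB * kron UA (1\<^sub>m dEA) * PiA UB"
    and consistent: "\<And>UA UB. unitary_map dAI dAO UA \<Longrightarrow> unitary_map dBI dBO UB \<Longrightarrow>
          PhiA UB * kron UA (1\<^sub>m dEA) * PiA UB = PhiB UA * kron UB (1\<^sub>m dEB) * PiB UA"
    and onbU: "onb_unitaries dA U"
    and onbV: "onb_unitaries dB V"
    and w_def: "w = vec (dP * dF * dAI * dAO * dBI * dBO) (\<lambda>k.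
          (1 / (of_nat dA * of_nat dB)) *
          (\<Sum>i<dA^2. \<Sum>j<dB^2.
             vkron (vkron (dket (G (U i) (V j))) (dket (cconj (U i)))) (dket (cconj (V j))) $ k))"
  shows "process_matrix dP dF dAI dAO dBI dBO (proj w) \<and> pure_process dP dF dAI dAO dBI dBO (proj w)"
proof -
  define n a b where "n = dP" and "a = dA" and "b = dB"
  have dims: "dP = n" "dF = n" "dAI = a" "dAO = a" "dBI = b" "dBO = b" "dA = a" "dB = b"
    using dimA dimB dimPF by (simp_all add: n_def a_def b_def)
  note [simp] = dims
  have ab: "0 < a" "0 < b" using pos by simp_all
  have onb: "onb_unitaries a U" "onb_unitaries b V" using onbU onbV by simp_all
  have frA': "unitary_map n (a * dEA) (PiA Y)" "unitary_map (a * dEA) n (PhiA Y)" if "unitary_map b b Y" for Y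
    using frA that unfolding frame_function_A_def dims by blast+
  have frB': "unitary_map n (b * dEB) (PiB X)" "unitary_map (b * dEB) n (PhiB X)" if "unitary_map a a X" for X
    using frB that unfolding frame_function_B_def dims by blast+
  have GA: "G X Y $$ (f, p) = (\<Sum>z\<in>sq a. frame_coeff dEA (PhiA Y) (PiA Y) f p z * X $$ z)"
    if "unitary_map a a X" "unitary_map b b Y" "f < n" "p < n" for X Y f p
    unfolding G_def using frA'[OF that(2)] that by (intro frame_entry) (simp_all add: unitary_map_def)
  have GB: "G X Y $$ (f, p) = (\<Sum>z\<in>sq b. frame_coeff dEB (PhiB X) (PiB X) f p z * Y $$ z)"
    if "unitary_map a a X" "unitary_map b b Y" "f < n" "p < n" for X Y f p
  proof -
    have "G X Y = PhiB X * kron Y (1\<^sub>m dEB) * PiB X"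
      using consistent[of X Y] that by (simp add: G_def)
    then show ?thesis
      using frB'[OF that(1)] that by (simp only:) (intro frame_entry, simp_all add: unitary_map_def)
  qed
  have G_carrier: "G (U i) (V j) \<in> carrier_mat n n" if "j < b\<^sup>2" for i j
    using frA'[OF onb_unitariesD(1)[OF onb(2) that]] by (auto simp: G_def unitary_map_def)
  have U_carrier: "U i \<in> carrier_mat a a" if "i < a\<^sup>2" for i
    using onb_unitariesD(1)[OF onb(1) that] by (simp add: unitary_map_def)
  have V_carrier: "V i \<in> carrier_mat b b" if "i < b\<^sup>2" for i
    using onb_unitariesD(1)[OF onb(2) that] by (simp add: unitary_map_def)
  define l where "l = w_coeff n a b w"
  have l: "l f p x y = (1 / (of_nat a * of_nat b)) *
      (\<Sum>i<a^2. \<Sum>j<b^2. G (U i) (V j) $$ (f, p) * cnj (U i $$ x) * cnj (V j $$ y))"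
    if fp: "f < n" "p < n" and xy: "x \<in> sq a" "y \<in> sq b" for f p x y
  proof -
    obtain ao ai bo bi where z: "x = (ao, ai)" "y = (bo, bi)" "ao < a" "ai < a" "bo < b" "bi < b"
      using xy by (auto simp: sq_def)
    \<comment> \<open>A position in \<open>w\<close>, grouped by the three nested
      \<open>vkron\<close> factors instead of digit by digit.\<close>
    define k where "k = ((p * n + f) * (a * a) + (ai * a + ao)) * (b * b) + (bi * b + bo)"
    have k: "enc [n, n, a, a, b, b] [p, f, ai, ao, bi, bo] = k"
      by (simp add: enc_Cons enc_Nil k_def algebra_simps)
    have lt: "p * n + f < n * n" "ai * a + ao < a * a" "bi * b + bo < b * b"
      using fp z by (simp_all add: pair_index_less)
    have lt2: "(p * n + f) * (a * a) + (ai * a + ao) < n * n * (a * a)" "k < n * n * (a * a) * (b * b)"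
      using lt by (simp_all add: k_def pair_index_less)
    have "vkron (vkron (dket (G (U i) (V j))) (dket (cconj (U i)))) (dket (cconj (V j))) $ k =
      G (U i) (V j) $$ (f, p) * cnj (U i $$ x) * cnj (V j $$ y)" if ij: "i < a^2" "j < b^2" for i j
    proof -
      have d: "dim_vec (dket (G (U i) (V j))) = n * n" "dim_vec (dket (cconj (U i))) = a * a" "dim_vec (dket (cconj (V j))) = b * b"
        using G_carrier[OF ij(2), of i] U_carrier[OF ij(1)] V_carrier[OF ij(2)] by (simp_all add: dket_def cconj_def)
      have e: "dket (G (U i) (V j)) $ (p * n + f) = G (U i) (V j) $$ (f, p)"
        "dket (cconj (U i)) $ (ai * a + ao) = cnj (U i $$ x)" "dket (cconj (V j)) $ (bi * b + bo) = cnj (V j $$ y)"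
        using G_carrier[OF ij(2), of i] U_carrier[OF ij(1)] V_carrier[OF ij(2)] lt fp z by (simp_all add: dket_def cconj_def)
      have d': "dim_vec (vkron (dket (G (U i) (V j))) (dket (cconj (U i)))) = n * n * (a * a)"
        by (simp add: vkron_def d)
      show ?thesis
        using vkron_index[of "(p * n + f) * (a * a) + (ai * a + ao)" "vkron (dket (G (U i) (V j))) (dket (cconj (U i)))"
            "bi * b + bo" "dket (cconj (V j))"]
          vkron_index[of "p * n + f" "dket (G (U i) (V j))" "ai * a + ao" "dket (cconj (U i))"] lt lt2(1)
        unfolding d d' e k_def by simp
    qed
    moreover have "k < n * n * a * a * b * b" using lt2(2) by (simp add: mult.assoc)
    ultimately show ?thesis
      using z by (simp add: l_def w_coeff_def k w_def)
  qed
  interpret two_slot n a b l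
  proof
    fix Y u c p q
    assume Y: "isom b Y" and ctr: "\<And>i j. i < a \<Longrightarrow> j < a \<Longrightarrow> ctr a u i j = (if i = j then c else 0)"
      and pq: "p < n" "q < n"
    define Y' where "Y' = mat b b Y"
    have uY: "unitary_map b b Y'" using Y by (simp add: isom_iff_unitary Y'_def)
    have coeff: "(\<Sum>y\<in>sq b. l f p x y * Y y) = frame_coeff dEA (PhiA Y') (PiA Y') f p x"
      if f: "f < n" "p < n" and x: "x \<in> sq a" for f p x
    proof -
      have "(\<Sum>y\<in>sq b. l f p x y * Y y) = (\<Sum>y\<in>sq b. (1 / (of_nat a * of_nat b)) *
        (\<Sum>i<a^2. \<Sum>j<b^2. G (U i) (V j) $$ (f, p) * cnj (U i $$ x) * cnj (V j $$ y)) * Y' $$ y)"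
        by (intro sum.cong refl arg_cong2[of _ _ _ _ times] l f x) (auto simp: Y'_def sq_def)
      also have "\<dots> = frame_coeff dEA (PhiA Y') (PiA Y') f p x"
        by (rule bilinear_coefficients[where g = "\<lambda>X Y. G X Y $$ (f, p)" and F = "\<lambda>Y. frame_coeff dEA (PhiA Y) (PiA Y) f p"
              and H = "\<lambda>X. frame_coeff dEB (PhiB X) (PiB X) f p", OF onb ab _ _ uY x])
           (rule GA[OF _ _ f] GB[OF _ _ f]; assumption)+
      finally show ?thesis .
    qed
    show "bform n a b l u (ob Y Y) p q = (if p = q then c else 0)"
      by (rule bform_frame[OF coeff frA'(2,1)[OF uY] ctr pq])
  next
    fix X v c p q
    assume X: "isom a X" and ctr: "\<And>i j. i < b \<Longrightarrow> j < b \<Longrightarrow> ctr b v i j = (if i = j then c else 0)"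
      and pq: "p < n" "q < n"
    define X' where "X' = mat a a X"
    have uX: "unitary_map a a X'" using X by (simp add: isom_iff_unitary X'_def)
    have coeff: "(\<Sum>x\<in>sq a. l f p x y * X x) = frame_coeff dEB (PhiB X') (PiB X') f p y"
      if f: "f < n" "p < n" and y: "y \<in> sq b" for f p y
    proof -
      \<comment> \<open>With the parties exchanged, \<open>bilinear_coefficients\<close> sums over
        Bob's basis first.\<close>
      have "(\<Sum>x\<in>sq a. l f p x y * X x) = (\<Sum>x\<in>sq a. (1 / (of_nat b * of_nat a)) *
        (\<Sum>j<b^2. \<Sum>i<a^2. G (U i) (V j) $$ (f, p) * cnj (V j $$ y) * cnj (U i $$ x)) * X' $$ x)"
      proof (intro sum.cong refl arg_cong2[of _ _ _ _ times])
        fix x assume x: "x \<in> sq a"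
        have "l f p x y = (1 / (of_nat a * of_nat b)) *
          (\<Sum>j<b^2. \<Sum>i<a^2. G (U i) (V j) $$ (f, p) * cnj (U i $$ x) * cnj (V j $$ y))"
          unfolding l[OF f x y] by (subst sum.swap) (rule refl)
        then show "l f p x y = (1 / (of_nat b * of_nat a)) *
          (\<Sum>j<b^2. \<Sum>i<a^2. G (U i) (V j) $$ (f, p) * cnj (V j $$ y) * cnj (U i $$ x))"
          by (simp add: mult_ac)
      qed (auto simp: X'_def sq_def)
      also have "\<dots> = frame_coeff dEB (PhiB X') (PiB X') f p y"
        by (rule bilinear_coefficients[where g = "\<lambda>Y X. G X Y $$ (f, p)" and F = "\<lambda>X. frame_coeff dEB (PhiB X) (PiB X) f p"
              and H = "\<lambda>Y. frame_coeff dEA (PhiA Y) (PiA Y) f p", OF onb(2,1) ab(2,1) _ _ uX y])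
           (rule GA[OF _ _ f] GB[OF _ _ f]; assumption)+
      finally show ?thesis .
    qed
    show "bform n a b l (ob X X) v p q = (if p = q then c else 0)"
      unfolding bform_swap[of n a b] by (rule bform_frame[OF coeff frB'(2,1)[OF uX] ctr pq])
  qed
  have "dim_vec w = n * n * a * a * b * b" by (simp add: w_def)
  then show ?thesis
    using process_and_pure[OF l_def _ ab] by simp
qed

end
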